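(* Let $m,n$ be positive integers. A generic strictly proper skew-symmetric (respectively skew-Hamiltonian) transfer function $G(s)$ with $m$ inputs, $m$ outputs, and McMillan degree $n$ (with $n$ even in the skew-symmetric case) is pole-assignable with complex static skew-symmetric feedback compensators if and only if $\lfloor n/2\rfloor\le\binom{m}{2}$.
   Context: Everything is over $\mathbb{C}$. A strictly proper transfer function with $m$ inputs, $m$ outputs and McMillan degree $n$ is $G(s)=C(sI_n-A)^{-1}B$ with $A\in\mathbb{C}^{n\times n}$, $B\in\mathbb{C}^{n\times m}$, $C\in\mathbb{C}^{m\times n}$ a minimal realization. It is skew-symmetric if $G(s)^{\top}=-G(s)$ (then $n$ is even) and skew-Hamiltonian if $G(s)^{\top}=-G(-s)$, for all $s$. For each symmetry type the set of such transfer functions is an irreducible quasiprojective variety; a property is generic if it holds on a nonempty Zariski-open subset of this variety. A static skew-symmetric feedback compensator is a skew-symmetric matrix $F\in\mathbb{C}^{m\times m}$ ($u=Fy+v$ in the system $\dot x=Ax+Bu$, $y=Cx$), giving the closed-loop characteristic polynomial $\varphi(s)=\det(sI_n-(A+BFC))$, which depends only on $G$ and $F$. For $F$ skew-symmetric the closed-loop system has the same symmetry as $G$: in the skew-symmetric case $\varphi$ is the square of a monic polynomial of degree $n/2$, and in the skew-Hamiltonian case $\varphi(s)=(-1)^n\varphi(-s)$. $G$ is pole-assignable with complex static skew-symmetric feedback compensators if the map $F\mapsto\varphi(s)$, from complex skew-symmetric $m\times m$ matrices to the set of monic polynomials of degree $n$ having the respective form (squares of monic polynomials of degree $n/2$;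 respectively polynomials with $\varphi(s)=(-1)^n\varphi(-s)$), is dominant, i.e. its image is dense in that set. *)

theory Defs
  imports
    "Jordan_Normal_Form.Char_Poly"
    "Jordan_Normal_Form.Gauss_Jordan_Elimination"
    "HOL-Computational_Algebra.Computational_Algebra"
begin

text \<open>
  Zariski topology on a subset \<open>V\<close> of an affine space, given by its coordinate functions \<open>X\<close>.
  The points may have any type; only the coordinate functions matter.
\<close>

inductive_set polynomial_functions :: "('a \<Rightarrow> complex) set \<Rightarrow> ('a \<Rightarrow> complex) set"
  for X :: "('a \<Rightarrow> complex) set" where
  const: "(\<lambda>_. c) \<in> polynomial_functions X"
| coord: "x \<in> X \<Longrightarrow> x \<in> polynomial_functions X"
| add: "f \<in> polynomial_functions X \<Longrightarrow> g \<in> polynomial_functions X \<Longrightarrow>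
    (\<lambda>v. f v + g v) \<in> polynomial_functions X"
| mult: "f \<in> polynomial_functions X \<Longrightarrow> g \<in> polynomial_functions X \<Longrightarrow>
    (\<lambda>v. f v * g v) \<in> polynomial_functions X"

definition zariski_closed_in :: "('a \<Rightarrow> complex) set \<Rightarrow> 'a set \<Rightarrow> 'a set \<Rightarrow> bool" where
  "zariski_closed_in X V Z \<longleftrightarrow>
    (\<exists>P \<subseteq> polynomial_functions X. Z = {v \<in> V. \<forall>f\<in>P. f v = 0})"

definition zariski_open_in :: "('a \<Rightarrow> complex) set \<Rightarrow> 'a set \<Rightarrow> 'a set \<Rightarrow> bool" where
  "zariski_open_in X V U \<longleftrightarrow> U \<subseteq> V \<and> zariski_closed_in X V (V - U)"

definition zariski_dense_in :: "('a \<Rightarrow> complex) set \<Rightarrow> 'a set \<Rightarrow> 'a set \<Rightarrow> bool" where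
  "zariski_dense_in X V S \<longleftrightarrow>
    S \<subseteq> V \<and> (\<forall>Z. zariski_closed_in X V Z \<and> S \<subseteq> Z \<longrightarrow> Z = V)"

text \<open>Transfer functions are matrices over the field of rational functions in \<open>s\<close>.\<close>

abbreviation poly_to_rat :: "complex poly \<Rightarrow> complex poly fract" where
  "poly_to_rat p \<equiv> Fraction_Field.Fract p 1"

abbreviation const_mat :: "complex mat \<Rightarrow> complex poly fract mat" where
  "const_mat M \<equiv> map_mat (\<lambda>a. poly_to_rat [:a:]) M"

definition resolvent :: "complex mat \<Rightarrow> complex poly fract mat" where
  "resolvent A = the (mat_inverse (map_mat poly_to_rat (char_poly_matrix A)))"

lemma resolvent_inverse:
  assumes A: "A \<in> carrier_mat n n"
  shows "resolvent A \<in> carrier_mat n n"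
    and "map_mat poly_to_rat (char_poly_matrix A) * resolvent A = 1\<^sub>m n"
    and "resolvent A * map_mat poly_to_rat (char_poly_matrix A) = 1\<^sub>m n"
proof -
  interpret comm_ring_hom poly_to_rat
    by unfold_locales (auto simp: Zero_fract_def One_fract_def)
  let ?M = "map_mat poly_to_rat (char_poly_matrix A)"
  have M: "?M \<in> carrier_mat n n" using A by simp
  have "char_poly A \<noteq> 0" using degree_monic_char_poly[OF A] by auto
  moreover have "det ?M = poly_to_rat (char_poly A)"
    by (simp add: char_poly_def)
  ultimately have "det ?M \<noteq> 0"
    unfolding Zero_fract_def by (metis eq_fract(1) mult_1_right zero_neq_one)
  then have "?M \<in> Units (ring_mat TYPE(complex poly fract) n n)"
    by (rule det_non_zero_imp_unit[OF M])
  then have "mat_inverse ?M \<noteq> None"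
    using mat_inverse(1)[OF M, where b = n] by blast
  then obtain R where R: "mat_inverse ?M = Some R" by (rule not_None_eq[THEN iffD1, THEN exE])
  with mat_inverse(2)[OF M R]
  show "resolvent A \<in> carrier_mat n n" "?M * resolvent A = 1\<^sub>m n" "resolvent A * ?M = 1\<^sub>m n"
    unfolding resolvent_def R option.sel by blast+
qed

definition transfer_function ::
  "complex mat \<Rightarrow> complex mat \<Rightarrow> complex mat \<Rightarrow> complex poly fract mat" where
  "transfer_function A B C = const_mat C * resolvent A * const_mat B"

definition realization ::
  "nat \<Rightarrow> nat \<Rightarrow> complex poly fract mat \<Rightarrow> complex mat \<times> complex mat \<times> complex mat \<Rightarrow> bool" where
  "realization m n G = (\<lambda>(A, B, C).
    A \<in> carrier_mat n n \<and> B \<in> carrier_mat n m \<and> C \<in> carrier_mat m n \<and>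
    G = transfer_function A B C)"

definition minimal_realization ::
  "nat \<Rightarrow> nat \<Rightarrow> complex poly fract mat \<Rightarrow> complex mat \<times> complex mat \<times> complex mat \<Rightarrow> bool" where
  "minimal_realization m n G R \<longleftrightarrow>
    realization m n G R \<and> (\<forall>n' R'. realization m n' G R' \<longrightarrow> n \<le> n')"

text \<open>The McMillan degree of a transfer function is the least order of a realization.\<close>

definition transfer_functions :: "nat \<Rightarrow> nat \<Rightarrow> complex poly fract mat set" where
  "transfer_functions m n = {G. \<exists>R. minimal_realization m n G R}"

abbreviation poly_reflect :: "complex poly \<Rightarrow> complex poly" where
  "poly_reflect p \<equiv> pcompose p [:0, -1:]"

definition rat_reflect :: "complex poly fract \<Rightarrow> complex poly fract" where
  "rat_reflect r = (THE t. \<exists>p q. q \<noteq> 0 \<and> r = Fraction_Field.Fract p q \<and>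
    t = Fraction_Field.Fract (poly_reflect p) (poly_reflect q))"

lemma rat_reflect_Fract:
  assumes q: "q \<noteq> 0"
  shows "rat_reflect (Fraction_Field.Fract p q) =
    Fraction_Field.Fract (poly_reflect p) (poly_reflect q)"
  unfolding rat_reflect_def
proof (rule the_equality)
  have nz: "poly_reflect x \<noteq> 0" if "x \<noteq> 0" for x
    using that pcompose_eq_0[of x "[:0, -1:]"] by auto
  fix t
  assume "\<exists>p' q'. q' \<noteq> 0 \<and> Fraction_Field.Fract p q = Fraction_Field.Fract p' q' \<and>
    t = Fraction_Field.Fract (poly_reflect p') (poly_reflect q')"
  then obtain p' q' where q': "q' \<noteq> 0" and eq: "Fraction_Field.Fract p q = Fraction_Field.Fract p' q'"
    and t: "t = Fraction_Field.Fract (poly_reflect p') (poly_reflect q')" by blast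
  have "p * q' = p' * q" using eq eq_fract(1)[OF q q'] by blast
  then have "poly_reflect p * poly_reflect q' = poly_reflect p' * poly_reflect q"
    by (simp flip: pcompose_mult)
  then show "t = Fraction_Field.Fract (poly_reflect p) (poly_reflect q)"
    unfolding t eq_fract(1)[OF nz[OF q'] nz[OF q]] by simp
qed (rule exI[of _ p], rule exI[of _ q], simp add: q)

definition skew_symmetric_tfs :: "nat \<Rightarrow> nat \<Rightarrow> complex poly fract mat set" where
  "skew_symmetric_tfs m n = {G \<in> transfer_functions m n. G\<^sup>T = - G}"

definition skew_hamiltonian_tfs :: "nat \<Rightarrow> nat \<Rightarrow> complex poly fract mat set" where
  "skew_hamiltonian_tfs m n = {G \<in> transfer_functions m n. G\<^sup>T = - map_mat rat_reflect G}"

text \<open>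
  The variety of transfer functions of McMillan degree \<open>n\<close> is the geometric quotient of the
  space of minimal triples \<open>(A, B, C)\<close> by the change-of-basis action of \<open>GL\<^sub>n\<close>.  Hence its Zariski
  topology, and that of its closed subset of transfer functions with a given symmetry, is the
  quotient topology: a set is open iff the set of all minimal realizations of its members is.
\<close>

definition triple_coords ::
  "nat \<Rightarrow> nat \<Rightarrow> (complex mat \<times> complex mat \<times> complex mat \<Rightarrow> complex) set" where
  "triple_coords m n =
    {\<lambda>(A, B, C). A $$ (i, j) | i j. i < n \<and> j < n} \<union>
    {\<lambda>(A, B, C). B $$ (i, j) | i j. i < n \<and> j < m} \<union>
    {\<lambda>(A, B, C). C $$ (i, j) | i j. i < m \<and> j < n}"

definition minimal_triples ::
  "nat \<Rightarrow> nat \<Rightarrow> complex poly fract mat set \<Rightarrow> (complex mat \<times> complex mat \<times> complex mat) set" where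
  "minimal_triples m n T = {R. \<exists>G\<in>T. minimal_realization m n G R}"

definition tf_zariski_open ::
  "nat \<Rightarrow> nat \<Rightarrow> complex poly fract mat set \<Rightarrow> complex poly fract mat set \<Rightarrow> bool" where
  "tf_zariski_open m n T U \<longleftrightarrow> U \<subseteq> T \<and>
    zariski_open_in (triple_coords m n) (minimal_triples m n T) (minimal_triples m n U)"

definition generic ::
  "nat \<Rightarrow> nat \<Rightarrow> complex poly fract mat set \<Rightarrow> (complex poly fract mat \<Rightarrow> bool) \<Rightarrow> bool" where
  "generic m n T Q \<longleftrightarrow> (\<exists>U. tf_zariski_open m n T U \<and> U \<noteq> {} \<and> (\<forall>G\<in>U. Q G))"

definition skew_symmetric_mats :: "nat \<Rightarrow> complex mat set" where
  "skew_symmetric_mats m = {F \<in> carrier_mat m m. F\<^sup>T = - F}"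

definition square_polys :: "nat \<Rightarrow> complex poly set" where
  "square_polys n = {q\<^sup>2 | q. monic q \<and> degree q = n div 2}"

definition reflection_polys :: "nat \<Rightarrow> complex poly set" where
  "reflection_polys n = {p. monic p \<and> degree p = n \<and> p = Polynomial.smult ((-1) ^ n) (poly_reflect p)}"

definition poly_coords :: "nat \<Rightarrow> (complex poly \<Rightarrow> complex) set" where
  "poly_coords n = {\<lambda>p. coeff p k | k. k < n}"

text \<open>
  Minimal realizations of \<open>G\<close> are unique up to change of basis, so the closed-loop characteristic
  polynomial, and with it the following notion, does not depend on the realization chosen.
\<close>

definition pole_assignable ::
  "nat \<Rightarrow> nat \<Rightarrow> complex poly set \<Rightarrow> complex poly fract mat \<Rightarrow> bool" where
  "pole_assignable m n V G \<longleftrightarrow>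
    (\<exists>A B C. minimal_realization m n G (A, B, C) \<and>
      zariski_dense_in (poly_coords n) V
        ((\<lambda>F. char_poly (A + B * F * C)) ` skew_symmetric_mats m))"

end

theory Submission
  imports Defs "HOL-Computational_Algebra.Field_as_Ring"
begin

text \<open>
  Write \<open>N\<close> for \<open>n div 2\<close> and \<open>h\<^sub>p = C A\<^sup>p B\<close>
  for the Markov parameters, and let the sign \<open>\<sigma>\<close> be \<open>1\<close> in the
  skew-symmetric and \<open>-1\<close> in the skew-Hamiltonian case. A transfer function
  determines its Markov parameters and is determined by them, and the symmetry of
  \<open>G\<close> says that \<open>h\<^sub>p\<close> transposed is
  \<open>- \<sigma>\<^bsup>p+1\<^esup> h\<^sub>p\<close> for all \<open>p\<close>
  (\<open>transpose_eq_iff_markov_symmetric\<close>). Both varieties of target polynomials are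
  affine spaces of dimension \<open>N\<close>: on each of them \<open>N\<close> of the
  coefficients can be prescribed freely, and the others are polynomials in these
  (\<open>square_polys_chart\<close>, \<open>reflection_polys_chart\<close>).

  Necessity is a dimension count, valid for every \<open>G\<close>. The coefficients of the
  closed-loop characteristic polynomial are polynomials in the \<open>m choose 2\<close> free
  entries of \<open>F\<close>. If this is less than \<open>N\<close>, then the \<open>N\<close>
  coordinates satisfy a nontrivial polynomial relation (\<open>algebraic_dependence\<close>),
  and the image lies in a proper closed subset.

  For sufficiency, the derivative of the closed-loop characteristic polynomial at
  \<open>F = 0\<close> in the direction \<open>F\<close> depends, through a triangular change of
  coordinates, on the traces of the \<open>F h\<^sub>p\<close>
  (\<open>coeff_char_poly_pencil_1\<close>). These vanish for the \<open>p\<close> with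
  \<open>h\<^sub>p\<close> symmetric; those for the first \<open>N\<close> other
  \<open>p\<close> form the tangent map. If it is onto, then the image is dense: the homogeneous
  part of least degree of a polynomial vanishing on the image, expanded at the image of
  \<open>0\<close>, would vanish everywhere (\<open>polynomial_function_zero_of_curves\<close>).
  That the tangent map is onto is an open condition on the Markov parameters, hence on
  \<open>G\<close>.

  It remains to see that the closed-loop polynomials lie in the target variety and that the open
  condition can be satisfied. For the first point a further open condition is imposed, namely
  that some combination of the entries of the Hankel matrix of Markov parameters has nonzero
  determinant of order \<open>n\<close>. It forces any two realizations of order
  \<open>n\<close> to be isomorphic by a unique isomorphism
  (\<open>realizations_isomorphic\<close>, \<open>intertwiner_unique\<close>). Applied to a
  realization and to the transposed one, this yields an invertible matrix \<open>S\<close> that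
  intertwines the closed-loop matrix with \<open>\<sigma>\<close> times its transpose. For
  \<open>\<sigma> = -1\<close> the characteristic polynomial is therefore invariant under the
  reflection. For \<open>\<sigma> = 1\<close> the matrix \<open>S\<close> is skew-symmetric, and
  multiplying the characteristic matrix by \<open>S\<close> gives a skew-symmetric matrix, whose
  determinant is a square (\<open>det_skew_is_square\<close>). For the second point, a diagonal
  \<open>A\<close> with one block of size two for each of \<open>N\<close> distinct pairs of
  inputs, and one further state if \<open>n\<close> is odd, satisfies both open conditions, by
  interpolation and by a Vandermonde determinant (\<open>symmetric_realization_exists\<close>).
\<close>

section \<open>Polynomial functions\<close>

definition affine_coords :: "nat \<Rightarrow> ((nat \<Rightarrow> complex) \<Rightarrow> complex) set" where
  "affine_coords N = {\<lambda>y. y i | i. i < N}"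

lemma polynomial_functions_sum:
  assumes "\<And>i. i \<in> I \<Longrightarrow> f i \<in> polynomial_functions X"
  shows "(\<lambda>v. \<Sum>i\<in>I. f i v) \<in> polynomial_functions X"
  using assms
  by (induction I rule: infinite_finite_induct)
    (auto intro: polynomial_functions.intros)

lemma polynomial_functions_prod:
  assumes "\<And>i. i \<in> I \<Longrightarrow> f i \<in> polynomial_functions X"
  shows "(\<lambda>v. \<Prod>i\<in>I. f i v) \<in> polynomial_functions X"
  using assms
  by (induction I rule: infinite_finite_induct)
    (auto intro: polynomial_functions.intros)

lemma polynomial_functions_power:
  assumes "f \<in> polynomial_functions X"
  shows "(\<lambda>v. f v ^ k) \<in> polynomial_functions X"
  using polynomial_functions_prod[of "{..<k}" "\<lambda>_. f"] assms by simp

lemma polynomial_functions_cmult: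
  assumes "f \<in> polynomial_functions X"
  shows "(\<lambda>v. c * f v) \<in> polynomial_functions X"
  by (intro polynomial_functions.mult polynomial_functions.const assms)

lemma polynomial_functions_diff:
  assumes "f \<in> polynomial_functions X" "g \<in> polynomial_functions X"
  shows "(\<lambda>v. f v - g v) \<in> polynomial_functions X"
  using polynomial_functions.add[OF assms(1) polynomial_functions_cmult[OF assms(2), of "-1"]]
  by simp

lemma polynomial_functions_det:
  assumes "\<And>i j. i < n \<Longrightarrow> j < n \<Longrightarrow> (\<lambda>v. f v i j) \<in> polynomial_functions X"
  shows "(\<lambda>v. det (mat n n (\<lambda>(i, j). f v i j))) \<in> polynomial_functions X"
proof -
  have eq: "(\<lambda>v. det (mat n n (\<lambda>(i, j). f v i j))) =
    (\<lambda>v. \<Sum>p | p permutes {0..<n}. signof p * (\<Prod>i = 0..<n. f v i (p i)))"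
    by (rule ext, subst det_def', rule mat_carrier, rule sum.cong)
      (auto intro!: prod.cong simp: permutes_in_image)
  show ?thesis unfolding eq
    by (intro polynomial_functions_sum polynomial_functions_cmult polynomial_functions_prod assms)
      (auto simp: permutes_in_image)
qed

lemma polynomial_functions_subst:
  assumes "f \<in> polynomial_functions X"
    and "\<And>x. x \<in> X \<Longrightarrow> (\<lambda>w. x (h w)) \<in> polynomial_functions Y"
  shows "(\<lambda>w. f (h w)) \<in> polynomial_functions Y"
  using assms by (induction rule: polynomial_functions.induct) (auto intro: polynomial_functions.intros)

section \<open>Algebraic dependence of more functions than variables\<close>

text \<open>
  Padding the coefficient matrix with zero rows makes it square and singular.
\<close>

lemma homogeneous_system_nontrivial_solution:
  fixes u :: "'a \<Rightarrow> nat \<Rightarrow> complex"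
  assumes L: "finite L" and card: "card L < R"
  shows "\<exists>c. (\<exists>k<R. c k \<noteq> 0) \<and> (\<forall>l\<in>L. (\<Sum>k<R. u l k * c k) = 0)"
proof -
  obtain e where e: "bij_betw e {..<card L} L"
    using ex_bij_betw_nat_finite[OF L] by (auto simp: atLeast0LessThan)
  define M where "M = mat R R (\<lambda>(i, k). if i < card L then u (e i) k else 0)"
  have M: "M \<in> carrier_mat R R" by (simp add: M_def)
  have "det M = (\<Sum>j<R. M $$ (R - 1, j) * cofactor M (R - 1) j)"
    by (rule laplace_expansion_row[OF M]) (use card in auto)
  also have "\<dots> = 0" by (rule sum.neutral) (use card in \<open>auto simp: M_def\<close>)
  finally obtain v where v: "v \<in> carrier_vec R" "v \<noteq> 0\<^sub>v R" "M *\<^sub>v v = 0\<^sub>v R"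
    using det_0_iff_vec_prod_zero_field[OF M] by auto
  have "\<exists>k<R. vec_index v k \<noteq> 0"
  proof (rule ccontr)
    assume "\<not> ?thesis"
    with v(1) have "v = 0\<^sub>v R" by (intro eq_vecI) auto
    with v(2) show False by simp
  qed
  moreover have "(\<Sum>k<R. u l k * vec_index v k) = 0" if "l \<in> L" for l
  proof -
    have "l \<in> e ` {..<card L}" using e that by (simp add: bij_betw_def)
    then obtain i where i: "i < card L" "l = e i" by (elim imageE) simp
    have "vec_index (M *\<^sub>v v) i = (\<Sum>k<R. u l k * vec_index v k)"
      using i card v(1) unfolding M_def
      by (auto simp: scalar_prod_def atLeast0LessThan intro!: sum.cong)
    then show ?thesis using v(3) i card by simp
  qed
  ultimately show ?thesis by blast
qed

text \<open>
  Bounds the degree in each of the first \<open>a\<close> variables separately, without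
  reference to monomials. The bounds add up under products, which is what the counting below
  needs.
\<close>

definition separately_polynomial :: "nat \<Rightarrow> nat \<Rightarrow> ((nat \<Rightarrow> complex) \<Rightarrow> complex) \<Rightarrow> bool" where
  "separately_polynomial a D f \<longleftrightarrow>
    (\<forall>x. \<forall>e<a. \<exists>p. degree p \<le> D \<and> (\<forall>t. f (x(e := t)) = poly p t))"

lemma separately_polynomial_mono:
  "separately_polynomial a D f \<Longrightarrow> D \<le> D' \<Longrightarrow> separately_polynomial a D' f"
  unfolding separately_polynomial_def by (meson le_trans)

lemma separately_polynomial_const: "separately_polynomial a 0 (\<lambda>_. c)"
  unfolding separately_polynomial_def by (auto intro!: exI[of _ "[:c:]"])

lemma separately_polynomial_mult:
  assumes "separately_polynomial a D f" "separately_polynomial a E g"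
  shows "separately_polynomial a (D + E) (\<lambda>x. f x * g x)"
  unfolding separately_polynomial_def
proof (intro allI impI)
  fix x e assume "e < a"
  with assms obtain p q where "degree p \<le> D" "\<forall>t. f (x(e := t)) = poly p t"
    "degree q \<le> E" "\<forall>t. g (x(e := t)) = poly q t"
    unfolding separately_polynomial_def by meson
  then show "\<exists>r. degree r \<le> D + E \<and> (\<forall>t. f (x(e := t)) * g (x(e := t)) = poly r t)"
    by (intro exI[of _ "p * q"]) (auto intro: order_trans[OF degree_mult_le])
qed

lemma separately_polynomial_prod:
  assumes "\<And>i. i \<in> I \<Longrightarrow> separately_polynomial a (D i) (f i)"
  shows "separately_polynomial a (\<Sum>i\<in>I. D i) (\<lambda>x. \<Prod>i\<in>I. f i x)"
  using assms
  by (induction I rule: infinite_finite_induct)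
    (auto intro: separately_polynomial_const separately_polynomial_mult)

lemma separately_polynomial_power:
  assumes "separately_polynomial a D f"
  shows "separately_polynomial a (k * D) (\<lambda>x. f x ^ k)"
  using separately_polynomial_prod[of "{..<k}" a "\<lambda>_. D" "\<lambda>_. f"] assms by simp

lemma separately_polynomial_sum:
  assumes "\<And>i. i \<in> I \<Longrightarrow> separately_polynomial a D (f i)"
  shows "separately_polynomial a D (\<lambda>x. \<Sum>i\<in>I. f i x)"
  unfolding separately_polynomial_def
proof (intro allI impI)
  fix x e assume "e < a"
  then have "\<exists>p. degree p \<le> D \<and> (\<forall>t. f i (x(e := t)) = poly p t)" if "i \<in> I" for i
    using assms[OF that] unfolding separately_polynomial_def by blast
  then obtain p where p: "\<And>i. i \<in> I \<Longrightarrow> degree (p i) \<le> D"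
    "\<And>i t. i \<in> I \<Longrightarrow> f i (x(e := t)) = poly (p i) t" by metis
  show "\<exists>r. degree r \<le> D \<and> (\<forall>t. (\<Sum>i\<in>I. f i (x(e := t))) = poly r t)"
  proof (cases "finite I")
    case True
    then show ?thesis using p
      by (intro exI[of _ "\<Sum>i\<in>I. p i"]) (auto intro!: degree_sum_le simp: poly_sum)
  qed (auto intro!: exI[of _ 0])
qed

text \<open>
  The free variables are released from the grid one at a time: in the variable \<open>j\<close>
  the function is a univariate polynomial of degree at most \<open>K\<close> with the
  \<open>K + 1\<close> roots \<open>0, \<dots>, K\<close>.
\<close>

lemma separately_polynomial_zero_of_grid:
  assumes f: "separately_polynomial a K f"
    and grid: "\<And>x. (\<And>e. e < a \<Longrightarrow> x e \<in> of_nat ` {..K}) \<Longrightarrow> (\<And>e. e \<ge> a \<Longrightarrow> x e = 0) \<Longrightarrow> f x = 0"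
    and x: "\<And>e. e \<ge> a \<Longrightarrow> x e = 0"
  shows "f x = 0"
proof -
  have "f x = 0" if "j \<le> a" "\<And>e. j \<le> e \<Longrightarrow> e < a \<Longrightarrow> x e \<in> of_nat ` {..K}"
    "\<And>e. e \<ge> a \<Longrightarrow> x e = 0" for x j
    using that
  proof (induction j arbitrary: x)
    case 0
    then show ?case by (intro grid) auto
  next
    case (Suc j)
    then obtain p where p: "degree p \<le> K" "\<And>t. f (x(j := t)) = poly p t"
      using f unfolding separately_polynomial_def by (metis Suc_le_lessD)
    have zero: "poly p t = 0" if "t \<in> of_nat ` {..K}" for t
      unfolding p(2)[symmetric] by (rule Suc.IH) (use Suc.prems that in auto)
    have "p = 0"
    proof (rule ccontr)
      assume "p \<noteq> 0"
      have "card (of_nat ` {..K} :: complex set) = Suc K"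
        by (subst card_image) (auto simp: inj_on_def)
      moreover have "card (of_nat ` {..K} :: complex set) \<le> card {t. poly p t = 0}"
        by (rule card_mono) (use zero \<open>p \<noteq> 0\<close> poly_roots_finite in auto)
      ultimately show False using card_poly_roots_bound[OF \<open>p \<noteq> 0\<close>] p(1) by simp
    qed
    then show ?case using p(2)[of "x j"] by simp
  qed
  from this[of a x] x show ?thesis by simp
qed

lemma sum_digits:
  fixes k M N :: nat
  shows "(\<Sum>i<N. (k div M ^ i mod M) * M ^ i) = k mod M ^ N"
  by (induction N) (simp_all add: mod_mult2_eq mult.commute[of M])

text \<open>
  A counting argument. There are \<open>M\<^sup>N\<close> monomials in the \<open>g i\<close>
  with exponents below \<open>M\<close>. Each has degree at most \<open>K = D N M\<close> in
  every variable, so that a linear combination vanishes as soon as it vanishes at the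
  \<open>(K + 1)\<^sup>a\<close> points of a grid. As \<open>a < N\<close>, for large
  \<open>M\<close> these are fewer linear conditions than there are monomials. The monomials are
  numbered by the base-\<open>M\<close> digits of \<open>k < M\<^sup>N\<close>; Kronecker's
  substitution of \<open>z\<close> to the power \<open>M\<^sup>i\<close> for \<open>y i\<close>
  turns monomial \<open>k\<close> into \<open>z\<^sup>k\<close> and shows that a nontrivial
  combination is not the zero function.
\<close>

lemma algebraic_dependence:
  fixes g :: "nat \<Rightarrow> (nat \<Rightarrow> complex) \<Rightarrow> complex"
  assumes aN: "a < N" and g: "\<And>i. i < N \<Longrightarrow> separately_polynomial a D (g i)"
  shows "\<exists>f\<in>polynomial_functions (affine_coords N). (\<exists>y. f y \<noteq> 0) \<and>
    (\<forall>x. (\<forall>e\<ge>a. x e = 0) \<longrightarrow> f (\<lambda>i. g i x) = 0)"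
proof -
  \<comment> \<open>large enough for \<open>(D N + 1)\<^sup>a M\<^sup>a < M\<^bsup>a+1\<^esup>\<close>\<close>
  define M where "M = Suc ((D * N + 1) ^ a)"
  define K where "K = D * N * M"
  define digit where "digit k i = k div M ^ i mod M" for k i :: nat
  define mono where "mono k y = (\<Prod>i<N. y i ^ digit k i)" for k and y :: "nat \<Rightarrow> complex"
  define Gr where "Gr = {x :: nat \<Rightarrow> complex. (\<forall>e<a. x e \<in> of_nat ` {..K}) \<and> (\<forall>e\<ge>a. x e = 0)}"
  have M: "M > 0" by (simp add: M_def)
  have "Gr \<subseteq> (\<lambda>\<phi> e. if e < a then \<phi> e else 0) ` (PiE {..<a} (\<lambda>_. of_nat ` {..K}))"
  proof
    fix x assume "x \<in> Gr"
    then show "x \<in> (\<lambda>\<phi> e. if e < a then \<phi> e else 0) ` (PiE {..<a} (\<lambda>_. of_nat ` {..K}))"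
      by (intro image_eqI[of _ _ "restrict x {..<a}"]) (auto simp: Gr_def fun_eq_iff not_less)
  qed
  moreover have fin: "finite (PiE {..<a} (\<lambda>_. of_nat ` {..K}) :: (nat \<Rightarrow> complex) set)"
    by (intro finite_PiE) auto
  ultimately have finGr: "finite Gr"
    by (rule finite_subset[OF _ finite_imageI])
  have "card Gr \<le> card (PiE {..<a} (\<lambda>_. of_nat ` {..K}) :: (nat \<Rightarrow> complex) set)"
    by (rule surj_card_le) fact+
  also have "card (PiE {..<a} (\<lambda>_. of_nat ` {..K}) :: (nat \<Rightarrow> complex) set) \<le> (K + 1) ^ a"
    by (subst card_PiE) (auto intro!: power_mono card_image_le[THEN order_trans])
  also have "\<dots> \<le> ((D * N + 1) * M) ^ a"
    by (rule power_mono) (use M in \<open>auto simp: K_def\<close>)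
  also have "\<dots> = (D * N + 1) ^ a * M ^ a" by (rule power_mult_distrib)
  also have "\<dots> < M * M ^ a" by (rule mult_strict_right_mono) (auto simp: M_def)
  also have "\<dots> \<le> M ^ N" using aN M power_increasing[of "Suc a" N M] by simp
  finally have "card Gr < M ^ N" .
  from homogeneous_system_nontrivial_solution[OF finGr this, of "\<lambda>x k. mono k (\<lambda>i. g i x)"]
  obtain c where "(\<exists>k<M ^ N. c k \<noteq> 0) \<and>
    (\<forall>x\<in>Gr. (\<Sum>k<M ^ N. mono k (\<lambda>i. g i x) * c k) = 0)" by (rule exE)
  then have c: "\<exists>k<M ^ N. c k \<noteq> 0"
    "\<And>x. x \<in> Gr \<Longrightarrow> (\<Sum>k<M ^ N. mono k (\<lambda>i. g i x) * c k) = 0" by simp_all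
  define f where "f y = (\<Sum>k<M ^ N. mono k y * c k)" for y
  have "f \<in> polynomial_functions (affine_coords N)"
    unfolding f_def mono_def
    by (intro polynomial_functions_sum polynomial_functions.mult polynomial_functions_prod
        polynomial_functions_power polynomial_functions.const polynomial_functions.coord)
      (auto simp: affine_coords_def)
  moreover have "\<exists>y. f y \<noteq> 0"
  proof -
    define q where "q = (\<Sum>k<M ^ N. monom (c k) k)"
    have "coeff q k = c k" if "k < M ^ N" for k
      unfolding q_def coeff_sum coeff_monom using that by (subst sum.delta) auto
    with c(1) have "q \<noteq> 0" by force
    then obtain z where z: "poly q z \<noteq> 0" by (metis poly_all_0_iff_0)
    have "mono k (\<lambda>i. z ^ M ^ i) = z ^ k" if "k < M ^ N" for k
    proof -
      have "mono k (\<lambda>i. z ^ M ^ i) = z ^ (\<Sum>i<N. (k div M ^ i mod M) * M ^ i)"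
        unfolding mono_def digit_def power_sum
        by (intro prod.cong refl) (simp only: power_mult[symmetric] mult.commute)
      then show ?thesis using that by (simp add: sum_digits)
    qed
    then have "f (\<lambda>i. z ^ M ^ i) = poly q z"
      by (simp add: f_def q_def poly_sum poly_monom mult.commute)
    with z show ?thesis by metis
  qed
  moreover have "f (\<lambda>i. g i x) = 0" if x: "\<forall>e\<ge>a. x e = 0" for x
  proof (rule separately_polynomial_zero_of_grid[of a K "\<lambda>x. f (\<lambda>i. g i x)"])
    have "separately_polynomial a (\<Sum>i<N. digit k i * D) (\<lambda>x. mono k (\<lambda>i. g i x))" for k
      unfolding mono_def
      by (intro separately_polynomial_prod separately_polynomial_power g) auto
    moreover have "(\<Sum>i<N. digit k i * D) \<le> K" for k
    proof -
      have "(\<Sum>i<N. digit k i * D) \<le> (\<Sum>i<N. M * D)"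
        by (intro sum_mono mult_right_mono) (use M in \<open>auto simp: digit_def less_imp_le\<close>)
      then show ?thesis by (simp add: K_def mult_ac)
    qed
    ultimately have "separately_polynomial a (K + 0) (\<lambda>x. mono k (\<lambda>i. g i x) * c k)" for k
      by (intro separately_polynomial_mult separately_polynomial_const)
        (rule separately_polynomial_mono)
    then show "separately_polynomial a K (\<lambda>x. f (\<lambda>i. g i x))"
      unfolding f_def by (intro separately_polynomial_sum) simp
  next
    fix x :: "nat \<Rightarrow> complex"
    assume "\<And>e. e < a \<Longrightarrow> x e \<in> of_nat ` {..K}" "\<And>e. e \<ge> a \<Longrightarrow> x e = 0"
    then have "x \<in> Gr" by (simp add: Gr_def)
    then show "f (\<lambda>i. g i x) = 0" using c(2) by (simp add: f_def)
  qed (use x in auto)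
  ultimately show ?thesis by blast
qed

section \<open>Polynomial functions vanishing along curves in all directions\<close>

text \<open>
  The Taylor expansion of \<open>P\<close> at \<open>y0\<close>, as a polynomial in the scaling
  factor \<open>t\<close>; its coefficient of \<open>t\<^sup>e\<close> is the homogeneous part
  of degree \<open>e\<close>.
\<close>

lemma polynomial_function_line_expansion:
  fixes y0 :: "nat \<Rightarrow> complex"
  assumes "P \<in> polynomial_functions (affine_coords N)"
  shows "\<exists>p D. (\<forall>y t. P (\<lambda>i. y0 i + t * y i) = poly (p y) t) \<and> (\<forall>y. degree (p y) \<le> D) \<and>
    (\<forall>e. (\<lambda>y. coeff (p y) e) \<in> polynomial_functions (affine_coords N))"
  using assms
proof (induction rule: polynomial_functions.induct)
  case (const c)
  show ?case
    by (intro exI[of _ "\<lambda>_. [:c:]"] exI[of _ 0]) (auto intro: polynomial_functions.const)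
next
  case (coord x)
  then obtain i where i: "i < N" "x = (\<lambda>y. y i)" by (auto simp: affine_coords_def)
  have "(\<lambda>y. coeff [:y0 i, y i:] e) \<in> polynomial_functions (affine_coords N)" for e
    by (cases e; cases "e - 1")
      (use coord i in \<open>auto intro: polynomial_functions.intros simp: coeff_pCons\<close>)
  then show ?case unfolding i
    by (intro exI[of _ "\<lambda>y. [:y0 i, y i:]"] exI[of _ 1]) auto
next
  case (add f g)
  then obtain p D q E where *: "\<forall>y t. f (\<lambda>i. y0 i + t * y i) = poly (p y) t" "\<forall>y. degree (p y) \<le> D"
    "\<forall>e. (\<lambda>y. coeff (p y) e) \<in> polynomial_functions (affine_coords N)"
    "\<forall>y t. g (\<lambda>i. y0 i + t * y i) = poly (q y) t" "\<forall>y. degree (q y) \<le> E"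
    "\<forall>e. (\<lambda>y. coeff (q y) e) \<in> polynomial_functions (affine_coords N)"
    by metis
  then show ?case
    by (intro exI[of _ "\<lambda>y. p y + q y"] exI[of _ "max D E"])
      (simp_all add: polynomial_functions.add, meson degree_add_le max.cobounded1 max.cobounded2 order_trans)
next
  case (mult f g)
  then obtain p D q E where *: "\<forall>y t. f (\<lambda>i. y0 i + t * y i) = poly (p y) t" "\<forall>y. degree (p y) \<le> D"
    "\<forall>e. (\<lambda>y. coeff (p y) e) \<in> polynomial_functions (affine_coords N)"
    "\<forall>y t. g (\<lambda>i. y0 i + t * y i) = poly (q y) t" "\<forall>y. degree (q y) \<le> E"
    "\<forall>e. (\<lambda>y. coeff (q y) e) \<in> polynomial_functions (affine_coords N)"
    by metis
  then show ?case
    by (intro exI[of _ "\<lambda>y. p y * q y"] exI[of _ "D + E"])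
      (auto intro!: polynomial_functions_sum polynomial_functions.mult
        order_trans[OF degree_mult_le] add_mono simp: coeff_mult)
qed

lemma isCont_polynomial_function:
  assumes "P \<in> polynomial_functions (affine_coords N)"
    and "\<And>i. i < N \<Longrightarrow> isCont (\<lambda>t. z t i) (t0 :: complex)"
  shows "isCont (\<lambda>t. P (z t)) t0"
  using assms
  by (induction rule: polynomial_functions.induct)
    (auto simp: affine_coords_def intro!: continuous_intros)

lemma polynomial_function_cong:
  assumes "P \<in> polynomial_functions (affine_coords N)" and "\<And>i. i < N \<Longrightarrow> y i = y' i"
  shows "P y = P y'"
  using assms by (induction rule: polynomial_functions.induct) (auto simp: affine_coords_def)

text \<open>
  Replaces the inverse function theorem in the passage from a surjective derivative to a dense
  image. Along a curve through \<open>y0\<close> with velocity \<open>u\<close>, the function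
  \<open>P\<close> behaves like \<open>t\<^sup>d\<close> times the value at \<open>u\<close> of
  its homogeneous part of least degree \<open>d\<close>. If \<open>P\<close> vanishes along such
  a curve for each \<open>u\<close>, then this part vanishes identically.
\<close>

lemma polynomial_function_zero_of_curves:
  fixes P :: "(nat \<Rightarrow> complex) \<Rightarrow> complex" and y0 :: "nat \<Rightarrow> complex"
  assumes P: "P \<in> polynomial_functions (affine_coords N)"
    and curves: "\<And>u. \<exists>z. (\<forall>i<N. z 0 i = u i \<and> isCont (\<lambda>t. z t i) 0) \<and>
      (\<forall>t. P (\<lambda>i. y0 i + t * z t i) = 0)"
  shows "P y = 0"
proof (rule ccontr)
  assume nz: "P y \<noteq> 0"
  obtain p D where p: "\<And>y t. P (\<lambda>i. y0 i + t * y i) = poly (p y) t"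
    "\<And>y. degree (p y) \<le> D" "\<And>e. (\<lambda>y. coeff (p y) e) \<in> polynomial_functions (affine_coords N)"
    using polynomial_function_line_expansion[OF P, of y0] by blast
  have "poly (p (\<lambda>i. y i - y0 i)) 1 \<noteq> 0" using nz p(1)[of 1 "\<lambda>i. y i - y0 i"] by simp
  then have "\<exists>d y. coeff (p y) d \<noteq> 0" by (metis leading_coeff_0_iff poly_0)
  then obtain d where d: "\<exists>y. coeff (p y) d \<noteq> 0" "\<And>e y. e < d \<Longrightarrow> coeff (p y) e = 0"
    using exists_least_iff[of "\<lambda>d. \<exists>y. coeff (p y) d \<noteq> 0"] by metis
  then obtain u where u: "coeff (p u) d \<noteq> 0" by blast
  then have dD: "d \<le> D" using p(2)[of u] le_degree order_trans by blast
  obtain z where z: "\<And>i. i < N \<Longrightarrow> z 0 i = u i" "\<And>i. i < N \<Longrightarrow> isCont (\<lambda>t. z t i) 0"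
    "\<And>t. P (\<lambda>i. y0 i + t * z t i) = 0" using curves[of u] by blast
  \<comment> \<open>\<open>P\<close> along the curve, divided by \<open>t\<^sup>d\<close>; it extends continuously to \<open>t = 0\<close>\<close>
  define w where "w t = (\<Sum>e=d..D. coeff (p (z t)) e * t ^ (e - d))" for t
  have "w t = 0" if "t \<noteq> 0" for t
  proof -
    have "0 = poly (p (z t)) t" using z(3)[of t] p(1) by simp
    also have "\<dots> = (\<Sum>e\<le>D. coeff (p (z t)) e * t ^ e)"
      unfolding poly_altdef by (rule sum.mono_neutral_left) (use p(2) in \<open>auto simp: coeff_eq_0\<close>)
    also have "\<dots> = (\<Sum>e=d..D. coeff (p (z t)) e * t ^ e)"
      by (rule sum.mono_neutral_right) (use d(2) in auto)
    also have "\<dots> = t ^ d * w t"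
      by (auto simp: w_def sum_distrib_left intro!: sum.cong simp flip: power_add)
    finally show ?thesis using that by simp
  qed
  moreover have "isCont w 0"
    unfolding w_def by (intro continuous_intros isCont_polynomial_function[OF p(3)] z(2))
  ultimately have "w 0 = 0"
    by (metis (mono_tags, lifting) LIM_equal LIM_unique isCont_def tendsto_const)
  moreover have "w 0 = coeff (p (z 0)) d"
    using dD by (simp add: w_def sum.atLeast_Suc_atMost power_0_left)
  moreover have "coeff (p (z 0)) d = coeff (p u) d"
    by (rule polynomial_function_cong[OF p(3)]) (use z(1) in auto)
  ultimately show False using u by simp
qed

section \<open>Affine coordinates on the varieties of target polynomials\<close>

text \<open>
  Forward substitution: the right-hand side for \<open>c j\<close> involves only the earlier
  unknowns.
\<close>

lemma triangular_system_solvable: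
  fixes r :: "nat \<Rightarrow> (nat \<Rightarrow> 'a) \<Rightarrow> 'a"
  assumes "\<And>j c c'. (\<And>i. i < j \<Longrightarrow> c i = c' i) \<Longrightarrow> r j c = r j c'"
  shows "\<exists>c. \<forall>j<N. c j = r j c"
proof (induction N)
  case (Suc N)
  then obtain c where c: "\<forall>j<N. c j = r j c" by blast
  define c' where "c' = c(N := r N c)"
  have "r j c' = r j c" if "j \<le> N" for j
    by (rule assms) (use that in \<open>auto simp: c'_def\<close>)
  moreover have "c' N = r N c" "\<And>j. j < N \<Longrightarrow> c' j = c j" by (auto simp: c'_def)
  ultimately show ?case using c by (intro exI[of _ c']) (simp add: less_Suc_eq)
qed auto

text \<open>
  In the coordinates \<open>poly_coords n\<close>, the coefficients with indices
  \<open>\<kappa> 0, \<dots>, \<kappa> (N - 1)\<close> identify \<open>V\<close> with the affine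
  space of dimension \<open>N\<close> as algebraic varieties.
\<close>

definition coefficient_chart :: "nat \<Rightarrow> nat \<Rightarrow> (nat \<Rightarrow> nat) \<Rightarrow> complex poly set \<Rightarrow> bool" where
  "coefficient_chart n N \<kappa> V \<longleftrightarrow> (\<forall>i<N. \<kappa> i < n) \<and>
    (\<forall>k<n. \<exists>g\<in>polynomial_functions (affine_coords N).
      \<forall>p\<in>V. coeff p k = g (\<lambda>i. coeff p (\<kappa> i))) \<and>
    (\<forall>c. \<exists>p\<in>V. \<forall>i<N. coeff p (\<kappa> i) = c i)"

lemma polynomial_function_in_chart:
  assumes V: "coefficient_chart n N \<kappa> V" and f: "f \<in> polynomial_functions (poly_coords n)"
  shows "\<exists>g\<in>polynomial_functions (affine_coords N). \<forall>p\<in>V. f p = g (\<lambda>i. coeff p (\<kappa> i))"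
  using f
proof (induction rule: polynomial_functions.induct)
  case (const c)
  show ?case by (intro bexI[of _ "\<lambda>_. c"]) (auto intro: polynomial_functions.const)
next
  case (coord x)
  with V show ?case by (auto simp: poly_coords_def coefficient_chart_def)
next
  case (add f g)
  then obtain f' g' where "f' \<in> polynomial_functions (affine_coords N)"
    "g' \<in> polynomial_functions (affine_coords N)"
    "\<forall>p\<in>V. f p = f' (\<lambda>i. coeff p (\<kappa> i))" "\<forall>p\<in>V. g p = g' (\<lambda>i. coeff p (\<kappa> i))" by blast
  then show ?case
    by (intro bexI[of _ "\<lambda>v. f' v + g' v"] polynomial_functions.add) simp_all
next
  case (mult f g)
  then obtain f' g' where "f' \<in> polynomial_functions (affine_coords N)"
    "g' \<in> polynomial_functions (affine_coords N)"
    "\<forall>p\<in>V. f p = f' (\<lambda>i. coeff p (\<kappa> i))" "\<forall>p\<in>V. g p = g' (\<lambda>i. coeff p (\<kappa> i))" by blast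
  then show ?case
    by (intro bexI[of _ "\<lambda>v. f' v * g' v"] polynomial_functions.mult) simp_all
qed

text \<open>
  In the chart, a polynomial function that vanishes on \<open>S\<close> vanishes along curves in
  all directions: the hypothesis provides, for each tangent vector \<open>u\<close> of
  \<open>V\<close> at \<open>p0\<close>, a polynomial curve in \<open>S\<close> that starts at
  \<open>p0\<close> with velocity \<open>u\<close>.
\<close>

lemma zariski_dense_if_tangent_onto:
  assumes V: "coefficient_chart n N \<kappa> V" and SV: "S \<subseteq> V"
    and curves: "\<And>u. \<exists>D \<psi>. \<psi> 0 = p0 \<and> (\<forall>i<N. coeff (\<psi> 1) (\<kappa> i) = u i) \<and>
      (\<forall>t. (\<Sum>j\<le>Suc D. Polynomial.smult (t ^ j) (\<psi> j)) \<in> S)"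
  shows "zariski_dense_in (poly_coords n) V S"
  unfolding zariski_dense_in_def
proof (intro conjI allI impI SV)
  fix Z assume Z: "zariski_closed_in (poly_coords n) V Z \<and> S \<subseteq> Z"
  then obtain P where P: "P \<subseteq> polynomial_functions (poly_coords n)"
    "Z = {v \<in> V. \<forall>f\<in>P. f v = 0}" by (auto simp: zariski_closed_in_def)
  have "f p = 0" if f: "f \<in> P" and p: "p \<in> V" for f p
  proof -
    obtain g where g: "g \<in> polynomial_functions (affine_coords N)"
      "\<And>p. p \<in> V \<Longrightarrow> f p = g (\<lambda>i. coeff p (\<kappa> i))"
      using polynomial_function_in_chart[OF V] f P(1) by blast
    have "\<exists>z. (\<forall>i<N. z 0 i = u i \<and> isCont (\<lambda>t. z t i) 0) \<and>
      (\<forall>t. g (\<lambda>i. coeff p0 (\<kappa> i) + t * z t i) = 0)" for u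
    proof -
      obtain D \<psi> where \<psi>: "\<psi> 0 = p0" "\<And>i. i < N \<Longrightarrow> coeff (\<psi> 1) (\<kappa> i) = u i"
        "\<And>t. (\<Sum>j\<le>Suc D. Polynomial.smult (t ^ j) (\<psi> j)) \<in> S" using curves[of u] by blast
      define z where "z t i = (\<Sum>j\<le>D. t ^ j * coeff (\<psi> (Suc j)) (\<kappa> i))" for t i
      have "coeff (\<Sum>j\<le>Suc D. Polynomial.smult (t ^ j) (\<psi> j)) (\<kappa> i) =
        coeff p0 (\<kappa> i) + t * z t i" for t i
        by (simp add: coeff_sum sum.atMost_Suc_shift \<psi>(1) z_def sum_distrib_left mult.assoc
            del: sum.atMost_Suc)
      moreover have "f (\<Sum>j\<le>Suc D. Polynomial.smult (t ^ j) (\<psi> j)) = 0" for t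
        using \<psi>(3) Z P(2) f by auto
      ultimately have "g (\<lambda>i. coeff p0 (\<kappa> i) + t * z t i) = 0" for t
        using g(2) \<psi>(3)[of t] SV by (metis (no_types, lifting) ext subsetD)
      moreover have "z 0 i = u i" if "i < N" for i
        using \<psi>(2)[OF that] by (simp add: z_def sum.atMost_shift power_0_left)
      moreover have "isCont (\<lambda>t. z t i) 0" for i
        unfolding z_def by (intro continuous_intros)
      ultimately show ?thesis by blast
    qed
    from polynomial_function_zero_of_curves[OF g(1) this] show "f p = 0"
      using g(2)[OF p] by simp
  qed
  then show "Z = V" using P(2) by blast
qed

text \<open>
  An algebraic relation between the chart coordinates on \<open>S\<close> cuts out a closed
  subset, which is proper because the coordinates take arbitrary values on \<open>V\<close>.
\<close>

lemma not_zariski_dense_if_few_parameters: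
  assumes V: "coefficient_chart n N \<kappa> V" and "a < N"
    and \<phi>: "\<And>k. separately_polynomial a D (\<lambda>x. coeff (\<phi> x) k)"
    and S: "\<And>p. p \<in> S \<Longrightarrow> \<exists>x. (\<forall>e\<ge>a. x e = 0) \<and> p = \<phi> x"
  shows "\<not> zariski_dense_in (poly_coords n) V S"
proof
  assume dense: "zariski_dense_in (poly_coords n) V S"
  obtain f y where f: "f \<in> polynomial_functions (affine_coords N)" "f y \<noteq> 0"
    "\<And>x. (\<forall>e\<ge>a. x e = 0) \<Longrightarrow> f (\<lambda>i. coeff (\<phi> x) (\<kappa> i)) = 0"
    using algebraic_dependence[OF \<open>a < N\<close>, of D "\<lambda>i x. coeff (\<phi> x) (\<kappa> i)"] \<phi> by blast
  have "(\<lambda>p. f (\<lambda>i. coeff p (\<kappa> i))) \<in> polynomial_functions (poly_coords n)"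
    by (rule polynomial_functions_subst[OF f(1)])
      (use V in \<open>auto simp: affine_coords_def poly_coords_def coefficient_chart_def
        intro!: polynomial_functions.coord\<close>)
  then have "zariski_closed_in (poly_coords n) V {p\<in>V. f (\<lambda>i. coeff p (\<kappa> i)) = 0}"
    unfolding zariski_closed_in_def by (intro exI[of _ "{\<lambda>p. f (\<lambda>i. coeff p (\<kappa> i))}"]) auto
  moreover have "S \<subseteq> {p\<in>V. f (\<lambda>i. coeff p (\<kappa> i)) = 0}"
    using dense S f(3) by (fastforce simp: zariski_dense_in_def)
  ultimately have "{p\<in>V. f (\<lambda>i. coeff p (\<kappa> i)) = 0} = V"
    using dense by (simp add: zariski_dense_in_def)
  moreover obtain p where p: "p \<in> V" "\<forall>i<N. coeff p (\<kappa> i) = y i"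
    using V unfolding coefficient_chart_def by meson
  ultimately have "f (\<lambda>i. coeff p (\<kappa> i)) = 0" by blast
  also have "f (\<lambda>i. coeff p (\<kappa> i)) = f y"
    by (rule polynomial_function_cong[OF f(1)]) (use p(2) in auto)
  finally show False using f(2) by simp
qed

lemma coeff_poly_reflect: "coeff (poly_reflect p) k = (-1) ^ k * coeff p k"
  by (simp add: coeff_pcompose_linear)

text \<open>
  The reflection symmetry kills every second coefficient below the leading one and leaves the
  others free.
\<close>

lemma reflection_polys_chart:
  "coefficient_chart n (n div 2) (\<lambda>i. n - 1 - (2 * i + 1)) (reflection_polys n)"
  unfolding coefficient_chart_def
proof (intro conjI allI impI)
  fix i assume "i < n div 2"
  then show "n - 1 - (2 * i + 1) < n" by simp
next
  fix k assume k: "k < n"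
  let ?P = "polynomial_functions (affine_coords (n div 2))"
  show "\<exists>g\<in>?P. \<forall>p\<in>reflection_polys n. coeff p k = g (\<lambda>i. coeff p (n - 1 - (2 * i + 1)))"
  proof (cases "even (n + k)")
    case True
    then have "even (n - k)" using k by simp
    then obtain d where d: "n - k = 2 * d" by blast
    then have i: "d - 1 < n div 2" "n - 1 - (2 * (d - 1) + 1) = k" using k by auto
    show ?thesis
      by (intro bexI[of _ "\<lambda>y. y (d - 1)"] polynomial_functions.coord)
        (use i in \<open>auto simp: affine_coords_def\<close>)
  next
    case False
    have "coeff p k = 0" if "p \<in> reflection_polys n" for p
    proof -
      have "p = Polynomial.smult ((-1) ^ n) (poly_reflect p)"
        using that by (simp add: reflection_polys_def)
      then have "coeff p k = (-1) ^ n * ((-1) ^ k * coeff p k)"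
        by (metis coeff_smult coeff_poly_reflect)
      also have "\<dots> = - coeff p k" using False by (simp add: power_add[symmetric] mult.assoc[symmetric])
      finally show ?thesis by simp
    qed
    then show ?thesis by (intro bexI[of _ "\<lambda>_. 0"] polynomial_functions.const) simp
  qed
next
  fix c :: "nat \<Rightarrow> complex"
  define r where "r = (\<Sum>i<n div 2. monom (c i) (n - 1 - (2 * i + 1)))"
  have r: "coeff r k = (\<Sum>i<n div 2. if n - 1 - (2 * i + 1) = k then c i else 0)" for k
    by (simp add: r_def coeff_sum)
  have r0: "coeff r k = 0" if "k \<ge> n \<or> odd (n + k)" for k
    unfolding r by (rule sum.neutral) (use that in auto)
  define p where "p = monom 1 n + r"
  have "coeff r n = 0" by (rule r0) simp
  then have lead: "coeff p n = 1" by (simp add: p_def)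
  moreover have deg: "degree p = n"
  proof (rule antisym)
    show "degree p \<le> n" by (rule degree_le) (auto simp: p_def r0)
    show "n \<le> degree p" using lead by (simp add: le_degree)
  qed
  moreover have "p = Polynomial.smult ((-1) ^ n) (poly_reflect p)"
  proof (rule poly_eqI)
    fix k
    show "coeff p k = coeff (Polynomial.smult ((-1) ^ n) (poly_reflect p)) k"
    proof (cases "even (n + k)")
      case True
      then show ?thesis
        by (simp add: coeff_poly_reflect power_add[symmetric] mult.assoc[symmetric])
    next
      case False
      then have "coeff p k = 0" by (auto simp: p_def r0)
      then show ?thesis by (simp add: coeff_poly_reflect)
    qed
  qed
  ultimately have "p \<in> reflection_polys n" by (simp add: reflection_polys_def)
  moreover have "coeff p (n - 1 - (2 * i + 1)) = c i" if i: "i < n div 2" for i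
  proof -
    have "coeff p (n - 1 - (2 * i + 1)) = coeff r (n - 1 - (2 * i + 1))"
      using i by (simp add: p_def)
    also have "\<dots> = (\<Sum>j<n div 2. if j = i then c j else 0)"
      unfolding r by (rule sum.cong) (use i in auto)
    also have "\<dots> = c i" using i by simp
    finally show ?thesis .
  qed
  ultimately show "\<exists>p\<in>reflection_polys n. \<forall>i<n div 2. coeff p (n - 1 - (2 * i + 1)) = c i"
    by blast
qed

text \<open>
  The coefficient \<open>i + 1\<close> places below the leading one of a monic square is twice
  the corresponding coefficient of the root, up to a polynomial in the earlier ones. The root of
  a monic square can thus be computed from the top half of the square by forward substitution.
\<close>

lemma coeff_monic_square:
  fixes q :: "'a :: comm_ring_1 poly"
  assumes q: "monic q" "degree q = N" and i: "i < N"
  shows "coeff (q\<^sup>2) (2 * N - 1 - i) =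
    2 * coeff q (N - 1 - i) + (\<Sum>j<i. coeff q (N - 1 - j) * coeff q (N - 1 - (i - 1 - j)))"
proof -
  let ?f = "\<lambda>k. coeff q k * coeff q (2 * N - 1 - i - k)"
  have "coeff (q\<^sup>2) (2 * N - 1 - i) = (\<Sum>k\<le>2 * N - 1 - i. ?f k)"
    by (simp add: power2_eq_square coeff_mult)
  also have "\<dots> = sum ?f {N - 1 - i..N}"
    by (rule sum.mono_neutral_right) (use q i in \<open>auto simp: coeff_eq_0 not_le\<close>)
  also have "{N - 1 - i..N} = insert N (insert (N - 1 - i) ((\<lambda>j. N - 1 - j) ` {..<i}))"
  proof (intro equalityI subsetI)
    fix k assume "k \<in> {N - 1 - i..N}"
    then show "k \<in> insert N (insert (N - 1 - i) ((\<lambda>j. N - 1 - j) ` {..<i}))"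
      using i by (cases "k = N"; cases "k = N - 1 - i")
        (auto intro!: image_eqI[of _ _ "N - 1 - k"])
  qed (use i in auto)
  also have "sum ?f \<dots> = ?f N + (?f (N - 1 - i) + sum ?f ((\<lambda>j. N - 1 - j) ` {..<i}))"
    using i by (subst sum.insert; (subst sum.insert)?) auto
  also have "sum ?f ((\<lambda>j. N - 1 - j) ` {..<i}) =
    (\<Sum>j<i. coeff q (N - 1 - j) * coeff q (N - 1 - (i - 1 - j)))"
    by (subst sum.reindex) (use i in \<open>auto simp: inj_on_def intro!: sum.cong
        arg_cong[of _ _ "\<lambda>k. coeff q k"] arg_cong2[of _ _ _ _ "(*)"]\<close>)
  also have "?f N = coeff q (N - 1 - i)" using q i by (simp add: numeral_2_eq_2)
  also have "?f (N - 1 - i) = coeff q (N - 1 - i)"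
  proof -
    have "2 * N - 1 - i - (N - 1 - i) = N" using i by linarith
    then show ?thesis using q by simp
  qed
  finally show ?thesis by (simp add: algebra_simps)
qed

text \<open>
  The top half of the coefficients of a monic square determines its monic root polynomially, and
  hence the bottom half.
\<close>

lemma square_polys_chart:
  assumes "even n"
  shows "coefficient_chart n (n div 2) (\<lambda>i. n - 1 - i) (square_polys n)"
proof -
  define N where "N = n div 2"
  have n: "n = 2 * N" using assms by (simp add: N_def)
  let ?P = "polynomial_functions (affine_coords N)"
  let ?top = "\<lambda>q i. coeff (q\<^sup>2 :: complex poly) (n - 1 - i)"
  have top: "\<exists>g\<in>?P. \<forall>q. monic q \<and> degree q = N \<longrightarrow> coeff q (N - 1 - i) = g (?top q)"
    if "i < N" for i
    using that
  proof (induction i rule: less_induct)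
    case (less i)
    then have "\<forall>j\<in>{..<i}. \<exists>g. g \<in> ?P \<and> (\<forall>q. monic q \<and> degree q = N \<longrightarrow>
        coeff q (N - 1 - j) = g (?top q))" by (meson less_trans lessThan_iff)
    then obtain G where G: "\<And>j. j < i \<Longrightarrow> G j \<in> ?P"
      "\<And>j q. j < i \<Longrightarrow> monic q \<Longrightarrow> degree q = N \<Longrightarrow> coeff q (N - 1 - j) = G j (?top q)"
      by (metis lessThan_iff)
    define g where "g y = (1 / 2) * (y i - (\<Sum>j<i. G j y * G (i - 1 - j) y))" for y
    have "g \<in> ?P"
      unfolding g_def using less.prems
      by (intro polynomial_functions_cmult polynomial_functions_diff polynomial_functions_sum
          polynomial_functions.mult G(1) polynomial_functions.coord) (auto simp: affine_coords_def)
    moreover have "coeff q (N - 1 - i) = g (?top q)" if q: "monic q" "degree q = N" for q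
    proof -
      have "(\<Sum>j<i. G j (?top q) * G (i - 1 - j) (?top q)) =
        (\<Sum>j<i. coeff q (N - 1 - j) * coeff q (N - 1 - (i - 1 - j)))"
        by (rule sum.cong[OF refl], subst (1 2) G(2)[OF _ q]) auto
      then show ?thesis using coeff_monic_square[OF q less.prems] by (simp add: g_def n)
    qed
    ultimately show ?case by blast
  qed
  have all: "\<exists>g\<in>?P. \<forall>q. monic q \<and> degree q = N \<longrightarrow> coeff q k = g (?top q)" for k
  proof -
    consider "k < N" | "k = N" | "k > N" by linarith
    then show ?thesis
    proof cases
      case 1
      then show ?thesis using top[of "N - 1 - k"] by simp
    next
      case 2
      then show ?thesis by (intro bexI[of _ "\<lambda>_. 1"] polynomial_functions.const) auto
    next
      case 3
      then show ?thesis
        by (intro bexI[of _ "\<lambda>_. 0"] polynomial_functions.const) (auto simp: coeff_eq_0)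
    qed
  qed
  then have "\<forall>k. \<exists>g. g \<in> ?P \<and> (\<forall>q. monic q \<and> degree q = N \<longrightarrow> coeff q k = g (?top q))"
    by blast
  then obtain G where G: "\<And>k. G k \<in> ?P"
    "\<And>k q. monic q \<Longrightarrow> degree q = N \<Longrightarrow> coeff q k = G k (?top q)" by metis
  show ?thesis
    unfolding coefficient_chart_def N_def[symmetric]
  proof (intro conjI allI impI)
    fix i assume "i < N"
    then show "n - 1 - i < n" by (simp add: n)
  next
    fix k
    show "\<exists>g\<in>?P. \<forall>p\<in>square_polys n. coeff p k = g (\<lambda>i. coeff p (n - 1 - i))"
    proof (intro bexI[of _ "\<lambda>y. \<Sum>j\<le>k. G j y * G (k - j) y"] ballI)
      fix p assume "p \<in> square_polys n"
      then obtain q where q: "monic q" "degree q = N" "p = q\<^sup>2"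
        by (auto simp: square_polys_def N_def)
      have "coeff p k = (\<Sum>j\<le>k. coeff q j * coeff q (k - j))"
        by (simp add: q(3) power2_eq_square coeff_mult)
      also have "\<dots> = (\<Sum>j\<le>k. G j (?top q) * G (k - j) (?top q))"
        by (rule sum.cong[OF refl], subst (1 2) G(2)[OF q(1,2)]) auto
      finally show "coeff p k = (\<Sum>j\<le>k. G j (\<lambda>i. coeff p (n - 1 - i)) *
        G (k - j) (\<lambda>i. coeff p (n - 1 - i)))" by (simp add: q(3))
    qed (intro polynomial_functions_sum polynomial_functions.mult G(1))
  next
    fix c :: "nat \<Rightarrow> complex"
    obtain y where y: "\<And>i. i < N \<Longrightarrow> y i = (1 / 2) * (c i - (\<Sum>j<i. y j * y (i - 1 - j)))"
      using triangular_system_solvable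
        [of "\<lambda>i y. (1 / 2) * (c i - (\<Sum>j<i. y j * y (i - 1 - j)))" N] by fastforce
    define r where "r = (\<Sum>i<N. monom (y i) (N - 1 - i))"
    have r: "coeff r k = (\<Sum>i<N. if N - 1 - i = k then y i else 0)" for k
      by (simp add: r_def coeff_sum)
    have r0: "coeff r k = 0" if "k \<ge> N" for k
      unfolding r by (rule sum.neutral) (use that in auto)
    have ry: "coeff r (N - 1 - i) = y i" if "i < N" for i
    proof -
      have "coeff r (N - 1 - i) = (\<Sum>j<N. if j = i then y j else 0)"
        unfolding r by (rule sum.cong) (use that in auto)
      then show ?thesis using that by simp
    qed
    define q where "q = monom 1 N + r"
    have lead: "coeff q N = 1" by (simp add: q_def r0)
    have deg: "degree q = N"
    proof (rule antisym)
      show "degree q \<le> N" by (rule degree_le) (auto simp: q_def r0)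
      show "N \<le> degree q" using lead by (simp add: le_degree)
    qed
    have monic: "monic q" using lead deg by simp
    have qy: "coeff q (N - 1 - i) = y i" if "i < N" for i
      using that ry by (simp add: q_def)
    have "coeff (q\<^sup>2) (n - 1 - i) = c i" if i: "i < N" for i
    proof -
      have "(\<Sum>j<i. coeff q (N - 1 - j) * coeff q (N - 1 - (i - 1 - j))) =
        (\<Sum>j<i. y j * y (i - 1 - j))"
        by (rule sum.cong[OF refl], subst (1 2) qy) (use i in auto)
      with coeff_monic_square[OF monic deg i] show ?thesis
        using qy[OF i] y[OF i] by (simp add: n mult.commute)
    qed
    moreover have "q\<^sup>2 \<in> square_polys n"
      using monic deg by (auto simp: square_polys_def N_def)
    ultimately show "\<exists>p\<in>square_polys n. \<forall>i<N. coeff p (n - 1 - i) = c i" by blast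
  qed
qed

section \<open>First-order perturbation of a characteristic polynomial\<close>

lemma index_mult_mat_sum:
  assumes "M \<in> carrier_mat a b" "M' \<in> carrier_mat b c" "i < a" "j < c"
  shows "(M * M') $$ (i, j) = (\<Sum>l<b. M $$ (i, l) * M' $$ (l, j))"
  using assms by (auto simp: scalar_prod_def atLeast0LessThan intro!: sum.cong)

lemma coeff_1_prod_linear:
  fixes a b :: "'i \<Rightarrow> 'a :: idom"
  assumes "finite I"
  shows "coeff (\<Prod>i\<in>I. [:a i, b i:]) 1 = (\<Sum>i\<in>I. b i * (\<Prod>j\<in>I - {i}. a j))"
proof -
  have "coeff p 1 = poly (pderiv p) 0" for p :: "'a poly"
    by (simp add: poly_0_coeff_0 coeff_pderiv)
  then have "coeff (\<Prod>i\<in>I. [:a i, b i:]) 1 =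
    poly (\<Sum>i\<in>I. (\<Prod>j\<in>I - {i}. [:a j, b j:]) * pderiv [:a i, b i:]) 0"
    by (simp only: pderiv_prod)
  also have "\<dots> = (\<Sum>i\<in>I. b i * (\<Prod>j\<in>I - {i}. a j))"
    by (simp add: poly_sum poly_prod pderiv_pCons mult.commute)
  finally show ?thesis .
qed

lemma coeff_0_det_pencil:
  fixes M X :: "'a :: idom mat"
  assumes M: "M \<in> carrier_mat n n"
  shows "coeff (det (mat n n (\<lambda>ij. [:M $$ ij, X $$ ij:]))) 0 = det M"
  unfolding poly_0_coeff_0[symmetric]
  by (rule poly_det_cong[OF M]) auto

text \<open>
  Jacobi's formula for the derivative of the determinant of \<open>M + t X\<close> at
  \<open>t = 0\<close>: the Leibniz expansion is differentiated, the factor from row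
  \<open>i\<close> being replaced by an entry of \<open>X\<close>, and expanded along that row.
\<close>

lemma coeff_1_det_pencil:
  fixes M X :: "'a :: idom mat"
  assumes M: "M \<in> carrier_mat n n"
  shows "coeff (det (mat n n (\<lambda>ij. [:M $$ ij, X $$ ij:]))) 1 =
    (\<Sum>i<n. \<Sum>j<n. X $$ (i, j) * adj_mat M $$ (j, i))"
proof -
  let ?P = "{p. p permutes {0..<n}}"
  define R where "R i = mat n n (\<lambda>(k, j). if k = i then X $$ (i, j) else M $$ (k, j))" for i
  have "det (R i) = (\<Sum>p\<in>?P. signof p * (X $$ (i, p i) * (\<Prod>k\<in>{0..<n} - {i}. M $$ (k, p k))))"
    if i: "i < n" for i
  proof -
    have "det (R i) = (\<Sum>p\<in>?P. signof p * (\<Prod>k\<in>{0..<n}. R i $$ (k, p k)))"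
      by (rule det_def') (simp add: R_def)
    also have "\<dots> = (\<Sum>p\<in>?P. signof p * (X $$ (i, p i) * (\<Prod>k\<in>{0..<n} - {i}. M $$ (k, p k))))"
    proof (rule sum.cong[OF refl])
      fix p assume p: "p \<in> ?P"
      then have pk: "p k < n" if "k < n" for k using that permutes_in_image[of p "{0..<n}" k] by simp
      have "(\<Prod>k\<in>{0..<n}. R i $$ (k, p k)) = R i $$ (i, p i) * (\<Prod>k\<in>{0..<n} - {i}. R i $$ (k, p k))"
        using i by (intro prod.remove) auto
      also have "(\<Prod>k\<in>{0..<n} - {i}. R i $$ (k, p k)) = (\<Prod>k\<in>{0..<n} - {i}. M $$ (k, p k))"
        by (rule prod.cong) (auto simp: R_def pk)
      also have "R i $$ (i, p i) = X $$ (i, p i)" using i pk by (simp add: R_def)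
      finally show "signof p * (\<Prod>k\<in>{0..<n}. R i $$ (k, p k)) =
        signof p * (X $$ (i, p i) * (\<Prod>k\<in>{0..<n} - {i}. M $$ (k, p k)))" by simp
    qed
    finally show ?thesis .
  qed
  note detR = this
  have "coeff (det (mat n n (\<lambda>ij. [:M $$ ij, X $$ ij:]))) 1 =
    coeff (\<Sum>p\<in>?P. signof p * (\<Prod>k\<in>{0..<n}. [:M $$ (k, p k), X $$ (k, p k):])) 1"
    by (subst det_def', rule mat_carrier, rule arg_cong[of _ _ "\<lambda>q. coeff q 1"], rule sum.cong)
      (auto intro!: prod.cong simp: permutes_in_image)
  also have "\<dots> = (\<Sum>p\<in>?P. signof p * coeff (\<Prod>k\<in>{0..<n}. [:M $$ (k, p k), X $$ (k, p k):]) 1)"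
    unfolding coeff_sum
  proof (rule sum.cong[OF refl])
    fix p
    show "coeff (signof p * (\<Prod>k\<in>{0..<n}. [:M $$ (k, p k), X $$ (k, p k):])) 1 =
      signof p * coeff (\<Prod>k\<in>{0..<n}. [:M $$ (k, p k), X $$ (k, p k):]) 1"
      by (cases p rule: sign_cases) simp_all
  qed
  also have "\<dots> = (\<Sum>p\<in>?P. \<Sum>i<n. signof p *
      (X $$ (i, p i) * (\<Prod>k\<in>{0..<n} - {i}. M $$ (k, p k))))"
    unfolding coeff_1_prod_linear[OF finite_atLeastLessThan]
    by (simp add: sum_distrib_left atLeast0LessThan)
  also have "\<dots> = (\<Sum>i<n. det (R i))"
    by (subst sum.swap) (simp add: detR)
  also have "\<dots> = (\<Sum>i<n. \<Sum>j<n. X $$ (i, j) * adj_mat M $$ (j, i))"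
  proof (rule sum.cong[OF refl])
    fix i assume i: "i \<in> {..<n}"
    have "det (R i) = (\<Sum>j<n. R i $$ (i, j) * cofactor (R i) i j)"
      by (rule laplace_expansion_row) (use i in \<open>auto simp: R_def\<close>)
    also have "\<dots> = (\<Sum>j<n. X $$ (i, j) * adj_mat M $$ (j, i))"
    proof (rule sum.cong[OF refl])
      fix j assume j: "j \<in> {..<n}"
      have "mat_delete (R i) i j = mat_delete M i j"
        using i j M by (auto simp: mat_delete_def R_def intro!: eq_matI)
      then show "R i $$ (i, j) * cofactor (R i) i j = X $$ (i, j) * adj_mat M $$ (j, i)"
        using i j M by (simp add: R_def adj_mat_def cofactor_def)
    qed
    finally show "det (R i) = (\<Sum>j<n. X $$ (i, j) * adj_mat M $$ (j, i))" .
  qed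
  finally show ?thesis .
qed

text \<open>
  The coefficient of \<open>t\<^sup>j\<close> in the characteristic polynomial of
  \<open>A + t X\<close>. The determinant is taken over the polynomials in \<open>t\<close>
  whose coefficients are polynomials in \<open>s\<close>.
\<close>

definition char_poly_pencil :: "complex mat \<Rightarrow> complex mat \<Rightarrow> nat \<Rightarrow> complex poly" where
  "char_poly_pencil A X = coeff (det (mat (dim_row A) (dim_row A)
    (\<lambda>ij. [:char_poly_matrix A $$ ij, [:- X $$ ij:]:])))"

lemma char_poly_on_line:
  assumes A: "A \<in> carrier_mat n n" and X: "X \<in> carrier_mat n n" and "n \<le> D"
  shows "char_poly (A + t \<cdot>\<^sub>m X) = (\<Sum>j\<le>D. Polynomial.smult (t ^ j) (char_poly_pencil A X j))"
proof -
  define \<Phi> where "\<Phi> = det (mat n n (\<lambda>ij. [:char_poly_matrix A $$ ij, [:- X $$ ij:]:]))"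
  have \<Phi>: "char_poly_pencil A X = coeff \<Phi>" using A by (simp add: char_poly_pencil_def \<Phi>_def)
  have "char_poly (A + t \<cdot>\<^sub>m X) = poly \<Phi> [:t:]"
    unfolding \<Phi>_def char_poly_def
    by (rule poly_det_cong[symmetric, of _ n]) (use A X in \<open>auto simp: char_poly_matrix_def\<close>)
  also have "\<dots> = (\<Sum>j\<le>degree \<Phi>. coeff \<Phi> j * [:t:] ^ j)" by (rule poly_altdef)
  also have "\<dots> = (\<Sum>j\<le>D. coeff \<Phi> j * [:t:] ^ j)"
  proof (rule sum.mono_neutral_left)
    have "degree \<Phi> \<le> 1 * n" unfolding \<Phi>_def by (rule degree_det_le) auto
    then show "{..degree \<Phi>} \<subseteq> {..D}" using \<open>n \<le> D\<close> by auto
  qed (auto simp: coeff_eq_0)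
  also have "\<dots> = (\<Sum>j\<le>D. Polynomial.smult (t ^ j) (char_poly_pencil A X j))"
    unfolding \<Phi> by (intro sum.cong) (auto simp: poly_const_pow)
  finally show ?thesis .
qed

lemma char_poly_pencil_0:
  assumes A: "A \<in> carrier_mat n n"
  shows "char_poly_pencil A X 0 = char_poly A"
proof -
  have "mat n n (\<lambda>ij. [:char_poly_matrix A $$ ij, [:- X $$ ij:]:]) =
    mat n n (\<lambda>ij. [:char_poly_matrix A $$ ij, mat n n (\<lambda>ij. [:- X $$ ij:]) $$ ij:])"
    by (intro eq_matI) auto
  then show ?thesis using coeff_0_det_pencil[of "char_poly_matrix A" n] A
    by (simp add: char_poly_pencil_def char_poly_def)
qed

definition mat_trace :: "complex mat \<Rightarrow> complex" where
  "mat_trace M = (\<Sum>i<dim_row M. M $$ (i, i))"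

lemma mat_trace_mult:
  assumes "M \<in> carrier_mat k l" "M' \<in> carrier_mat l k"
  shows "mat_trace (M * M') = (\<Sum>i<k. \<Sum>j<l. M $$ (i, j) * M' $$ (j, i))"
  using assms
  by (auto simp: mat_trace_def scalar_prod_def atLeast0LessThan intro!: sum.cong)

lemma mat_trace_mult_comm:
  assumes "M \<in> carrier_mat k l" "M' \<in> carrier_mat l k"
  shows "mat_trace (M * M') = mat_trace (M' * M)"
  unfolding mat_trace_mult[OF assms] mat_trace_mult[OF assms(2,1)]
  by (subst sum.swap) (simp add: mult.commute)

lemma mat_trace_add:
  assumes "M \<in> carrier_mat k k" "M' \<in> carrier_mat k k"
  shows "mat_trace (M + M') = mat_trace M + mat_trace M'"
  using assms by (simp add: mat_trace_def sum.distrib)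

lemma mat_trace_smult: "mat_trace (c \<cdot>\<^sub>m M) = c * mat_trace M" if "M \<in> carrier_mat k k"
  using that by (simp add: mat_trace_def sum_distrib_left)

text \<open>
  The adjugate of the characteristic matrix is a matrix polynomial; these are its coefficients.
\<close>

definition adj_coeff :: "complex mat \<Rightarrow> nat \<Rightarrow> complex mat" where
  "adj_coeff A k = map_mat (\<lambda>p. coeff p k) (adj_mat (char_poly_matrix A))"

lemma adj_coeff_carrier [simp]:
  assumes "A \<in> carrier_mat n n" shows "adj_coeff A k \<in> carrier_mat n n"
  using adj_mat(1)[of "char_poly_matrix A" n] assms by (simp add: adj_coeff_def)

lemma degree_char_poly_matrix_entry:
  assumes "A \<in> carrier_mat n n" "i < n" "j < n"
  shows "degree (char_poly_matrix A $$ (i, j)) \<le> 1"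
  using assms by (auto simp: char_poly_matrix_def intro!: degree_add_le)

lemma degree_adj_char_poly_matrix:
  assumes A: "A \<in> carrier_mat n n" and ij: "i < n" "j < n"
  shows "degree (adj_mat (char_poly_matrix A) $$ (i, j)) < n"
proof -
  have "degree (det (mat_delete (char_poly_matrix A) j i)) \<le> 1 * (n - 1)"
  proof (rule degree_det_le)
    show "mat_delete (char_poly_matrix A) j i \<in> carrier_mat (n - 1) (n - 1)"
      using char_poly_matrix_closed[OF A] by (auto simp: mat_delete_def)
    fix a b assume ab: "a < n - 1" "b < n - 1"
    then show "degree (mat_delete (char_poly_matrix A) j i $$ (a, b)) \<le> 1"
      using char_poly_matrix_closed[OF A] ij
      by (auto simp: mat_delete_def intro!: degree_char_poly_matrix_entry[OF A, unfolded One_nat_def])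
  qed
  moreover have "degree (cofactor (char_poly_matrix A) j i) =
    degree (det (mat_delete (char_poly_matrix A) j i))"
    unfolding cofactor_def by (cases "even (i + j)") (simp_all add: add.commute)
  ultimately show ?thesis
    using carrier_matD[OF char_poly_matrix_closed[OF A]] ij by (simp add: adj_mat_def)
qed

lemma adj_coeff_top:
  assumes A: "A \<in> carrier_mat n n" and "n \<le> k"
  shows "adj_coeff A k = 0\<^sub>m n n"
proof (rule eq_matI)
  fix i j assume ij: "i < dim_row (0\<^sub>m n n)" "j < dim_col (0\<^sub>m n n)"
  then have "degree (adj_mat (char_poly_matrix A) $$ (i, j)) < k"
    using degree_adj_char_poly_matrix[OF A] \<open>n \<le> k\<close> by fastforce
  then show "adj_coeff A k $$ (i, j) = 0\<^sub>m n n $$ (i, j)"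
    using ij adj_mat(1)[of "char_poly_matrix A" n] A by (simp add: adj_coeff_def coeff_eq_0)
qed (use carrier_matD[OF adj_coeff_carrier[OF A, of k]] in auto)

text \<open>
  The recursion of Faddeev and Le Verrier: compare coefficients in the identity that the
  characteristic matrix times its adjugate is the characteristic polynomial times the identity.
\<close>

lemma adj_coeff_rec:
  assumes A: "A \<in> carrier_mat n n"
  shows "adj_coeff A k = A * adj_coeff A (Suc k) + coeff (char_poly A) (Suc k) \<cdot>\<^sub>m 1\<^sub>m n"
proof (rule eq_matI)
  let ?M = "char_poly_matrix A" and ?J = "adj_mat (char_poly_matrix A)"
  have M: "?M \<in> carrier_mat n n" and J: "?J \<in> carrier_mat n n"
    using A adj_mat(1)[of ?M n] by auto
  fix i j
  assume "i < dim_row (A * adj_coeff A (Suc k) + coeff (char_poly A) (Suc k) \<cdot>\<^sub>m 1\<^sub>m n)"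
    "j < dim_col (A * adj_coeff A (Suc k) + coeff (char_poly A) (Suc k) \<cdot>\<^sub>m 1\<^sub>m n)"
  then have ij: "i < n" "j < n" using A by auto
  have "(?M * ?J) $$ (i, j) = (\<Sum>l<n. ?M $$ (i, l) * ?J $$ (l, j))"
    using ij M J by (auto simp: scalar_prod_def atLeast0LessThan intro!: sum.cong)
  also have "\<dots> = (\<Sum>l<n. (if l = i then pCons 0 (?J $$ (l, j)) else 0) +
      Polynomial.smult (- A $$ (i, l)) (?J $$ (l, j)))"
    using ij A by (intro sum.cong) (auto simp: char_poly_matrix_def)
  also have "\<dots> = pCons 0 (?J $$ (i, j)) + (\<Sum>l<n. Polynomial.smult (- A $$ (i, l)) (?J $$ (l, j)))"
    using ij unfolding sum.distrib by simp
  finally have eq: "(det ?M \<cdot>\<^sub>m 1\<^sub>m n) $$ (i, j) =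
    pCons 0 (?J $$ (i, j)) + (\<Sum>l<n. Polynomial.smult (- A $$ (i, l)) (?J $$ (l, j)))"
    using adj_mat(2)[OF M] by simp
  have "coeff ((det ?M \<cdot>\<^sub>m 1\<^sub>m n) $$ (i, j)) (Suc k) =
      coeff (?J $$ (i, j)) k - (\<Sum>l<n. A $$ (i, l) * coeff (?J $$ (l, j)) (Suc k))"
    unfolding eq by (simp add: coeff_sum sum_negf)
  then have "coeff (?J $$ (i, j)) k = (\<Sum>l<n. A $$ (i, l) * coeff (?J $$ (l, j)) (Suc k)) +
      (if i = j then coeff (char_poly A) (Suc k) else 0)"
    using ij by (auto simp: char_poly_def)
  moreover have "(A * adj_coeff A (Suc k)) $$ (i, j) =
      (\<Sum>l<n. A $$ (i, l) * coeff (?J $$ (l, j)) (Suc k))"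
    using ij A J by (auto simp: adj_coeff_def scalar_prod_def atLeast0LessThan intro!: sum.cong)
  ultimately show "adj_coeff A k $$ (i, j) =
      (A * adj_coeff A (Suc k) + coeff (char_poly A) (Suc k) \<cdot>\<^sub>m 1\<^sub>m n) $$ (i, j)"
    using ij A J by (simp add: adj_coeff_def)
qed (use A carrier_matD[OF adj_coeff_carrier[OF A, of k]] in auto)

lemma pow_mat_Suc_left:
  assumes "(A :: 'a :: comm_ring_1 mat) \<in> carrier_mat n n"
  shows "A ^\<^sub>m Suc k = A * A ^\<^sub>m k"
proof (induction k)
  case (Suc k)
  have "A ^\<^sub>m Suc (Suc k) = (A * A ^\<^sub>m k) * A" using Suc by simp
  also have "\<dots> = A * (A ^\<^sub>m k * A)" using assms by (intro assoc_mult_mat) auto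
  finally show ?case by simp
qed (use assms in auto)

lemma mat_trace_adj_coeff:
  assumes A: "A \<in> carrier_mat n n" and X: "X \<in> carrier_mat n n"
  shows "j < n \<Longrightarrow> mat_trace (X * A ^\<^sub>m p * adj_coeff A (n - 1 - j)) =
    (\<Sum>i\<le>j. coeff (char_poly A) (n - j + i) * mat_trace (X * A ^\<^sub>m (p + i)))"
proof (induction j arbitrary: p)
  case 0
  have Y: "X * A ^\<^sub>m p \<in> carrier_mat n n" using A X by (intro mult_carrier_mat[of _ n n]) auto
  have "adj_coeff A (n - 1) = coeff (char_poly A) n \<cdot>\<^sub>m 1\<^sub>m n"
    using adj_coeff_rec[OF A, of "n - 1"] 0 A by (simp add: adj_coeff_top[OF A])
  then have "X * A ^\<^sub>m p * adj_coeff A (n - 1 - 0) = coeff (char_poly A) n \<cdot>\<^sub>m (X * A ^\<^sub>m p)"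
    using right_mult_one_mat[OF Y] by (simp add: mult_smult_distrib[OF Y one_carrier_mat])
  then show ?case by (simp only: mat_trace_smult[OF Y]) simp
next
  case (Suc j)
  let ?Y = "X * A ^\<^sub>m p" and ?k = "n - 1 - Suc j"
  have pw: "A ^\<^sub>m q \<in> carrier_mat n n" for q using A by simp
  have Y: "?Y \<in> carrier_mat n n" using X pw by (intro mult_carrier_mat[of _ n n]) auto
  have k: "Suc ?k = n - 1 - j" using Suc.prems by linarith
  have rec: "adj_coeff A ?k = A * adj_coeff A (n - 1 - j) + coeff (char_poly A) (n - Suc j) \<cdot>\<^sub>m 1\<^sub>m n"
    using adj_coeff_rec[OF A, of ?k] unfolding k diff_Suc_eq_diff_pred[of n j] .
  have J: "adj_coeff A (n - 1 - j) \<in> carrier_mat n n" using A by simp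
  have "?Y * adj_coeff A ?k = ?Y * (A * adj_coeff A (n - 1 - j)) +
      ?Y * (coeff (char_poly A) (n - Suc j) \<cdot>\<^sub>m 1\<^sub>m n)"
    unfolding rec
    by (rule mult_add_distrib_mat[OF Y mult_carrier_mat[OF A J] smult_carrier_mat[OF one_carrier_mat]])
  also have "?Y * (A * adj_coeff A (n - 1 - j)) = X * A ^\<^sub>m Suc p * adj_coeff A (n - 1 - j)"
  proof -
    have "?Y * (A * adj_coeff A (n - 1 - j)) = ?Y * A * adj_coeff A (n - 1 - j)"
      by (rule assoc_mult_mat[OF Y A J, symmetric])
    also have "?Y * A = X * A ^\<^sub>m Suc p"
      using assoc_mult_mat[OF X pw[of p] A] by simp
    finally show ?thesis .
  qed
  also have "?Y * (coeff (char_poly A) (n - Suc j) \<cdot>\<^sub>m 1\<^sub>m n) =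
      coeff (char_poly A) (n - Suc j) \<cdot>\<^sub>m ?Y"
    using right_mult_one_mat[OF Y] by (simp add: mult_smult_distrib[OF Y one_carrier_mat])
  finally have "mat_trace (?Y * adj_coeff A ?k) =
      mat_trace (X * A ^\<^sub>m Suc p * adj_coeff A (n - 1 - j)) +
      coeff (char_poly A) (n - Suc j) * mat_trace ?Y"
  proof -
    assume eq: "?Y * adj_coeff A ?k = X * A ^\<^sub>m Suc p * adj_coeff A (n - 1 - j) +
      coeff (char_poly A) (n - Suc j) \<cdot>\<^sub>m ?Y"
    have 1: "X * A ^\<^sub>m Suc p * adj_coeff A (n - 1 - j) \<in> carrier_mat n n"
      using X pw[of "Suc p"] J by (intro mult_carrier_mat[of _ n n]) auto
    have 2: "coeff (char_poly A) (n - Suc j) \<cdot>\<^sub>m ?Y \<in> carrier_mat n n" using Y by simp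
    show ?thesis unfolding eq mat_trace_add[OF 1 2] mat_trace_smult[OF Y] ..
  qed
  also have "mat_trace (X * A ^\<^sub>m Suc p * adj_coeff A (n - 1 - j)) =
      (\<Sum>i\<le>j. coeff (char_poly A) (n - j + i) * mat_trace (X * A ^\<^sub>m (Suc p + i)))"
    by (rule Suc.IH[OF Suc_lessD[OF Suc.prems]])
  also have "\<dots> + coeff (char_poly A) (n - Suc j) * mat_trace ?Y =
      (\<Sum>i\<le>Suc j. coeff (char_poly A) (n - Suc j + i) * mat_trace (X * A ^\<^sub>m (p + i)))"
  proof -
    have "n - Suc j + Suc i = n - j + i" for i using Suc.prems by simp
    then show ?thesis
      by (simp only: sum.atMost_Suc_shift) (simp add: add.commute)
  qed
  finally show ?case .
qed

text \<open>
  The coefficient of \<open>s\<^bsup>n-1-j\<^esup>\<close> in the derivative of the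
  characteristic polynomial in the direction \<open>X\<close> involves the traces of
  \<open>X A\<^sup>i\<close> only for \<open>i \<le> j\<close>, and that for
  \<open>i = j\<close> with coefficient \<open>-1\<close>. This is the triangularity on which
  the surjectivity of the tangent map rests.
\<close>

lemma coeff_char_poly_pencil_1:
  assumes A: "A \<in> carrier_mat n n" and X: "X \<in> carrier_mat n n" and j: "j < n"
  shows "coeff (char_poly_pencil A X 1) (n - 1 - j) =
    - (\<Sum>i\<le>j. coeff (char_poly A) (n - j + i) * mat_trace (X * A ^\<^sub>m i))"
proof -
  let ?X = "mat n n (\<lambda>ij. [:- X $$ ij:])"
  have M: "char_poly_matrix A \<in> carrier_mat n n" using A by simp
  have "char_poly_pencil A X 1 =
    coeff (det (mat n n (\<lambda>ij. [:char_poly_matrix A $$ ij, ?X $$ ij:]))) 1"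
    unfolding char_poly_pencil_def using A
    by (intro arg_cong[of _ _ "\<lambda>M. coeff (det M) 1"] eq_matI) auto
  also have "\<dots> = (\<Sum>a<n. \<Sum>b<n. ?X $$ (a, b) * adj_mat (char_poly_matrix A) $$ (b, a))"
    by (rule coeff_1_det_pencil[OF M])
  finally have "coeff (char_poly_pencil A X 1) (n - 1 - j) =
    (\<Sum>a<n. \<Sum>b<n. - (X $$ (a, b) * adj_coeff A (n - 1 - j) $$ (b, a)))"
    using adj_mat(1)[OF M] by (simp add: coeff_sum adj_coeff_def)
  also have "\<dots> = - mat_trace (X * adj_coeff A (n - 1 - j))"
    unfolding mat_trace_mult[OF X adj_coeff_carrier[OF A]] by (simp add: sum_negf)
  also have "X * adj_coeff A (n - 1 - j) = X * A ^\<^sub>m 0 * adj_coeff A (n - 1 - j)"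
    using A X by simp
  finally show ?thesis using mat_trace_adj_coeff[OF A X j, of 0] by simp
qed

section \<open>Transfer functions and Markov parameters\<close>

interpretation poly_to_rat: comm_ring_hom poly_to_rat
  by unfold_locales (auto simp: Zero_fract_def One_fract_def)

interpretation const_rat: comm_ring_hom "\<lambda>a. poly_to_rat [:a:]"
  by unfold_locales (auto simp: Zero_fract_def One_fract_def one_pCons mult.commute)

definition strictly_proper :: "complex poly fract \<Rightarrow> bool" where
  "strictly_proper r \<longleftrightarrow> (\<exists>p q. r = Fraction_Field.Fract p q \<and> degree p < degree q)"

lemma strictly_proper_0 [simp]: "strictly_proper 0"
  unfolding strictly_proper_def
  by (intro exI[of _ 0] exI[of _ "[:0, 1:]"]) (simp add: fract_collapse)

lemma strictly_proper_add:
  assumes "strictly_proper r" "strictly_proper r'"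
  shows "strictly_proper (r + r')"
proof -
  obtain p q p' q' where *: "r = Fraction_Field.Fract p q" "degree p < degree q"
    "r' = Fraction_Field.Fract p' q'" "degree p' < degree q'"
    using assms by (auto simp: strictly_proper_def)
  then have nz: "q \<noteq> 0" "q' \<noteq> 0" by auto
  have "degree (p * q') < degree q + degree q'" "degree (p' * q) < degree q + degree q'"
    using * degree_mult_le[of p q'] degree_mult_le[of p' q] by linarith+
  then have "degree (p * q' + p' * q) < degree (q * q')"
    using nz by (simp add: degree_mult_eq degree_add_less)
  moreover have "r + r' = Fraction_Field.Fract (p * q' + p' * q) (q * q')" using nz * by simp
  ultimately show ?thesis unfolding strictly_proper_def by blast
qed

lemma strictly_proper_cmult:
  assumes "strictly_proper r"
  shows "strictly_proper (poly_to_rat [:c:] * r)"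
proof -
  obtain p q where *: "r = Fraction_Field.Fract p q" "degree p < degree q"
    using assms by (auto simp: strictly_proper_def)
  then have "poly_to_rat [:c:] * r = Fraction_Field.Fract (Polynomial.smult c p) q"
    "degree (Polynomial.smult c p) < degree q"
    by (auto intro: le_less_trans[OF degree_smult_le])
  then show ?thesis unfolding strictly_proper_def by blast
qed

lemma strictly_proper_diff:
  assumes "strictly_proper r" "strictly_proper r'"
  shows "strictly_proper (r - r')"
  using strictly_proper_add[OF assms(1) strictly_proper_cmult[OF assms(2), of "-1"]]
  by (simp add: const_rat.hom_uminus del: minus_fract)

lemma strictly_proper_sum:
  "(\<And>i. i \<in> I \<Longrightarrow> strictly_proper (f i)) \<Longrightarrow> strictly_proper (\<Sum>i\<in>I. f i)"
  by (induction I rule: infinite_finite_induct) (auto intro: strictly_proper_add)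

lemma strictly_proper_const:
  assumes "strictly_proper (poly_to_rat [:c:])"
  shows "c = 0"
proof (rule ccontr)
  assume "c \<noteq> 0"
  obtain p q where *: "poly_to_rat [:c:] = Fraction_Field.Fract p q" "degree p < degree q"
    using assms by (auto simp: strictly_proper_def)
  then have "q \<noteq> 0" by auto
  then have "Polynomial.smult c q = p" using *(1) eq_fract(1)[of 1 q "[:c:]" p] by simp
  with \<open>c \<noteq> 0\<close> *(2) show False by auto
qed

text \<open>
  Multiplication by \<open>s\<close> raises the degree of a nonzero rational function by one.
\<close>

lemma strictly_proper_all_shifts:
  assumes "\<And>k. strictly_proper (poly_to_rat [:0, 1:] ^ k * r)"
  shows "r = 0"
proof (rule ccontr)
  assume "r \<noteq> 0"
  obtain p q where r: "r = Fraction_Field.Fract p q" and q: "q \<noteq> 0" by (rule Fract_cases)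
  with \<open>r \<noteq> 0\<close> have p: "p \<noteq> 0" by (auto simp: fract_collapse)
  obtain p' q' where *: "poly_to_rat [:0, 1:] ^ degree q * r = Fraction_Field.Fract p' q'"
    "degree p' < degree q'"
    using assms[of "degree q"] unfolding strictly_proper_def by blast
  have "poly_to_rat [:0, 1:] ^ degree q * r = Fraction_Field.Fract ([:0, 1:] ^ degree q * p) q"
    unfolding r poly_to_rat.hom_power[symmetric] by simp
  have q': "q' \<noteq> 0" using *(2) by auto
  have "Fraction_Field.Fract ([:0, 1:] ^ degree q * p) q = Fraction_Field.Fract p' q'"
    using * \<open>_ = Fraction_Field.Fract ([:0, 1:] ^ degree q * p) q\<close> by metis
  then have eq: "[:0, 1:] ^ degree q * p * q' = p' * q" using eq_fract(1)[OF q q'] by metis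
  have "degree ([:0, 1:] ^ degree q * p * q') = degree q + degree p + degree q'"
    using p q' by (simp add: degree_mult_eq degree_power_eq)
  then show False using eq *(2) degree_mult_le[of p' q] by simp
qed

lemma resolvent_unique:
  assumes A: "A \<in> carrier_mat n n" and X: "X \<in> carrier_mat n n"
    and eq: "map_mat poly_to_rat (char_poly_matrix A) * X = 1\<^sub>m n"
  shows "X = resolvent A"
proof -
  let ?M = "map_mat poly_to_rat (char_poly_matrix A)"
  have M: "?M \<in> carrier_mat n n" using A by simp
  have "X = resolvent A * ?M * X" using resolvent_inverse(3)[OF A] X by simp
  also have "\<dots> = resolvent A * (?M * X)" by (rule assoc_mult_mat[OF resolvent_inverse(1)[OF A] M X])
  also have "\<dots> = resolvent A" unfolding eq using resolvent_inverse(1)[OF A] by simp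
  finally show ?thesis .
qed

lemma strictly_proper_resolvent:
  assumes A: "A \<in> carrier_mat n n" and ij: "i < n" "j < n"
  shows "strictly_proper (resolvent A $$ (i, j))"
proof -
  let ?M = "char_poly_matrix A" and ?h = "map_mat poly_to_rat"
  have M: "?M \<in> carrier_mat n n" using A by simp
  note J = adj_mat(1)[OF M] and R = resolvent_inverse(1)[OF A]
  have "?h ?M * ?h (adj_mat ?M) = ?h (char_poly A \<cdot>\<^sub>m 1\<^sub>m n)"
    using poly_to_rat.mat_hom_mult[OF M J] adj_mat(2)[OF M] by (simp add: char_poly_def)
  also have "\<dots> = poly_to_rat (char_poly A) \<cdot>\<^sub>m 1\<^sub>m n"
    by (rule eq_matI) auto
  finally have MJ: "?h ?M * ?h (adj_mat ?M) = poly_to_rat (char_poly A) \<cdot>\<^sub>m 1\<^sub>m n" .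
  have "?h (adj_mat ?M) = resolvent A * ?h ?M * ?h (adj_mat ?M)"
    using resolvent_inverse(3)[OF A] J by simp
  also have "\<dots> = resolvent A * (poly_to_rat (char_poly A) \<cdot>\<^sub>m 1\<^sub>m n)"
    unfolding MJ[symmetric] using M J by (intro assoc_mult_mat[OF R]) auto
  also have "\<dots> = poly_to_rat (char_poly A) \<cdot>\<^sub>m resolvent A"
    using right_mult_one_mat[OF R] by (simp add: mult_smult_distrib[OF R one_carrier_mat])
  finally have "?h (adj_mat ?M) $$ (i, j) = (poly_to_rat (char_poly A) \<cdot>\<^sub>m resolvent A) $$ (i, j)"
    by simp
  then have eq: "poly_to_rat (adj_mat ?M $$ (i, j)) = poly_to_rat (char_poly A) * resolvent A $$ (i, j)"
    using ij J R by simp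
  have nz: "char_poly A \<noteq> 0" and deg: "degree (char_poly A) = n"
    using degree_monic_char_poly[OF A] by auto
  obtain p q where pq: "resolvent A $$ (i, j) = Fraction_Field.Fract p q" "q \<noteq> 0"
    by (rule Fract_cases)
  have "resolvent A $$ (i, j) = Fraction_Field.Fract (adj_mat ?M $$ (i, j)) (char_poly A)"
    using eq nz pq by (simp add: eq_fract(1) mult_ac)
  then show ?thesis
    using degree_adj_char_poly_matrix[OF A ij] deg unfolding strictly_proper_def by metis
qed

lemma transfer_function_carrier [simp]:
  assumes "A \<in> carrier_mat n n" "B \<in> carrier_mat n k" "C \<in> carrier_mat m n"
  shows "transfer_function A B C \<in> carrier_mat m k"
  using assms resolvent_inverse(1)[OF assms(1)] unfolding transfer_function_def
  by (intro mult_carrier_mat[of _ m n]) auto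

lemma strictly_proper_transfer_function:
  assumes A: "A \<in> carrier_mat n n" and B: "B \<in> carrier_mat n k" and C: "C \<in> carrier_mat m n"
    and ij: "i < m" "j < k"
  shows "strictly_proper (transfer_function A B C $$ (i, j))"
proof -
  let ?c = "\<lambda>a. poly_to_rat [:a:]"
  note R = resolvent_inverse(1)[OF A]
  have CR: "const_mat C * resolvent A \<in> carrier_mat m n"
    using C R by (intro mult_carrier_mat[of _ m n]) auto
  have 1: "(const_mat C * resolvent A) $$ (i, l) = (\<Sum>u<n. ?c (C $$ (i, u)) * resolvent A $$ (u, l))"
    if "l < n" for l
    using index_mult_mat_sum[of "const_mat C" m n "resolvent A" n i l] ij C R that by simp
  have "transfer_function A B C $$ (i, j) =
      (\<Sum>l<n. (const_mat C * resolvent A) $$ (i, l) * ?c (B $$ (l, j)))"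
    using index_mult_mat_sum[OF CR, of "const_mat B" k i j] ij B
    unfolding transfer_function_def by simp
  also have "\<dots> = (\<Sum>l<n. ?c (B $$ (l, j)) * (\<Sum>u<n. ?c (C $$ (i, u)) * resolvent A $$ (u, l)))"
    by (intro sum.cong refl) (simp only: 1 lessThan_iff mult.commute)
  finally show ?thesis
    using strictly_proper_resolvent[OF A]
    by (auto intro!: strictly_proper_sum strictly_proper_cmult)
qed

text \<open>
  From \<open>s R = A R + 1\<close> for the resolvent \<open>R\<close>. The summand
  \<open>C B\<close> is the polynomial part of \<open>s G\<close>, so iteration reads off the
  Markov parameters of \<open>G\<close> one after the other.
\<close>

lemma transfer_function_shift:
  assumes A: "A \<in> carrier_mat n n" and B: "B \<in> carrier_mat n k" and C: "C \<in> carrier_mat m n"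
  shows "transfer_function A B (C * A) + const_mat (C * B) =
    poly_to_rat [:0, 1:] \<cdot>\<^sub>m transfer_function A B C"
proof -
  let ?s = "poly_to_rat [:0, 1:]" and ?R = "resolvent A"
  let ?A = "const_mat A" and ?B = "const_mat B" and ?C = "const_mat C"
  note R = resolvent_inverse(1)[OF A]
  have cA: "?A \<in> carrier_mat n n" and cB: "?B \<in> carrier_mat n k" and cC: "?C \<in> carrier_mat m n"
    using assms by auto
  have M: "map_mat poly_to_rat (char_poly_matrix A) = ?s \<cdot>\<^sub>m 1\<^sub>m n - ?A"
  proof (rule eq_matI)
    fix i j assume "i < dim_row (?s \<cdot>\<^sub>m 1\<^sub>m n - ?A)" "j < dim_col (?s \<cdot>\<^sub>m 1\<^sub>m n - ?A)"
    then have ij: "i < n" "j < n" using A by auto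
    then have "char_poly_matrix A $$ (i, j) = (if i = j then [:0, 1:] else 0) - [:A $$ (i, j):]"
      using A by (auto simp: char_poly_matrix_def)
    then show "map_mat poly_to_rat (char_poly_matrix A) $$ (i, j) = (?s \<cdot>\<^sub>m 1\<^sub>m n - ?A) $$ (i, j)"
      using ij A carrier_matD[OF char_poly_matrix_closed[OF A]]
      by (auto simp: poly_to_rat.hom_minus simp del: diff_fract)
  qed (use A carrier_matD[OF char_poly_matrix_closed[OF A]] in auto)
  have sR: "?s \<cdot>\<^sub>m ?R \<in> carrier_mat n n" using R by simp
  have "(?s \<cdot>\<^sub>m 1\<^sub>m n - ?A) * ?R = ?s \<cdot>\<^sub>m 1\<^sub>m n * ?R - ?A * ?R"
    by (rule minus_mult_distrib_mat[OF smult_carrier_mat[OF one_carrier_mat] cA R])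
  also have "?s \<cdot>\<^sub>m 1\<^sub>m n * ?R = ?s \<cdot>\<^sub>m ?R"
    unfolding mult_smult_assoc_mat[OF one_carrier_mat R] left_mult_one_mat[OF R] ..
  finally have eq: "?s \<cdot>\<^sub>m ?R - ?A * ?R = 1\<^sub>m n"
    using resolvent_inverse(2)[OF A] unfolding M by (rule trans[OF sym])
  have AR: "?A * ?R \<in> carrier_mat n n" using cA R by (rule mult_carrier_mat)
  have sR_eq: "?s \<cdot>\<^sub>m ?R = ?A * ?R + 1\<^sub>m n"
    unfolding eq[symmetric] using R A by (intro eq_matI) (simp_all del: index_mult_mat(1))
  have "?s \<cdot>\<^sub>m transfer_function A B C = ?C * (?s \<cdot>\<^sub>m ?R) * ?B"
    unfolding transfer_function_def mult_smult_distrib[OF cC R]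
      mult_smult_assoc_mat[OF mult_carrier_mat[OF cC R] cB] ..
  also have "\<dots> = (?C * (?A * ?R) + ?C) * ?B"
    unfolding sR_eq mult_add_distrib_mat[OF cC AR one_carrier_mat] using right_mult_one_mat[OF cC]
    by simp
  also have "\<dots> = ?C * (?A * ?R) * ?B + ?C * ?B"
    by (rule add_mult_distrib_mat[OF mult_carrier_mat[OF cC AR] cC cB])
  also have "?C * (?A * ?R) = const_mat (C * A) * ?R"
    using assoc_mult_mat[OF cC cA R] const_rat.mat_hom_mult[OF C A] by simp
  also have "?C * ?B = const_mat (C * B)" using const_rat.mat_hom_mult[OF C B] by simp
  finally show ?thesis unfolding transfer_function_def by simp
qed

definition markov :: "complex mat \<Rightarrow> complex mat \<Rightarrow> complex mat \<Rightarrow> nat \<Rightarrow> complex mat" where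
  "markov A B C k = C * A ^\<^sub>m k * B"

lemma markov_carrier [simp]:
  assumes "A \<in> carrier_mat n n" "B \<in> carrier_mat n k" "C \<in> carrier_mat m n"
  shows "markov A B C p \<in> carrier_mat m k"
  using assms pow_carrier_mat[OF assms(1), of p] unfolding markov_def
  by (intro mult_carrier_mat[of _ m n]) auto

lemma markov_Suc:
  assumes "A \<in> carrier_mat n n" "C \<in> carrier_mat m n"
  shows "markov A B C (Suc p) = markov A B (C * A) p"
  unfolding markov_def pow_mat_Suc_left[OF assms(1)]
  using assoc_mult_mat[OF assms(2,1) pow_carrier_mat[OF assms(1)], of p] by simp

text \<open>
  In \<open>s G\<close> the constant \<open>C B\<close> is determined because a nonzero constant
  is not strictly proper.
\<close>

lemma product_eq_if_transfer_function_eq: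
  assumes A: "A \<in> carrier_mat n n" and B: "B \<in> carrier_mat n k" and C: "C \<in> carrier_mat m n"
    and A': "A' \<in> carrier_mat n' n'" and B': "B' \<in> carrier_mat n' k" and C': "C' \<in> carrier_mat m n'"
    and G: "transfer_function A B C = transfer_function A' B' C'"
  shows "C * B = C' * B'"
proof (rule eq_matI)
  fix i j assume "i < dim_row (C' * B')" "j < dim_col (C' * B')"
  then have ij: "i < m" "j < k" using C' B' by auto
  let ?G = "transfer_function A B (C * A)" and ?G' = "transfer_function A' B' (C' * A')"
  have eq: "?G + const_mat (C * B) = ?G' + const_mat (C' * B')"
    unfolding transfer_function_shift[OF A B C] transfer_function_shift[OF A' B' C'] G ..
  have CA: "C * A \<in> carrier_mat m n" "C' * A' \<in> carrier_mat m n'" using A A' C C' by auto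
  note G = transfer_function_carrier[OF A B CA(1)] transfer_function_carrier[OF A' B' CA(2)]
  have CB: "C * B \<in> carrier_mat m k" "C' * B' \<in> carrier_mat m k" using B B' C C' by auto
  have "?G $$ (i, j) + poly_to_rat [:(C * B) $$ (i, j):] = (?G + const_mat (C * B)) $$ (i, j)"
    using ij G B C by (simp del: add_fract index_mult_mat(1))
  also have "\<dots> = ?G' $$ (i, j) + poly_to_rat [:(C' * B') $$ (i, j):]"
    unfolding eq using ij G B' C' by (simp del: add_fract index_mult_mat(1))
  finally have "poly_to_rat [:(C * B) $$ (i, j):] - poly_to_rat [:(C' * B') $$ (i, j):] =
    ?G' $$ (i, j) - ?G $$ (i, j)"
    by (simp add: algebra_simps del: add_fract diff_fract index_mult_mat(1))
  then have "poly_to_rat [:(C * B) $$ (i, j) - (C' * B') $$ (i, j):] = ?G' $$ (i, j) - ?G $$ (i, j)"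
    by (simp only: const_rat.hom_minus)
  moreover have "strictly_proper (?G' $$ (i, j) - ?G $$ (i, j))"
    using ij CA A B A' B' by (intro strictly_proper_diff strictly_proper_transfer_function)
  ultimately show "(C * B) $$ (i, j) = (C' * B') $$ (i, j)"
    using strictly_proper_const by (metis right_minus_eq)
qed (use B B' C C' in auto)

lemma mat_add_right_imp_eq:
  fixes X :: "'a :: ring mat"
  assumes "X \<in> carrier_mat k l" "Y \<in> carrier_mat k l" "Z \<in> carrier_mat k l" "X + Z = Y + Z"
  shows "X = Y"
proof (rule eq_matI)
  fix i j assume ij: "i < dim_row Y" "j < dim_col Y"
  have "(X + Z) $$ (i, j) = (Y + Z) $$ (i, j)" using assms(4) by simp
  then show "X $$ (i, j) = Y $$ (i, j)" using ij assms(1-3) by simp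
qed (use assms in auto)

lemma markov_eq_if_transfer_function_eq:
  assumes A: "A \<in> carrier_mat n n" and B: "B \<in> carrier_mat n k"
    and A': "A' \<in> carrier_mat n' n'" and B': "B' \<in> carrier_mat n' k"
    and "C \<in> carrier_mat m n" and "C' \<in> carrier_mat m n'"
    and "transfer_function A B C = transfer_function A' B' C'"
  shows "markov A B C p = markov A' B' C' p"
  using assms(5-)
proof (induction p arbitrary: C C')
  case (0 C C')
  then show ?case
    using product_eq_if_transfer_function_eq[OF A B 0(1) A' B' 0(2,3)] A A' by (simp add: markov_def)
next
  case (Suc p C C')
  note C = \<open>C \<in> carrier_mat m n\<close> and C' = \<open>C' \<in> carrier_mat m n'\<close>
  have CA: "C * A \<in> carrier_mat m n" "C' * A' \<in> carrier_mat m n'" using A A' C C' by auto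
  note CB = product_eq_if_transfer_function_eq[OF A B C A' B' C' Suc.prems(3)]
  have "transfer_function A B (C * A) + const_mat (C * B) =
    transfer_function A' B' (C' * A') + const_mat (C * B)"
    using transfer_function_shift[OF A B C] transfer_function_shift[OF A' B' C'] Suc.prems(3) CB
    by simp
  then have "transfer_function A B (C * A) = transfer_function A' B' (C' * A')"
    by (rule mat_add_right_imp_eq[rotated 3])
      (use transfer_function_carrier[OF A B CA(1)] transfer_function_carrier[OF A' B' CA(2)] B C in auto)
  then show ?case
    unfolding markov_Suc[OF A C] markov_Suc[OF A' C'] by (rule Suc.IH[OF CA])
qed

text \<open>
  With equal Markov parameters, multiplication of the difference by \<open>s\<^sup>p\<close>
  leaves no polynomial part, so that it stays strictly proper for all \<open>p\<close>.
\<close>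

lemma transfer_function_eq_if_markov_eq:
  assumes A: "A \<in> carrier_mat n n" and B: "B \<in> carrier_mat n k" and C: "C \<in> carrier_mat m n"
    and A': "A' \<in> carrier_mat n' n'" and B': "B' \<in> carrier_mat n' k" and C': "C' \<in> carrier_mat m n'"
    and h: "\<And>p. markov A B C p = markov A' B' C' p"
  shows "transfer_function A B C = transfer_function A' B' C'"
proof (rule eq_matI)
  let ?s = "poly_to_rat [:0, 1:]"
  let ?G = "\<lambda>p. transfer_function A B (C * A ^\<^sub>m p)"
  let ?G' = "\<lambda>p. transfer_function A' B' (C' * A' ^\<^sub>m p)"
  fix i j assume "i < dim_row (transfer_function A' B' C')" "j < dim_col (transfer_function A' B' C')"
  then have ij: "i < m" "j < k" using transfer_function_carrier[OF A' B' C'] by auto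
  have CA: "C * A ^\<^sub>m p \<in> carrier_mat m n" "C' * A' ^\<^sub>m p \<in> carrier_mat m n'" for p
    using A A' C C' by (auto intro!: mult_carrier_mat)
  note G = transfer_function_carrier[OF A B CA(1)] transfer_function_carrier[OF A' B' CA(2)]
  have "?G p $$ (i, j) - ?G' p $$ (i, j) = ?s ^ p * (?G 0 $$ (i, j) - ?G' 0 $$ (i, j))" for p
  proof (induction p)
    case (Suc p)
    have CAS: "C * A ^\<^sub>m Suc p = C * A ^\<^sub>m p * A" "C' * A' ^\<^sub>m Suc p = C' * A' ^\<^sub>m p * A'"
      using assoc_mult_mat[OF C pow_carrier_mat[OF A] A]
        assoc_mult_mat[OF C' pow_carrier_mat[OF A'] A'] by simp_all
    have CB: "C * A ^\<^sub>m p * B = C' * A' ^\<^sub>m p * B'" using h[of p] by (simp add: markov_def)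
    have "?G (Suc p) + const_mat (C * A ^\<^sub>m p * B) = ?s \<cdot>\<^sub>m ?G p"
      "?G' (Suc p) + const_mat (C * A ^\<^sub>m p * B) = ?s \<cdot>\<^sub>m ?G' p"
      unfolding CAS using transfer_function_shift[OF A B CA(1), of p] apply simp
      unfolding CB using transfer_function_shift[OF A' B' CA(2), of p] by simp
    from arg_cong[OF this(1), of "\<lambda>M. M $$ (i, j)"] arg_cong[OF this(2), of "\<lambda>M. M $$ (i, j)"]
    have 1: "?G (Suc p) $$ (i, j) + poly_to_rat [:(C * A ^\<^sub>m p * B) $$ (i, j):] = ?s * ?G p $$ (i, j)"
      and 2: "?G' (Suc p) $$ (i, j) + poly_to_rat [:(C * A ^\<^sub>m p * B) $$ (i, j):] = ?s * ?G' p $$ (i, j)"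
      using ij G[of p] G[of "Suc p"] C B by (simp_all del: add_fract index_mult_mat(1) pow_mat.simps)
    have "?G (Suc p) $$ (i, j) - ?G' (Suc p) $$ (i, j) = ?s * (?G p $$ (i, j) - ?G' p $$ (i, j))"
      unfolding right_diff_distrib 1[symmetric] 2[symmetric] by (simp del: add_fract)
    also have "\<dots> = ?s ^ Suc p * (?G 0 $$ (i, j) - ?G' 0 $$ (i, j))"
      unfolding Suc.IH by (simp add: mult.assoc)
    finally show ?case .
  qed simp
  moreover have "strictly_proper (?G p $$ (i, j) - ?G' p $$ (i, j))" for p
    by (intro strictly_proper_diff strictly_proper_transfer_function[OF A B CA(1) ij]
        strictly_proper_transfer_function[OF A' B' CA(2) ij])
  ultimately have "?G 0 $$ (i, j) - ?G' 0 $$ (i, j) = 0"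
    by (intro strictly_proper_all_shifts) simp
  then show "transfer_function A B C $$ (i, j) = transfer_function A' B' C' $$ (i, j)"
    using A A' C C' by simp
qed (use transfer_function_carrier[OF A B C] transfer_function_carrier[OF A' B' C'] in auto)

lemma resolvent_transpose:
  assumes A: "A \<in> carrier_mat n n"
  shows "resolvent A\<^sup>T = (resolvent A)\<^sup>T"
proof (rule resolvent_unique[symmetric])
  let ?M = "map_mat poly_to_rat (char_poly_matrix A)"
  have M: "?M \<in> carrier_mat n n" using A by simp
  have "map_mat poly_to_rat (char_poly_matrix A\<^sup>T) = ?M\<^sup>T"
    by (rule eq_matI) (use A in \<open>auto simp: char_poly_matrix_def\<close>)
  then show "map_mat poly_to_rat (char_poly_matrix A\<^sup>T) * (resolvent A)\<^sup>T = 1\<^sub>m n"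
    using transpose_mult[OF resolvent_inverse(1)[OF A] M] resolvent_inverse(3)[OF A] by simp
qed (use A resolvent_inverse(1)[OF A] in auto)

lemma transfer_function_transpose:
  assumes A: "A \<in> carrier_mat n n" and B: "B \<in> carrier_mat n k" and C: "C \<in> carrier_mat m n"
  shows "(transfer_function A B C)\<^sup>T = transfer_function A\<^sup>T C\<^sup>T B\<^sup>T"
proof -
  note R = resolvent_inverse(1)[OF A]
  have cB: "const_mat B \<in> carrier_mat n k" and cC: "const_mat C \<in> carrier_mat m n" using B C by auto
  have T: "(const_mat M)\<^sup>T = const_mat M\<^sup>T" for M by (rule eq_matI) auto
  have "(transfer_function A B C)\<^sup>T = (const_mat B)\<^sup>T * (const_mat C * resolvent A)\<^sup>T"
    unfolding transfer_function_def by (rule transpose_mult[OF mult_carrier_mat[OF cC R] cB])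
  also have "\<dots> = (const_mat B)\<^sup>T * ((resolvent A)\<^sup>T * (const_mat C)\<^sup>T)"
    using transpose_mult[OF cC R] by simp
  also have "\<dots> = (const_mat B)\<^sup>T * (resolvent A)\<^sup>T * (const_mat C)\<^sup>T"
    by (rule assoc_mult_mat[symmetric, OF transpose_carrier_mat[THEN iffD2, OF cB]
        transpose_carrier_mat[THEN iffD2, OF R] transpose_carrier_mat[THEN iffD2, OF cC]])
  finally show ?thesis unfolding transfer_function_def T resolvent_transpose[OF A] .
qed

lemma poly_reflect_nonzero: "q \<noteq> 0 \<Longrightarrow> poly_reflect q \<noteq> 0" for q :: "complex poly"
  by (simp add: pcompose_eq_0_iff)

interpretation rat_reflect: comm_ring_hom rat_reflect
proof
  fix x y :: "complex poly fract"
  obtain p q where x: "x = Fraction_Field.Fract p q" "q \<noteq> 0" by (rule Fract_cases)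
  obtain p' q' where y: "y = Fraction_Field.Fract p' q'" "q' \<noteq> 0" by (rule Fract_cases)
  show "rat_reflect (x + y) = rat_reflect x + rat_reflect y"
    using x y by (simp add: rat_reflect_Fract poly_reflect_nonzero pcompose_add pcompose_mult)
  show "rat_reflect (x * y) = rat_reflect x * rat_reflect y"
    using x y by (simp add: rat_reflect_Fract pcompose_mult)
next
  have "rat_reflect (Fraction_Field.Fract 0 1) = Fraction_Field.Fract 0 1"
    "rat_reflect (Fraction_Field.Fract 1 1) = Fraction_Field.Fract 1 1"
    by (simp_all only: rat_reflect_Fract[OF one_neq_zero] pcompose_0 pcompose_1)
  then show "rat_reflect 0 = 0" "rat_reflect 1 = 1" by (simp_all add: fract_collapse)
qed

lemma rat_reflect_poly: "rat_reflect (poly_to_rat p) = poly_to_rat (poly_reflect p)"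
  by (simp add: rat_reflect_Fract pcompose_1)

lemma map_reflect_resolvent:
  assumes A: "A \<in> carrier_mat n n"
  shows "- map_mat rat_reflect (resolvent A) = resolvent (- A)"
proof (rule resolvent_unique)
  let ?h = "map_mat poly_to_rat"
  note R = resolvent_inverse(1)[OF A]
  have M: "?h (char_poly_matrix A) \<in> carrier_mat n n" using A by simp
  have "map_mat rat_reflect (?h (char_poly_matrix A)) = - ?h (char_poly_matrix (- A))"
    by (rule eq_matI) (use A in \<open>auto simp: char_poly_matrix_def rat_reflect_poly pcompose_pCons
      poly_to_rat.hom_uminus[symmetric] simp del: minus_fract\<close>)
  moreover have "map_mat rat_reflect (?h (char_poly_matrix A)) * map_mat rat_reflect (resolvent A) = 1\<^sub>m n"
    using rat_reflect.mat_hom_mult[OF M R] resolvent_inverse(2)[OF A] rat_reflect.mat_hom_one by simp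
  ultimately show "?h (char_poly_matrix (- A)) * - map_mat rat_reflect (resolvent A) = 1\<^sub>m n"
    using A R carrier_matD[OF char_poly_matrix_closed[of "- A" n]] by simp
qed (use A resolvent_inverse(1)[OF A] in auto)

lemma transfer_function_reflect:
  assumes A: "A \<in> carrier_mat n n" and B: "B \<in> carrier_mat n k" and C: "C \<in> carrier_mat m n"
  shows "- map_mat rat_reflect (transfer_function A B C) = transfer_function (- A) B C"
proof -
  note R = resolvent_inverse(1)[OF A]
  have cB: "const_mat B \<in> carrier_mat n k" and cC: "const_mat C \<in> carrier_mat m n" using B C by auto
  have T: "map_mat rat_reflect (const_mat M) = const_mat M" for M
    by (rule eq_matI) (auto simp: rat_reflect_poly)
  have "map_mat rat_reflect (transfer_function A B C) =
    const_mat C * map_mat rat_reflect (resolvent A) * const_mat B"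
    unfolding transfer_function_def
    by (simp only: rat_reflect.mat_hom_mult[OF mult_carrier_mat[OF cC R] cB]
        rat_reflect.mat_hom_mult[OF cC R] T)
  then show ?thesis
    unfolding transfer_function_def map_reflect_resolvent[OF A, symmetric] using cB cC R by simp
qed

section \<open>Isomorphic realizations\<close>

lemma mat_assoc:
  fixes X Y Z :: "'a :: semiring_0 mat"
  assumes "dim_col X = dim_row Y" "dim_col Y = dim_row Z"
  shows "X * Y * Z = X * (Y * Z)"
  by (rule assoc_mult_mat[of X "dim_row X" "dim_row Y" Y "dim_row Z" Z "dim_col Z"])
    (use assms in auto)

lemma inverse_mat_exists:
  fixes M :: "'a :: field mat"
  assumes M: "M \<in> carrier_mat n n" and "det M \<noteq> 0"
  shows "\<exists>N\<in>carrier_mat n n. M * N = 1\<^sub>m n \<and> N * M = 1\<^sub>m n"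
  using det_non_zero_imp_unit[OF assms, of "()"] by (auto simp: Units_def ring_mat_def)

lemma mult_mat_right_cancel:
  fixes M :: "'a :: field mat"
  assumes M: "M \<in> carrier_mat n n" and "det M \<noteq> 0"
    and X: "X \<in> carrier_mat k n" and Y: "Y \<in> carrier_mat k n" and eq: "X * M = Y * M"
  shows "X = Y"
proof -
  obtain N where N: "N \<in> carrier_mat n n" "M * N = 1\<^sub>m n"
    using inverse_mat_exists[OF assms(1,2)] by blast
  have "X = X * M * N" using assoc_mult_mat[OF X M N(1)] N(2) X by simp
  also have "\<dots> = Y" unfolding eq using assoc_mult_mat[OF Y M N(1)] N(2) Y by simp
  finally show ?thesis .
qed

lemma mod_less_factor: "r < K * m \<Longrightarrow> r mod m < m" for r m :: nat
  by (cases "m = 0") auto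

text \<open>
  The blocks \<open>C A\<^sup>p\<close> for \<open>p < K\<close>, stacked: row \<open>r\<close>
  is row \<open>r mod m\<close> of block \<open>r div m\<close>.
\<close>

definition observability_mat :: "nat \<Rightarrow> complex mat \<Rightarrow> complex mat \<Rightarrow> complex mat" where
  "observability_mat K A C = mat (K * dim_row C) (dim_row A)
    (\<lambda>(r, j). (C * A ^\<^sub>m (r div dim_row C)) $$ (r mod dim_row C, j))"

definition controllability_mat :: "nat \<Rightarrow> complex mat \<Rightarrow> complex mat \<Rightarrow> complex mat" where
  "controllability_mat K A B = mat (dim_row A) (K * dim_col B)
    (\<lambda>(i, s). (A ^\<^sub>m (s div dim_col B) * B) $$ (i, s mod dim_col B))"

text \<open>
  The block Hankel matrix with the block \<open>h (p + q)\<close> in block row \<open>p\<close>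
  and block column \<open>q\<close>.
\<close>

definition hankel_mat :: "nat \<Rightarrow> nat \<Rightarrow> (nat \<Rightarrow> complex mat) \<Rightarrow> complex mat" where
  "hankel_mat m K h = mat (K * m) (K * m)
    (\<lambda>(r, s). h (r div m + s div m) $$ (r mod m, s mod m))"

lemma observability_mat_mult:
  assumes A: "A \<in> carrier_mat n n" and C: "C \<in> carrier_mat m n" and X: "X \<in> carrier_mat n l"
  shows "observability_mat K A C * X =
    mat (K * m) l (\<lambda>(r, j). (C * A ^\<^sub>m (r div m) * X) $$ (r mod m, j))"
proof (rule eq_matI)
  fix r j assume "r < dim_row (mat (K * m) l (\<lambda>(r, j). (C * A ^\<^sub>m (r div m) * X) $$ (r mod m, j)))"
    "j < dim_col (mat (K * m) l (\<lambda>(r, j). (C * A ^\<^sub>m (r div m) * X) $$ (r mod m, j)))"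
  then have r: "r < K * m" and j: "j < l" by auto
  then have rm: "r mod m < m" by (simp add: mod_less_factor)
  have O: "observability_mat K A C \<in> carrier_mat (K * m) n"
    using A C by (simp add: observability_mat_def)
  have CA: "C * A ^\<^sub>m (r div m) \<in> carrier_mat m n" by (rule mult_carrier_mat[OF C pow_carrier_mat[OF A]])
  show "(observability_mat K A C * X) $$ (r, j) =
    mat (K * m) l (\<lambda>(r, j). (C * A ^\<^sub>m (r div m) * X) $$ (r mod m, j)) $$ (r, j)"
    using r j A C unfolding index_mult_mat_sum[OF O X r j] index_mat(1)[OF r j] case_prod_conv
      index_mult_mat_sum[OF CA X rm j]
    by (intro sum.cong) (auto simp: observability_mat_def)
qed (use A C X in \<open>auto simp: observability_mat_def\<close>)

lemma mult_controllability_mat: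
  assumes A: "A \<in> carrier_mat n n" and B: "B \<in> carrier_mat n m" and X: "X \<in> carrier_mat l n"
  shows "X * controllability_mat K A B =
    mat l (K * m) (\<lambda>(i, s). (X * (A ^\<^sub>m (s div m) * B)) $$ (i, s mod m))"
proof (rule eq_matI)
  fix i s assume "i < dim_row (mat l (K * m) (\<lambda>(i, s). (X * (A ^\<^sub>m (s div m) * B)) $$ (i, s mod m)))"
    "s < dim_col (mat l (K * m) (\<lambda>(i, s). (X * (A ^\<^sub>m (s div m) * B)) $$ (i, s mod m)))"
  then have i: "i < l" and s: "s < K * m" by auto
  then have sm: "s mod m < m" by (simp add: mod_less_factor)
  have R: "controllability_mat K A B \<in> carrier_mat n (K * m)"
    using A B by (simp add: controllability_mat_def)
  have AB: "A ^\<^sub>m (s div m) * B \<in> carrier_mat n m" by (rule mult_carrier_mat[OF pow_carrier_mat[OF A] B])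
  show "(X * controllability_mat K A B) $$ (i, s) =
    mat l (K * m) (\<lambda>(i, s). (X * (A ^\<^sub>m (s div m) * B)) $$ (i, s mod m)) $$ (i, s)"
    using i s A B unfolding index_mult_mat_sum[OF X R i s] index_mat(1)[OF i s] case_prod_conv
      index_mult_mat_sum[OF X AB i sm]
    by (intro sum.cong) (auto simp: controllability_mat_def)
qed (use A B X in \<open>auto simp: controllability_mat_def\<close>)

lemma pow_mat_add:
  assumes A: "A \<in> carrier_mat n n"
  shows "A ^\<^sub>m (p + q) = A ^\<^sub>m p * A ^\<^sub>m q"
proof (induction q)
  case (Suc q)
  then show ?case
    using assoc_mult_mat[OF pow_carrier_mat[OF A] pow_carrier_mat[OF A] A, of p q] by simp
qed (use A pow_carrier_mat[OF A, of p] in simp)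

text \<open>
  For \<open>p = 0\<close> this factors the Hankel matrix through the state space; for
  \<open>p = 1\<close> it exposes \<open>A\<close>.
\<close>

lemma observability_mult_controllability:
  assumes A: "A \<in> carrier_mat n n" and B: "B \<in> carrier_mat n m" and C: "C \<in> carrier_mat m n"
  shows "observability_mat K A C * A ^\<^sub>m p * controllability_mat K A B =
    hankel_mat m K (\<lambda>q. markov A B C (q + p))"
proof -
  have O: "observability_mat K A C \<in> carrier_mat (K * m) n"
    using A C by (simp add: observability_mat_def)
  note Ap = pow_carrier_mat[OF A]
  have OA: "observability_mat K A C * A ^\<^sub>m p \<in> carrier_mat (K * m) n"
    by (rule mult_carrier_mat[OF O Ap])
  show ?thesis
    unfolding mult_controllability_mat[OF A B OA] hankel_mat_def
  proof (rule cong_mat[OF refl refl], clarsimp)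
    fix r s assume r: "r < K * m" and s: "s < K * m"
    then have m: "m > 0" by (cases m) auto
    have X: "A ^\<^sub>m p * (A ^\<^sub>m (s div m) * B) \<in> carrier_mat n m" using A B by (auto intro!: carrier_matI)
    have "observability_mat K A C * A ^\<^sub>m p * (A ^\<^sub>m (s div m) * B) =
      observability_mat K A C * (A ^\<^sub>m p * (A ^\<^sub>m (s div m) * B))"
      using O A B by (intro mat_assoc) auto
    also have "\<dots> = mat (K * m) m (\<lambda>(r, j). (C * A ^\<^sub>m (r div m) * (A ^\<^sub>m p * (A ^\<^sub>m (s div m) * B))) $$ (r mod m, j))"
      by (rule observability_mat_mult[OF A C X])
    finally have "(observability_mat K A C * A ^\<^sub>m p * (A ^\<^sub>m (s div m) * B)) $$ (r, s mod m) =
      (C * A ^\<^sub>m (r div m) * (A ^\<^sub>m p * (A ^\<^sub>m (s div m) * B))) $$ (r mod m, s mod m)"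
      using r m by simp
    also have "C * A ^\<^sub>m (r div m) * (A ^\<^sub>m p * (A ^\<^sub>m (s div m) * B)) =
      C * (A ^\<^sub>m (r div m) * (A ^\<^sub>m p * A ^\<^sub>m (s div m))) * B"
      using A B C by (simp add: mat_assoc)
    also have "\<dots> = markov A B C (r div m + s div m + p)"
      unfolding markov_def pow_mat_add[OF A, symmetric] by (simp add: add_ac)
    finally show "(observability_mat K A C * A ^\<^sub>m p * (A ^\<^sub>m (s div m) * B)) $$ (r, s mod m) =
      markov A B C (r div m + s div m + p) $$ (r mod m, s mod m)" .
  qed
qed

lemma controllability_intertwine:
  assumes A: "A \<in> carrier_mat n n" and B: "B \<in> carrier_mat n m" and A': "A' \<in> carrier_mat n n"
    and B': "B' \<in> carrier_mat n m" and S: "S \<in> carrier_mat n n"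
    and SA: "S * A = A' * S" and SB: "S * B = B'"
  shows "S * controllability_mat K A B = controllability_mat K A' B'"
proof -
  have SAp: "S * A ^\<^sub>m q = A' ^\<^sub>m q * S" for q
  proof (induction q)
    case (Suc q)
    have "S * A ^\<^sub>m Suc q = (S * A ^\<^sub>m q) * A" using S A by (simp add: mat_assoc)
    also have "\<dots> = A' ^\<^sub>m q * (S * A)" unfolding Suc using S A A' by (simp add: mat_assoc)
    also have "\<dots> = A' ^\<^sub>m Suc q * S" unfolding SA using S A' by (simp add: mat_assoc)
    finally show ?case .
  qed (use A A' S in simp)
  have "S * (A ^\<^sub>m q * B) = A' ^\<^sub>m q * B'" for q
  proof -
    have "S * (A ^\<^sub>m q * B) = (S * A ^\<^sub>m q) * B" using S A B by (simp add: mat_assoc)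
    also have "\<dots> = A' ^\<^sub>m q * (S * B)" unfolding SAp using S A' B by (simp add: mat_assoc)
    finally show ?thesis unfolding SB .
  qed
  then show ?thesis
    unfolding mult_controllability_mat[OF A B S] using A' B' by (simp add: controllability_mat_def)
qed

text \<open>
  A generalized minor: \<open>\<alpha>\<close> and \<open>\<beta>\<close> select linear
  combinations of rows and columns. Unlike the rank, it is a polynomial in the Markov
  parameters. If it is nonzero for some \<open>\<alpha>\<close> and \<open>\<beta>\<close> with
  \<open>n\<close> rows and columns, respectively, then a realization of order \<open>n\<close>
  is controllable and observable.
\<close>

definition hankel_probe :: "nat \<Rightarrow> nat \<Rightarrow> complex mat \<Rightarrow> complex mat \<Rightarrow> (nat \<Rightarrow> complex mat) \<Rightarrow> complex" where
  "hankel_probe m K \<alpha> \<beta> h = det (\<alpha> * hankel_mat m K h * \<beta>)"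

context
  fixes n m K :: nat and A B C \<alpha> \<beta> :: "complex mat"
  assumes A: "A \<in> carrier_mat n n" and B: "B \<in> carrier_mat n m" and C: "C \<in> carrier_mat m n"
    and \<alpha>: "\<alpha> \<in> carrier_mat n (K * m)" and \<beta>: "\<beta> \<in> carrier_mat (K * m) n"
    and probe: "hankel_probe m K \<alpha> \<beta> (markov A B C) \<noteq> 0"
begin

lemma probe_factors:
  "det (\<alpha> * observability_mat K A C) \<noteq> 0" "det (controllability_mat K A B * \<beta>) \<noteq> 0"
proof -
  have O: "\<alpha> * observability_mat K A C \<in> carrier_mat n n"
    and R: "controllability_mat K A B * \<beta> \<in> carrier_mat n n"
    using A B C \<alpha> \<beta> by (auto simp: observability_mat_def controllability_mat_def)
  have "\<alpha> * hankel_mat m K (markov A B C) * \<beta> =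
    \<alpha> * (observability_mat K A C * controllability_mat K A B) * \<beta>"
    using observability_mult_controllability[OF A B C, of K 0] A C
    by (simp add: observability_mat_def)
  also have "\<dots> = (\<alpha> * observability_mat K A C) * (controllability_mat K A B * \<beta>)"
    using A B C \<alpha> \<beta> by (simp add: mat_assoc observability_mat_def controllability_mat_def)
  finally show "det (\<alpha> * observability_mat K A C) \<noteq> 0" "det (controllability_mat K A B * \<beta>) \<noteq> 0"
    using probe det_mult[OF O R] by (auto simp: hankel_probe_def)
qed

text \<open>
  The controllability matrix has full row rank and is mapped by an intertwiner to that of the
  other realization.
\<close>

lemma intertwiner_unique:
  assumes A': "A' \<in> carrier_mat n n" and B': "B' \<in> carrier_mat n m"
    and S: "S \<in> carrier_mat n n" "S * A = A' * S" "S * B = B'"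
    and T: "T \<in> carrier_mat n n" "T * A = A' * T" "T * B = B'"
  shows "S = T"
proof (rule mult_mat_right_cancel[OF _ probe_factors(2) S(1) T(1)])
  let ?R = "controllability_mat K A B"
  have "S * ?R = T * ?R"
    unfolding controllability_intertwine[OF A B A' B' S] controllability_intertwine[OF A B A' B' T] ..
  moreover have "X * (?R * \<beta>) = X * ?R * \<beta>" if "X \<in> carrier_mat n n" for X
    using that A B \<beta> by (simp add: mat_assoc controllability_mat_def)
  ultimately show "S * (?R * \<beta>) = T * (?R * \<beta>)" using S(1) T(1) by simp
qed (use A B \<beta> in \<open>auto simp: controllability_mat_def\<close>)

text \<open>
  The product of the probed observability and controllability matrices \<open>O1 R1\<close> is a
  combination of Markov parameters and therefore the same for both realizations, and so are
  \<open>O1 A R1\<close>, \<open>O1 B\<close> and \<open>C R1\<close>. The isomorphism is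
  \<open>O2\<close> inverted times \<open>O1\<close>.
\<close>

lemma realizations_isomorphic:
  assumes A': "A' \<in> carrier_mat n n" and B': "B' \<in> carrier_mat n m" and C': "C' \<in> carrier_mat m n"
    and h: "\<And>p. markov A B C p = markov A' B' C' p"
  shows "\<exists>S\<in>carrier_mat n n. det S \<noteq> 0 \<and> S * A = A' * S \<and> S * B = B' \<and> C' * S = C"
proof -
  define O1 where "O1 = \<alpha> * observability_mat K A C"
  define O2 where "O2 = \<alpha> * observability_mat K A' C'"
  define R1 where "R1 = controllability_mat K A B * \<beta>"
  define R2 where "R2 = controllability_mat K A' B' * \<beta>"
  have c: "O1 \<in> carrier_mat n n" "O2 \<in> carrier_mat n n" "R1 \<in> carrier_mat n n" "R2 \<in> carrier_mat n n"
    using A B C A' B' C' \<alpha> \<beta>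
    by (auto simp: O1_def O2_def R1_def R2_def observability_mat_def controllability_mat_def)
  have det1: "det O1 \<noteq> 0" "det R1 \<noteq> 0" using probe_factors by (simp_all add: O1_def R1_def)
  have "(\<alpha> * observability_mat K A C) * A ^\<^sub>m p * (controllability_mat K A B * \<beta>) =
    \<alpha> * (observability_mat K A C * A ^\<^sub>m p * controllability_mat K A B) * \<beta>" for p
    using A B C \<alpha> \<beta> pow_carrier_mat[OF A, of p]
    by (simp add: mat_assoc observability_mat_def controllability_mat_def)
  moreover have "(\<alpha> * observability_mat K A' C') * A' ^\<^sub>m p * (controllability_mat K A' B' * \<beta>) =
    \<alpha> * (observability_mat K A' C' * A' ^\<^sub>m p * controllability_mat K A' B') * \<beta>" for p
    using A' B' C' \<alpha> \<beta> pow_carrier_mat[OF A', of p]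
    by (simp add: mat_assoc observability_mat_def controllability_mat_def)
  ultimately have OAR: "O1 * A ^\<^sub>m p * R1 = O2 * A' ^\<^sub>m p * R2" for p
    unfolding O1_def O2_def R1_def R2_def
    by (simp only: observability_mult_controllability[OF A B C]
        observability_mult_controllability[OF A' B' C'] h)
  have OR: "O1 * R1 = O2 * R2" using OAR[of 0] c A A' by simp
  have OAR1: "O1 * A * R1 = O2 * A' * R2" using OAR[of 1] c A A' by simp
  have OB: "O1 * B = O2 * B'"
  proof -
    have "O1 * B = \<alpha> * (observability_mat K A C * B)"
      using A B C \<alpha> by (simp add: O1_def mat_assoc observability_mat_def)
    also have "observability_mat K A C * B = observability_mat K A' C' * B'"
      unfolding observability_mat_mult[OF A C B] observability_mat_mult[OF A' C' B']
      using h by (simp add: markov_def)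
    also have "\<alpha> * \<dots> = O2 * B'"
      using A' B' C' \<alpha> by (simp add: O2_def mat_assoc observability_mat_def)
    finally show ?thesis .
  qed
  have CR: "C * R1 = C' * R2"
  proof -
    have "C * R1 = C * controllability_mat K A B * \<beta>"
      using A B C \<beta> by (simp add: R1_def mat_assoc controllability_mat_def)
    also have "C * controllability_mat K A B = C' * controllability_mat K A' B'"
    proof -
      have "C * (A ^\<^sub>m q * B) = C' * (A' ^\<^sub>m q * B')" for q
        using h[of q] A B C A' B' C' pow_carrier_mat[OF A, of q] pow_carrier_mat[OF A', of q]
        by (simp add: markov_def mat_assoc)
      then show ?thesis
        unfolding mult_controllability_mat[OF A B C] mult_controllability_mat[OF A' B' C'] by simp
    qed
    also have "\<dots> * \<beta> = C' * R2"
      using A' B' C' \<beta> by (simp add: R2_def mat_assoc controllability_mat_def)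
    finally show ?thesis .
  qed
  have "det O2 * det R2 = det O1 * det R1" using det_mult c OR by metis
  then have det2: "det O2 \<noteq> 0" using det1 by auto
  obtain Oi where Oi: "Oi \<in> carrier_mat n n" "Oi * O2 = 1\<^sub>m n"
    using inverse_mat_exists[OF c(2) det2] by blast
  define S where "S = Oi * O1"
  have S: "S \<in> carrier_mat n n" using Oi c by (simp add: S_def)
  have cancel: "Oi * (O2 * X) = X" if "X \<in> carrier_mat n k" for X k
    using assoc_mult_mat[OF Oi(1) c(2) that] Oi(2) that by simp
  have SR: "S * R1 = R2"
    using cancel[OF c(4)] c Oi(1) OR by (simp add: S_def mat_assoc)
  have SAR: "S * A * R1 = A' * R2"
  proof -
    have "S * A * R1 = Oi * (O1 * A * R1)" using c Oi(1) A by (simp add: S_def mat_assoc)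
    also have "\<dots> = Oi * (O2 * (A' * R2))" unfolding OAR1 using c A' by (simp add: mat_assoc)
    also have "\<dots> = A' * R2" by (rule cancel[of _ n]) (use A' c in simp)
    finally show ?thesis .
  qed
  have "S * A = A' * S"
  proof (rule mult_mat_right_cancel[OF c(3) det1(2), where k = n])
    show "S * A * R1 = A' * S * R1" unfolding SAR SR[symmetric] using A' S c by (simp add: mat_assoc)
  qed (use S A A' in simp_all)
  moreover have "S * B = B'"
  proof -
    have "S * B = Oi * (O1 * B)" using c Oi(1) B by (simp add: S_def mat_assoc)
    then show ?thesis unfolding OB using cancel[OF B'] by simp
  qed
  moreover have "C' * S = C"
  proof (rule mult_mat_right_cancel[OF c(3) det1(2), where k = m])
    show "C' * S * R1 = C * R1" unfolding CR SR[symmetric] using C' S c by (simp add: mat_assoc)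
  qed (use S C C' in simp_all)
  moreover have "det S \<noteq> 0"
  proof -
    have "det Oi * det O2 = 1" using det_mult[OF Oi(1) c(2)] Oi(2) by simp
    then have "det Oi \<noteq> 0" by auto
    then show ?thesis using det_mult[OF Oi(1) c(1)] det1 by (simp add: S_def)
  qed
  ultimately show ?thesis using S by blast
qed

text \<open>
  A realization of order \<open>n'\<close> factors the probed Hankel matrix through a space of
  dimension \<open>n'\<close>.
\<close>

lemma probe_order_minimal:
  assumes A': "A' \<in> carrier_mat n' n'" and B': "B' \<in> carrier_mat n' m" and C': "C' \<in> carrier_mat m n'"
    and h: "\<And>p. markov A B C p = markov A' B' C' p"
  shows "n \<le> n'"
proof (rule ccontr)
  assume "\<not> n \<le> n'"
  define O2 where "O2 = \<alpha> * observability_mat K A' C'"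
  define R2 where "R2 = controllability_mat K A' B' * \<beta>"
  have c: "O2 \<in> carrier_mat n n'" "R2 \<in> carrier_mat n' n"
    using A' B' C' \<alpha> \<beta> by (auto simp: O2_def R2_def observability_mat_def controllability_mat_def)
  obtain v where v: "\<exists>k<n. v k \<noteq> 0" "\<And>l. l < n' \<Longrightarrow> (\<Sum>k<n. R2 $$ (l, k) * v k) = 0"
    using homogeneous_system_nontrivial_solution[of "{..<n'}" n "\<lambda>l k. R2 $$ (l, k)"] \<open>\<not> n \<le> n'\<close>
    by auto
  let ?v = "Matrix.vec n v"
  have "R2 *\<^sub>v ?v = 0\<^sub>v n'"
    using c(2) v(2) by (intro eq_vecI) (auto simp: scalar_prod_def atLeast0LessThan)
  then have "(O2 * R2) *\<^sub>v ?v = 0\<^sub>v n"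
    using assoc_mult_mat_vec[OF c, of ?v] c(1) by auto
  moreover have "?v \<noteq> 0\<^sub>v n" using v(1) by (metis index_vec index_zero_vec(1))
  moreover have OR: "O2 * R2 \<in> carrier_mat n n" using c by simp
  ultimately have "det (O2 * R2) = 0"
    using det_0_iff_vec_prod_zero_field[OF OR] by (metis vec_carrier)
  moreover have "\<alpha> * hankel_mat m K (markov A B C) * \<beta> = O2 * R2"
  proof -
    have "markov A B C = markov A' B' C'" using h by blast
    moreover have "observability_mat K A' C' * controllability_mat K A' B' =
      hankel_mat m K (markov A' B' C')"
      using observability_mult_controllability[OF A' B' C', of K 0] A' C'
      by (simp add: observability_mat_def)
    ultimately show ?thesis
      using A' B' C' \<alpha> \<beta> by (simp add: O2_def R2_def mat_assoc observability_mat_def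
          controllability_mat_def flip: \<open>observability_mat K A' C' * controllability_mat K A' B' = _\<close>)
  qed
  ultimately show False using probe by (simp add: hankel_probe_def)
qed

end

section \<open>Skew-symmetric determinants and transposed realizations\<close>

text \<open>
  Induction by blocks of size two. A simultaneous permutation of rows and columns makes the
  upper left block \<open>J\<close> invertible; its determinant is the square of its upper right
  entry \<open>c\<close>, and the Schur complement of \<open>J\<close> is again skew-symmetric.
  The diagonal is assumed to vanish to cover characteristic two.
\<close>

lemma det_skew_is_square:
  fixes M :: "'a :: field mat"
  assumes "M \<in> carrier_mat n n" and "M\<^sup>T = - M" and "\<And>i. i < n \<Longrightarrow> M $$ (i, i) = 0"
  shows "\<exists>r. det M = r\<^sup>2"
  using assms
proof (induction n arbitrary: M rule: less_induct)
  case (less n M)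
  note M = less.prems(1) and diag = less.prems(3)
  have skew: "M $$ (j, i) = - M $$ (i, j)" if "i < n" "j < n" for i j
    using arg_cong[OF less.prems(2), of "\<lambda>M. M $$ (i, j)"] that M by simp
  show ?case
  proof (cases "n = 0 \<or> (\<forall>j<n. M $$ (0, j) = 0)")
    case True
    show ?thesis
    proof (cases "n = 0")
      case True
      then show ?thesis using M by (intro exI[of _ 1]) (simp add: det_dim_zero)
    next
      case False
      with True have "det M = 0"
        using laplace_expansion_row[OF M, of 0] by simp
      then show ?thesis by (intro exI[of _ 0]) simp
    qed
  next
    case False
    then obtain j where n: "n > 0" and j: "j < n" "M $$ (0, j) \<noteq> 0" by auto
    have j0: "j \<noteq> 0" using j diag[OF n] by metis
    define k where "k = n - 2"
    have n2: "n = 2 + k" using j j0 by (simp add: k_def)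
    define M' where "M' = (if j = 1 then M else swapcols 1 j (swaprows 1 j M))"
    define \<tau> where "\<tau> i = (if i = 1 then j else if i = j then 1 else i)" for i :: nat
    have \<tau>: "\<tau> i < n" if "i < n" for i using that j n2 by (auto simp: \<tau>_def)
    have \<tau>0: "\<tau> 0 = 0" "\<tau> 1 = j" using j0 by (auto simp: \<tau>_def)
    have M': "M' \<in> carrier_mat n n" using M by (simp add: M'_def)
    have M'_entry: "M' $$ (a, b) = M $$ (\<tau> a, \<tau> b)" if "a < n" "b < n" for a b
      using that M j n2 by (auto simp: M'_def \<tau>_def)
    have det_M': "det M' = det M"
    proof (cases "j = 1")
      case False
      have "det (swapcols 1 j (swaprows 1 j M)) = - det (swaprows 1 j M)"
        by (rule det_swapcols) (use False j n2 M in auto)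
      also have "det (swaprows 1 j M) = - det M"
        by (rule det_swaprows) (use False j n2 M in auto)
      finally show ?thesis using False by (simp add: M'_def)
    qed (simp add: M'_def)
    have skew': "M' $$ (b, a) = - M' $$ (a, b)" if "a < n" "b < n" for a b
      using that skew[of "\<tau> a" "\<tau> b"] \<tau> by (simp add: M'_entry)
    have diag': "M' $$ (a, a) = 0" if "a < n" for a
      using that diag[of "\<tau> a"] \<tau> by (simp add: M'_entry)
    define c where "c = M' $$ (0, 1)"
    have c: "c \<noteq> 0" using M'_entry[of 0 1] j n2 \<tau>0 by (simp add: c_def)
    define J where "J = mat 2 2 (\<lambda>(a, b). M' $$ (a, b))"
    define E where "E = mat 2 k (\<lambda>(a, b). M' $$ (a, b + 2))"
    define D where "D = mat k k (\<lambda>(a, b). M' $$ (a + 2, b + 2))"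
    \<comment> \<open>minus the inverse of \<open>J\<close>, times \<open>E\<close>\<close>
    define W where "W = mat 2 k (\<lambda>(a, b). if a = 0 then M' $$ (1, b + 2) / c else - (M' $$ (0, b + 2) / c))"
    have cs: "J \<in> carrier_mat 2 2" "E \<in> carrier_mat 2 k" "D \<in> carrier_mat k k" "W \<in> carrier_mat 2 k"
      by (simp_all add: J_def E_def D_def W_def)
    have shift2: "Suc (Suc (x - 2)) = x" if "\<not> x < 2" for x :: nat using that by simp
    have block: "M' = four_block_mat J E (- E\<^sup>T) D"
    proof (rule eq_matI)
      fix a b assume "a < dim_row (four_block_mat J E (- E\<^sup>T) D)"
        "b < dim_col (four_block_mat J E (- E\<^sup>T) D)"
      then have ab: "a < 2 + k" "b < 2 + k" using cs by auto
      then show "M' $$ (a, b) = four_block_mat J E (- E\<^sup>T) D $$ (a, b)"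
        using cs skew'[of b a] n2 by (auto simp: J_def E_def D_def shift2)
    qed (use M' cs n2 in auto)
    have JW: "J * W = - E"
    proof (rule eq_matI)
      fix a b assume "a < dim_row (- E)" "b < dim_col (- E)"
      then have ab: "a < 2" "b < k" using cs by auto
      have "J $$ (0, 0) = 0" "J $$ (1, 1) = 0" "J $$ (0, 1) = c" "J $$ (1, 0) = - c"
        using diag' skew'[of 0 1] n2 by (simp_all add: J_def c_def)
      then show "(J * W) $$ (a, b) = (- E) $$ (a, b)"
        using ab c less_2_cases[OF ab(1)] unfolding index_mult_mat_sum[OF cs(1,4) ab]
        by (auto simp: numeral_2_eq_2 W_def E_def)
    qed (use cs in auto)
    define N where "N = D - E\<^sup>T * W"
    have N: "N \<in> carrier_mat k k" using cs by (auto simp: N_def)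
    have N_entry: "N $$ (a, b) = M' $$ (a + 2, b + 2) -
      (M' $$ (0, a + 2) * M' $$ (1, b + 2) - M' $$ (1, a + 2) * M' $$ (0, b + 2)) / c"
      if "a < k" "b < k" for a b
    proof -
      have "(E\<^sup>T * W) $$ (a, b) = (\<Sum>l<2. E\<^sup>T $$ (a, l) * W $$ (l, b))"
        using cs that by (intro index_mult_mat_sum) auto
      then show ?thesis using that cs c
        by (simp add: N_def numeral_2_eq_2 E_def W_def D_def field_simps)
    qed
    have "M' * four_block_mat (1\<^sub>m 2) W (0\<^sub>m k 2) (1\<^sub>m k) =
      four_block_mat (J * 1\<^sub>m 2 + E * 0\<^sub>m k 2) (J * W + E * 1\<^sub>m k)
        (- E\<^sup>T * 1\<^sub>m 2 + D * 0\<^sub>m k 2) (- E\<^sup>T * W + D * 1\<^sub>m k)"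
      unfolding block by (rule mult_four_block_mat) (use cs in auto)
    also have "\<dots> = four_block_mat J (0\<^sub>m 2 k) (- E\<^sup>T) N"
    proof (intro cong_four_block_mat)
      show "J * W + E * 1\<^sub>m k = 0\<^sub>m 2 k" using cs by (simp add: JW)
      show "- E\<^sup>T * W + D * 1\<^sub>m k = N"
        using cs by (intro eq_matI) (auto simp: N_def)
    qed (use cs in auto)
    finally have eq: "M' * four_block_mat (1\<^sub>m 2) W (0\<^sub>m k 2) (1\<^sub>m k) =
      four_block_mat J (0\<^sub>m 2 k) (- E\<^sup>T) N" .
    have T: "four_block_mat (1\<^sub>m 2) W (0\<^sub>m k 2) (1\<^sub>m k) \<in> carrier_mat n n"
      using cs n2 by auto
    have "det (four_block_mat (1\<^sub>m 2) W (0\<^sub>m k 2) (1\<^sub>m k)) = 1"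
      using det_four_block_mat_lower_left_zero[of "1\<^sub>m 2" 2 W k "0\<^sub>m k 2" "1\<^sub>m k"] cs by simp
    then have "det M' = det (four_block_mat J (0\<^sub>m 2 k) (- E\<^sup>T) N)"
      unfolding eq[symmetric] det_mult[OF M' T] by simp
    also have "\<dots> = det J * det N"
      by (rule det_four_block_mat_upper_right_zero) (use cs N in auto)
    also have "det J = c\<^sup>2"
    proof -
      have "det J = (\<Sum>b<2. J $$ (0, b) * cofactor J 0 b)"
        by (rule laplace_expansion_row[OF cs(1)]) simp
      also have "\<dots> = c * cofactor J 0 1"
        using diag'[of 0] n2 by (simp add: numeral_2_eq_2 J_def c_def)
      also have "cofactor J 0 1 = c"
      proof -
        have "mat_delete J 0 1 = mat 1 1 (\<lambda>_. - c)"
          using skew'[of 0 1] n2 by (intro eq_matI) (auto simp: mat_delete_def J_def c_def)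
        then show ?thesis by (simp add: cofactor_def det_single)
      qed
      finally show ?thesis by (simp add: power2_eq_square)
    qed
    finally have "det M = c\<^sup>2 * det N" using det_M' by simp
    moreover have "\<exists>r. det N = r\<^sup>2"
    proof (rule less.IH[OF _ N])
      show "N\<^sup>T = - N"
      proof (rule eq_matI)
        fix a b assume "a < dim_row (- N)" "b < dim_col (- N)"
        then have ab: "a < k" "b < k" using N by auto
        then show "N\<^sup>T $$ (a, b) = (- N) $$ (a, b)"
          using N n2 c skew'[of "a + 2" "b + 2"] by (simp add: N_entry field_simps)
      qed (use N in auto)
      show "N $$ (i, i) = 0" if "i < k" for i
        using that N_entry[of i i] n2 diag'[of "i + 2"] by simp
    qed (use n2 in simp)
    ultimately show ?thesis by (metis power_mult_distrib)
  qed
qed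

lemma pow_mat_smult:
  assumes A: "(A :: 'a :: comm_ring_1 mat) \<in> carrier_mat n n"
  shows "(c \<cdot>\<^sub>m A) ^\<^sub>m p = c ^ p \<cdot>\<^sub>m A ^\<^sub>m p"
proof (induction p)
  case (Suc p)
  have Ap: "A ^\<^sub>m p \<in> carrier_mat n n" by (rule pow_carrier_mat[OF A])
  have "(c \<cdot>\<^sub>m A) ^\<^sub>m Suc p = (c ^ p \<cdot>\<^sub>m A ^\<^sub>m p) * (c \<cdot>\<^sub>m A)" using Suc by simp
  also have "\<dots> = c ^ p \<cdot>\<^sub>m (A ^\<^sub>m p * (c \<cdot>\<^sub>m A))"
    by (rule mult_smult_assoc_mat[OF Ap smult_carrier_mat[OF A]])
  also have "A ^\<^sub>m p * (c \<cdot>\<^sub>m A) = c \<cdot>\<^sub>m (A ^\<^sub>m p * A)" by (rule mult_smult_distrib[OF Ap A])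
  finally show ?case using A by (intro eq_matI) (auto simp del: index_mult_mat(1))
qed (use A in auto)

lemma pow_mat_transpose:
  assumes A: "(A :: 'a :: comm_ring_1 mat) \<in> carrier_mat n n"
  shows "(A\<^sup>T) ^\<^sub>m p = (A ^\<^sub>m p)\<^sup>T"
proof (induction p)
  case (Suc p)
  have "(A ^\<^sub>m Suc p)\<^sup>T = (A * A ^\<^sub>m p)\<^sup>T" unfolding pow_mat_Suc_left[OF A] ..
  also have "\<dots> = (A ^\<^sub>m p)\<^sup>T * A\<^sup>T" by (rule transpose_mult[OF A pow_carrier_mat[OF A]])
  finally show ?case using Suc by simp
qed (use A in auto)

lemma markov_transpose:
  assumes A: "A \<in> carrier_mat n n" and B: "B \<in> carrier_mat n k" and C: "C \<in> carrier_mat m n"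
  shows "(markov A B C p)\<^sup>T = markov A\<^sup>T C\<^sup>T B\<^sup>T p"
proof -
  note Ap = pow_carrier_mat[OF A, of p]
  have "(markov A B C p)\<^sup>T = B\<^sup>T * ((A ^\<^sub>m p)\<^sup>T * C\<^sup>T)"
    unfolding markov_def transpose_mult[OF mult_carrier_mat[OF C Ap] B] transpose_mult[OF C Ap] ..
  then show ?thesis
    unfolding markov_def pow_mat_transpose[OF A] using A B C by (simp add: mat_assoc)
qed

lemma markov_smult:
  assumes A: "A \<in> carrier_mat n n" and B: "B \<in> carrier_mat n k" and C: "C \<in> carrier_mat m n"
  shows "markov (a \<cdot>\<^sub>m A) B (c \<cdot>\<^sub>m C) p = c * a ^ p \<cdot>\<^sub>m markov A B C p"
proof -
  note Ap = pow_carrier_mat[OF A, of p]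
  have "markov (a \<cdot>\<^sub>m A) B (c \<cdot>\<^sub>m C) p = c \<cdot>\<^sub>m (C * (a ^ p \<cdot>\<^sub>m A ^\<^sub>m p)) * B"
    unfolding markov_def pow_mat_smult[OF A]
    by (simp only: mult_smult_assoc_mat[OF C smult_carrier_mat[OF Ap]])
  also have "C * (a ^ p \<cdot>\<^sub>m A ^\<^sub>m p) = a ^ p \<cdot>\<^sub>m (C * A ^\<^sub>m p)" by (rule mult_smult_distrib[OF C Ap])
  also have "c \<cdot>\<^sub>m (a ^ p \<cdot>\<^sub>m (C * A ^\<^sub>m p)) = c * a ^ p \<cdot>\<^sub>m (C * A ^\<^sub>m p)"
    by (intro eq_matI) (auto simp: mult.assoc)
  also have "\<dots> * B = c * a ^ p \<cdot>\<^sub>m markov A B C p"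
    unfolding markov_def by (rule mult_smult_assoc_mat[OF mult_carrier_mat[OF C Ap] B])
  finally show ?thesis .
qed

section \<open>Symmetry of the closed-loop characteristic polynomial\<close>

text \<open>
  The output feedback inherits the symmetry because \<open>S\<close> turns \<open>B F C\<close>
  into \<open>C\<^sup>T F C\<close>, a skew-symmetric matrix.
\<close>

lemma closed_loop_intertwine:
  fixes A B C S F :: "complex mat"
  assumes A: "A \<in> carrier_mat n n" and B: "B \<in> carrier_mat n m" and C: "C \<in> carrier_mat m n"
    and F: "F \<in> carrier_mat m m" "F\<^sup>T = - F" and S: "S \<in> carrier_mat n n"
    and \<sigma>: "\<sigma> * \<sigma> = 1" and SA: "S * A = \<sigma> \<cdot>\<^sub>m A\<^sup>T * S" and SB: "S * B = C\<^sup>T"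
    and BS: "(- \<sigma>) \<cdot>\<^sub>m B\<^sup>T * S = C"
  shows "S * (A + B * F * C) = \<sigma> \<cdot>\<^sub>m (A + B * F * C)\<^sup>T * S"
proof -
  have BF: "B * F \<in> carrier_mat n m" and BFC: "B * F * C \<in> carrier_mat n n" using B F C by auto
  have SBFC: "S * (B * F * C) = C\<^sup>T * F * C"
  proof -
    have "S * (B * F * C) = S * B * F * C" using S B F C by (simp add: mat_assoc)
    then show ?thesis unfolding SB .
  qed
  have "(B * F * C)\<^sup>T = C\<^sup>T * (F\<^sup>T * B\<^sup>T)"
    unfolding transpose_mult[OF BF C] transpose_mult[OF B F(1)] ..
  also have "\<dots> = - (C\<^sup>T * F * B\<^sup>T)" unfolding F(2) using B C F(1) by (simp add: mat_assoc)
  finally have T: "(A + B * F * C)\<^sup>T = A\<^sup>T + - (C\<^sup>T * F * B\<^sup>T)"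
    unfolding transpose_add[OF A BFC] by simp
  have CFB: "C\<^sup>T * F * B\<^sup>T \<in> carrier_mat n n" using B C F by auto
  have "\<sigma> \<cdot>\<^sub>m (A + B * F * C)\<^sup>T = \<sigma> \<cdot>\<^sub>m A\<^sup>T + (- \<sigma>) \<cdot>\<^sub>m (C\<^sup>T * F * B\<^sup>T)"
    unfolding T using A B C CFB by (intro eq_matI) (auto simp: algebra_simps simp del: index_mult_mat(1))
  then have "\<sigma> \<cdot>\<^sub>m (A + B * F * C)\<^sup>T * S = \<sigma> \<cdot>\<^sub>m A\<^sup>T * S + (- \<sigma>) \<cdot>\<^sub>m (C\<^sup>T * F * B\<^sup>T) * S"
    using A CFB S by (simp only:) (rule add_mult_distrib_mat[of _ n n], auto)
  also have "(- \<sigma>) \<cdot>\<^sub>m (C\<^sup>T * F * B\<^sup>T) = C\<^sup>T * F * ((- \<sigma>) \<cdot>\<^sub>m B\<^sup>T)"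
    by (rule mult_smult_distrib[symmetric, of _ n m _ n]) (use B C F in auto)
  also have "\<dots> * S = C\<^sup>T * F * ((- \<sigma>) \<cdot>\<^sub>m B\<^sup>T * S)" using B C F S by (simp add: mat_assoc)
  also have "\<dots> = C\<^sup>T * F * C" unfolding BS ..
  finally show ?thesis
    unfolding mult_add_distrib_mat[OF S A BFC] SBFC SA by simp
qed

text \<open>
  By the symmetry of the Markov parameters,
  \<open>(\<sigma> A\<^sup>T, C\<^sup>T, - \<sigma> B\<^sup>T)\<close> is another realization;
  \<open>S\<close> is the isomorphism to it. Transposition of the intertwining relations shows
  that \<open>- \<sigma> S\<^sup>T\<close> is an isomorphism as well, so that it agrees with
  \<open>S\<close>.
\<close>

lemma closed_loop_symmetry:
  assumes A: "A \<in> carrier_mat n n" and B: "B \<in> carrier_mat n m" and C: "C \<in> carrier_mat m n"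
    and \<alpha>: "\<alpha> \<in> carrier_mat n (K * m)" and \<beta>: "\<beta> \<in> carrier_mat (K * m) n"
    and probe: "hankel_probe m K \<alpha> \<beta> (markov A B C) \<noteq> 0"
    and \<sigma>: "\<sigma> * \<sigma> = 1" and h: "\<And>p. (markov A B C p)\<^sup>T = (- \<sigma> * \<sigma> ^ p) \<cdot>\<^sub>m markov A B C p"
    and F: "F \<in> carrier_mat m m" "F\<^sup>T = - F"
  shows "\<exists>S\<in>carrier_mat n n. det S \<noteq> 0 \<and> S\<^sup>T = (- \<sigma>) \<cdot>\<^sub>m S \<and>
    S * (A + B * F * C) = \<sigma> \<cdot>\<^sub>m (A + B * F * C)\<^sup>T * S"
proof -
  let ?A = "\<sigma> \<cdot>\<^sub>m A\<^sup>T" and ?C = "(- \<sigma>) \<cdot>\<^sub>m B\<^sup>T"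
  have T: "A\<^sup>T \<in> carrier_mat n n" "C\<^sup>T \<in> carrier_mat n m" "B\<^sup>T \<in> carrier_mat m n" using A B C by auto
  have c: "?A \<in> carrier_mat n n" "?C \<in> carrier_mat m n" using A B by auto
  have sq: "\<sigma> ^ p * \<sigma> ^ p = 1" for p by (simp add: \<sigma> flip: power_mult_distrib)
  have "markov A B C p = markov ?A C\<^sup>T ?C p" for p
  proof -
    have "markov ?A C\<^sup>T ?C p = (- \<sigma> * \<sigma> ^ p) \<cdot>\<^sub>m ((- \<sigma> * \<sigma> ^ p) \<cdot>\<^sub>m markov A B C p)"
      unfolding markov_smult[OF T] markov_transpose[OF A B C, symmetric] h ..
    also have "\<dots> = (\<sigma> * \<sigma>) * (\<sigma> ^ p * \<sigma> ^ p) \<cdot>\<^sub>m markov A B C p"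
      by (intro eq_matI) (auto simp: mult_ac)
    also have "\<dots> = markov A B C p" by (intro eq_matI) (simp_all add: \<sigma> sq)
    finally show ?thesis ..
  qed
  then obtain S where S: "S \<in> carrier_mat n n" "det S \<noteq> 0" "S * A = ?A * S" "S * B = C\<^sup>T" "?C * S = C"
    using realizations_isomorphic[OF A B C \<alpha> \<beta> probe c(1) T(2) c(2)] by blast
  have ST: "S\<^sup>T \<in> carrier_mat n n" using S by simp
  have "(- \<sigma>) \<cdot>\<^sub>m S\<^sup>T = S"
  proof (rule intertwiner_unique[OF A B C \<alpha> \<beta> probe c(1) T(2) _ _ _ S(1,3,4)])
    have "A\<^sup>T * S\<^sup>T = (S * A)\<^sup>T" using transpose_mult[OF S(1) A] by simp
    also have "\<dots> = (\<sigma> \<cdot>\<^sub>m (A\<^sup>T * S))\<^sup>T" unfolding S(3) mult_smult_assoc_mat[OF T(1) S(1)] ..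
    also have "\<dots> = \<sigma> \<cdot>\<^sub>m (A\<^sup>T * S)\<^sup>T" by (intro eq_matI) auto
    also have "(A\<^sup>T * S)\<^sup>T = S\<^sup>T * A" using transpose_mult[OF T(1) S(1)] by simp
    finally have AS: "A\<^sup>T * S\<^sup>T = \<sigma> \<cdot>\<^sub>m (S\<^sup>T * A)" .
    have "?A * ((- \<sigma>) \<cdot>\<^sub>m S\<^sup>T) = \<sigma> \<cdot>\<^sub>m ((- \<sigma>) \<cdot>\<^sub>m (A\<^sup>T * S\<^sup>T))"
      unfolding mult_smult_assoc_mat[OF T(1) smult_carrier_mat[OF ST]] mult_smult_distrib[OF T(1) ST] ..
    also have "\<dots> = (- \<sigma>) * (\<sigma> * \<sigma>) \<cdot>\<^sub>m (S\<^sup>T * A)"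
      unfolding AS by (intro eq_matI) (auto simp: mult_ac simp del: index_mult_mat(1))
    also have "\<dots> = (- \<sigma>) \<cdot>\<^sub>m S\<^sup>T * A" unfolding mult_smult_assoc_mat[OF ST A] by (simp add: \<sigma>)
    finally show "(- \<sigma>) \<cdot>\<^sub>m S\<^sup>T * A = ?A * ((- \<sigma>) \<cdot>\<^sub>m S\<^sup>T)" ..
    have "(- \<sigma>) \<cdot>\<^sub>m S\<^sup>T * B = (- \<sigma>) \<cdot>\<^sub>m (B\<^sup>T * S)\<^sup>T"
      unfolding mult_smult_assoc_mat[OF ST B] transpose_mult[OF T(3) S(1)] by simp
    also have "\<dots> = ((- \<sigma>) \<cdot>\<^sub>m (B\<^sup>T * S))\<^sup>T" by (intro eq_matI) auto
    also have "(- \<sigma>) \<cdot>\<^sub>m (B\<^sup>T * S) = C" unfolding S(5)[symmetric] mult_smult_assoc_mat[OF T(3) S(1)] ..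
    finally show "(- \<sigma>) \<cdot>\<^sub>m S\<^sup>T * B = C\<^sup>T" .
  qed (use ST in simp)
  then have "(- \<sigma>) \<cdot>\<^sub>m S = (- \<sigma>) \<cdot>\<^sub>m ((- \<sigma>) \<cdot>\<^sub>m S\<^sup>T)" by simp
  also have "\<dots> = (\<sigma> * \<sigma>) \<cdot>\<^sub>m S\<^sup>T" by (intro eq_matI) auto
  also have "\<dots> = S\<^sup>T" by (intro eq_matI) (simp_all add: \<sigma>)
  finally have "S\<^sup>T = (- \<sigma>) \<cdot>\<^sub>m S" ..
  then show ?thesis
    using S closed_loop_intertwine[OF A B C F S(1) \<sigma> S(3,4,5)] by blast
qed

text \<open>
  The matrix \<open>S (s - X) = s S - S X\<close> is skew-symmetric, and its determinant is the
  characteristic polynomial up to a constant. It is a square in the field of rational functions,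
  hence in the factorial ring of polynomials.
\<close>

lemma char_poly_square_of_skew_pencil:
  fixes S X :: "complex mat"
  assumes S: "S \<in> carrier_mat n n" "det S \<noteq> 0" "S\<^sup>T = - S" and X: "X \<in> carrier_mat n n"
    and SX: "S * X = X\<^sup>T * S"
  shows "char_poly X \<in> square_polys n"
proof -
  let ?c = "\<lambda>a. [:a:] :: complex poly"
  interpret c: comm_ring_hom ?c by unfold_locales (auto simp: one_pCons)
  define P where "P = map_mat ?c S * char_poly_matrix X"
  have cS: "map_mat ?c S \<in> carrier_mat n n" and M: "char_poly_matrix X \<in> carrier_mat n n"
    using S X by auto
  have P: "P \<in> carrier_mat n n" using cS M by (simp add: P_def)
  have SXc: "S * X \<in> carrier_mat n n" using S X by simp
  have P_entry: "P $$ (i, j) = [:- (S * X) $$ (i, j), S $$ (i, j):]" if ij: "i < n" "j < n" for i j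
  proof -
    have "P $$ (i, j) = (\<Sum>l<n. [:S $$ (i, l):] * char_poly_matrix X $$ (l, j))"
      unfolding P_def index_mult_mat_sum[OF cS M ij] using S ij by (intro sum.cong) auto
    also have "\<dots> = (\<Sum>l<n. (if l = j then [:0, S $$ (i, l):] else 0) + [:- (S $$ (i, l) * X $$ (l, j)):])"
      using ij X by (intro sum.cong) (auto simp: char_poly_matrix_def)
    also have "\<dots> = [:0, S $$ (i, j):] + (\<Sum>l<n. [:- (S $$ (i, l) * X $$ (l, j)):])"
      unfolding sum.distrib using ij by simp
    also have "(\<Sum>l<n. [:- (S $$ (i, l) * X $$ (l, j)):]) = [:- (S * X) $$ (i, j):]"
      unfolding index_mult_mat_sum[OF S(1) X ij] by (simp add: c.hom_sum sum_negf[symmetric] del: minus_pCons)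
    finally show ?thesis by simp
  qed
  have S_skew: "S $$ (j, i) = - S $$ (i, j)" if "i < n" "j < n" for i j
    using arg_cong[OF S(3), of "\<lambda>M. M $$ (i, j)"] that S(1) by simp
  have SXT: "(S * X)\<^sup>T = - (S * X)"
    unfolding transpose_mult[OF S(1) X] S(3) using S(1) X SX by simp
  have SX_skew: "(S * X) $$ (j, i) = - (S * X) $$ (i, j)" if "i < n" "j < n" for i j
    using arg_cong[OF SXT, of "\<lambda>M. M $$ (i, j)"] that S(1) X
    by (simp del: index_mult_mat(1))
  have P_skew: "P $$ (j, i) = - P $$ (i, j)" if "i < n" "j < n" for i j
    using that S_skew[OF that] SX_skew[OF that] by (simp add: P_entry del: index_mult_mat(1))
  let ?P = "map_mat poly_to_rat P"
  have "\<exists>r. det ?P = r\<^sup>2"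
  proof (rule det_skew_is_square[of _ n])
    show "?P\<^sup>T = - ?P"
    proof (rule eq_matI)
      fix i j assume "i < dim_row (- ?P)" "j < dim_col (- ?P)"
      then have ij: "i < n" "j < n" using P by auto
      then show "?P\<^sup>T $$ (i, j) = (- ?P) $$ (i, j)" using P P_skew[OF ij] by simp
    qed (use P in auto)
    fix i assume i: "i < n"
    have "P $$ (i, i) = 0" using P_skew[OF i i] by simp
    then show "?P $$ (i, i) = 0" using i P by simp
  qed (use P in simp)
  then obtain r where r: "poly_to_rat (det P) = r\<^sup>2" by auto
  obtain a b where ab: "r = Fraction_Field.Fract a b" "b \<noteq> 0" by (rule Fract_cases)
  have "poly_to_rat (det P) = Fraction_Field.Fract (a\<^sup>2) (b\<^sup>2)"
    unfolding r ab by (simp add: power2_eq_square)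
  then have eq: "det P * b\<^sup>2 = a\<^sup>2" using eq_fract(1)[of 1 "b\<^sup>2" "det P" "a\<^sup>2"] ab(2) by simp
  then have "b ^ 2 dvd a ^ 2" by (metis dvd_triv_right)
  then have "b dvd a" by (simp add: pow_divides_pow_iff)
  then obtain w where "a = b * w" by blast
  with eq ab(2) have w: "det P = w\<^sup>2" by (simp add: power_mult_distrib)
  have "det P = [:det S:] * char_poly X"
    unfolding P_def det_mult[OF cS M] c.hom_det[symmetric] char_poly_def by simp
  with w have w2: "w\<^sup>2 = Polynomial.smult (det S) (char_poly X)" by simp
  \<comment> \<open>\<open>q\<close> is monic only up to sign\<close>
  define q where "q = Polynomial.smult (1 / csqrt (det S)) w"
  have q2: "q\<^sup>2 = char_poly X"
  proof -
    have "q\<^sup>2 = Polynomial.smult ((1 / csqrt (det S))\<^sup>2) (w\<^sup>2)" by (simp add: q_def smult_power)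
    also have "(1 / csqrt (det S))\<^sup>2 = 1 / det S" by (simp add: power_divide)
    finally show ?thesis using S(2) by (simp add: w2)
  qed
  have deg: "degree (char_poly X) = n" and mon: "monic (char_poly X)"
    using degree_monic_char_poly[OF X] by auto
  have "q \<noteq> 0" using q2 mon by auto
  then have degq: "degree q = n div 2" using deg q2 degree_power_eq[of q 2] by simp
  have "(lead_coeff q)\<^sup>2 = 1" using mon unfolding q2[symmetric] by (simp add: lead_coeff_power)
  then consider "monic q" | "monic (- q)" by (auto simp: power2_eq_1_iff)
  then show ?thesis
  proof cases
    case 1
    then show ?thesis unfolding square_polys_def
      using q2[symmetric] degq by (intro CollectI exI[of _ q]) auto
  next
    case 2
    then show ?thesis unfolding square_polys_def
      using q2[symmetric] degq by (intro CollectI exI[of _ "- q"]) (auto simp: power2_eq_square)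
  qed
qed

lemma char_poly_uminus_reflect:
  fixes X :: "complex mat"
  assumes X: "X \<in> carrier_mat n n"
  shows "poly_reflect (char_poly X) = (-1) ^ n * char_poly (- X)"
proof -
  have "map_mat poly_reflect (char_poly_matrix X) = (-1) \<cdot>\<^sub>m char_poly_matrix (- X)"
    by (rule eq_matI) (use X in \<open>auto simp: char_poly_matrix_def pcompose_pCons\<close>)
  then have "poly_reflect (char_poly X) = det ((-1) \<cdot>\<^sub>m char_poly_matrix (- X))"
    unfolding char_poly_def
    using comm_ring_hom.hom_det[OF pcompose_hom.comm_ring_hom_axioms, of "[:0, -1:]" "char_poly_matrix X"]
    by metis
  then show ?thesis
    using carrier_matD[OF char_poly_matrix_closed[of "- X" n]] X by (simp add: char_poly_def)
qed

lemma char_poly_reflection_of_intertwiner: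
  fixes S X :: "complex mat"
  assumes S: "S \<in> carrier_mat n n" "det S \<noteq> 0" and X: "X \<in> carrier_mat n n"
    and SX: "S * X = - X\<^sup>T * S"
  shows "char_poly X \<in> reflection_polys n"
proof -
  obtain N where N: "N \<in> carrier_mat n n" "S * N = 1\<^sub>m n" "N * S = 1\<^sub>m n"
    using inverse_mat_exists[OF S] by blast
  have XT: "- X\<^sup>T \<in> carrier_mat n n" using X by simp
  have "- X\<^sup>T = - X\<^sup>T * (S * N)" unfolding N(2) using XT by simp
  also have "\<dots> = S * X * N" unfolding SX using XT S N by (simp add: mat_assoc)
  finally have "similar_mat (- X\<^sup>T) X"
    by (intro similar_matI[of _ _ S N n]) (use X S N in auto)
  then have "char_poly (- X\<^sup>T) = char_poly X" by (rule char_poly_similar)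
  moreover have "char_poly (- X\<^sup>T) = char_poly (- X)"
    using char_poly_transpose_mat[of "- X" n] X by (simp add: transpose_uminus)
  ultimately have "poly_reflect (char_poly X) = (-1) ^ n * char_poly X"
    using char_poly_uminus_reflect[OF X] by simp
  then have "Polynomial.smult ((-1) ^ n) (poly_reflect (char_poly X)) = char_poly X"
    by (cases "even n") simp_all
  then show ?thesis using degree_monic_char_poly[OF X] by (simp add: reflection_polys_def)
qed

section \<open>A symmetric transfer function in general position\<close>

lemma sum_lessThan_mult:
  fixes f :: "nat \<Rightarrow> nat \<Rightarrow> 'a :: comm_monoid_add"
  shows "(\<Sum>r<K * m. f (r div m) (r mod m)) = (\<Sum>p<K. \<Sum>u<m. f p u)"
proof -
  have "(\<Sum>r<K * m. f (r div m) (r mod m)) =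
    (\<Sum>p<K. \<Sum>r\<in>{p * m..<p * m + m}. f (r div m) (r mod m))"
    by (rule sum.nat_group[symmetric])
  also have "\<dots> = (\<Sum>p<K. \<Sum>u<m. f p u)"
  proof (rule sum.cong[OF refl])
    fix p
    have "(\<Sum>r\<in>{p * m..<p * m + m}. f (r div m) (r mod m)) =
        (\<Sum>u<m. f ((p * m + u) div m) ((p * m + u) mod m))"
      by (rule sum.reindex_bij_witness[of _ "\<lambda>u. p * m + u" "\<lambda>r. r - p * m"]) auto
    then show "(\<Sum>r\<in>{p * m..<p * m + m}. f (r div m) (r mod m)) = (\<Sum>u<m. f p u)" by simp
  qed
  finally show ?thesis .
qed

lemma sum_matching_residues:
  fixes f g :: "nat \<Rightarrow> 'a :: comm_semiring_0"
  assumes "x < m"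
  shows "(\<Sum>r<K * m. (if r mod m = x then f (r div m) else 0) * (if r mod m = y then g (r div m) else 0)) =
    (if x = y then \<Sum>p<K. f p * g p else 0)"
proof -
  have "(\<Sum>r<K * m. (if r mod m = x then f (r div m) else 0) * (if r mod m = y then g (r div m) else 0)) =
    (\<Sum>p<K. \<Sum>u<m. (if u = x then f p else 0) * (if u = y then g p else 0))"
    by (rule sum_lessThan_mult)
  also have "\<dots> = (\<Sum>p<K. \<Sum>u<m. if u = x then if x = y then f p * g p else 0 else 0)"
    by (intro sum.cong) auto
  also have "\<dots> = (if x = y then \<Sum>p<K. f p * g p else 0)" using assms by simp
  finally show ?thesis .
qed

lemma lagrange_polynomial_exists:
  fixes x :: "'a :: field"
  assumes "finite D"
  shows "\<exists>p. poly p x = 1 \<and> (\<forall>y\<in>D. y \<noteq> x \<longrightarrow> poly p y = 0)"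
proof (intro exI conjI ballI impI)
  let ?p = "\<Prod>y\<in>D - {x}. Polynomial.smult (1 / (x - y)) [:- y, 1:]"
  have "poly ?p x = (\<Prod>y\<in>D - {x}. 1)"
    unfolding poly_prod by (rule prod.cong) (auto simp: field_simps)
  then show "poly ?p x = 1" by simp
  show "poly ?p y = 0" if "y \<in> D" "y \<noteq> x" for y
    unfolding poly_prod by (rule prod_zero) (use assms that in auto)
qed

text \<open>
  A linear relation between the rows is a nonzero polynomial of degree less than
  \<open>N\<close> with the \<open>N\<close> roots \<open>x l\<close>.
\<close>

lemma det_vandermonde_nonzero:
  fixes e x :: "nat \<Rightarrow> complex"
  assumes e: "\<And>l. l < N \<Longrightarrow> e l \<noteq> 0" and x: "inj_on x {..<N}"
  shows "det (mat N N (\<lambda>(k, l). e l * x l ^ k)) \<noteq> 0"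
proof
  let ?M = "mat N N (\<lambda>(k, l). e l * x l ^ k)"
  assume "det ?M = 0"
  then have "det ?M\<^sup>T = 0" using det_transpose[of ?M N] by simp
  then obtain v where v: "v \<in> carrier_vec N" "v \<noteq> 0\<^sub>v N" "?M\<^sup>T *\<^sub>v v = 0\<^sub>v N"
    using det_0_iff_vec_prod_zero_field[of "?M\<^sup>T" N] by auto
  define q where "q = (\<Sum>k<N. monom (vec_index v k) k)"
  have q: "coeff q k = (if k < N then vec_index v k else 0)" for k
    by (simp add: q_def coeff_sum)
  have "poly q (x l) = 0" if l: "l < N" for l
  proof -
    have "0 = vec_index (?M\<^sup>T *\<^sub>v v) l" using v(3) l by simp
    also have "\<dots> = e l * poly q (x l)"
      using l v(1) by (simp add: scalar_prod_def atLeast0LessThan q_def poly_sum poly_monom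
          sum_distrib_left mult_ac)
    finally show ?thesis using e[OF l] by simp
  qed
  then have sub: "x ` {..<N} \<subseteq> {z. poly q z = 0}" by auto
  have "q = 0"
  proof (rule ccontr)
    assume nz: "q \<noteq> 0"
    have "N = card (x ` {..<N})" using x by (simp add: card_image)
    also have "\<dots> \<le> card {z. poly q z = 0}" using sub poly_roots_finite[OF nz] by (rule card_mono[rotated])
    also have "\<dots> \<le> degree q" by (rule card_poly_roots_bound[OF nz])
    finally have "coeff q (degree q) = 0" by (simp add: q)
    with nz show False by simp
  qed
  then have "vec_index v k = 0" if "k < N" for k using q[of k] that by simp
  then have "v = 0\<^sub>v N" using v(1) by (intro eq_vecI) auto
  with v(2) show False by simp
qed

text \<open>
  The realization of the sum over \<open>i\<close> of \<open>\<gamma> i / (s - d i)\<close>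
  times the elementary matrix with entry one at position \<open>(c i, b i)\<close>.
\<close>

locale diagonal_realization =
  fixes n m :: nat and d \<gamma> :: "nat \<Rightarrow> complex" and c b :: "nat \<Rightarrow> nat"
  assumes \<gamma>: "\<And>i. i < n \<Longrightarrow> \<gamma> i \<noteq> 0"
    and c: "\<And>i. i < n \<Longrightarrow> c i < m" and b: "\<And>i. i < n \<Longrightarrow> b i < m"
begin

definition "A = mat n n (\<lambda>(i, j). if i = j then d i else 0)"
definition "B = mat n m (\<lambda>(i, v). if v = b i then 1 else 0)"
definition "C = mat m n (\<lambda>(u, i). if u = c i then \<gamma> i else 0)"

lemma carriers [simp]: "A \<in> carrier_mat n n" "B \<in> carrier_mat n m" "C \<in> carrier_mat m n"
  by (simp_all add: A_def B_def C_def)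

lemma A_pow: "A ^\<^sub>m p = mat n n (\<lambda>(i, j). if i = j then d i ^ p else 0)"
proof (induction p)
  case (Suc p)
  have P: "A ^\<^sub>m p \<in> carrier_mat n n" by (rule pow_carrier_mat) simp
  have "(A ^\<^sub>m p * A) $$ (i, j) = (if i = j then d i ^ Suc p else 0)" if "i < n" "j < n" for i j
  proof -
    have "(A ^\<^sub>m p * A) $$ (i, j) = (\<Sum>l<n. if l = i then d i ^ p * A $$ (i, j) else 0)"
      unfolding index_mult_mat_sum[OF P carriers(1) that] using that by (intro sum.cong) (auto simp: Suc)
    then show ?thesis using that by (simp add: A_def)
  qed
  then show ?case by (intro eq_matI) (auto simp: A_def simp del: index_mult_mat(1))
qed (auto simp: A_def)

lemma CA_entry:
  assumes "u < m" "i < n"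
  shows "(C * A ^\<^sub>m p) $$ (u, i) = (if u = c i then \<gamma> i * d i ^ p else 0)"
proof -
  have P: "A ^\<^sub>m p \<in> carrier_mat n n" by (rule pow_carrier_mat) simp
  have "(C * A ^\<^sub>m p) $$ (u, i) = (\<Sum>l<n. if l = i then C $$ (u, i) * d i ^ p else 0)"
    unfolding index_mult_mat_sum[OF carriers(3) P assms]
    using assms by (intro sum.cong) (auto simp: A_pow)
  then show ?thesis using assms by (simp add: C_def)
qed

lemma AB_entry:
  assumes "i < n" "v < m"
  shows "(A ^\<^sub>m p * B) $$ (i, v) = (if v = b i then d i ^ p else 0)"
proof -
  have P: "A ^\<^sub>m p \<in> carrier_mat n n" by (rule pow_carrier_mat) simp
  have "(A ^\<^sub>m p * B) $$ (i, v) = (\<Sum>l<n. if l = i then d i ^ p * B $$ (i, v) else 0)"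
    unfolding index_mult_mat_sum[OF P carriers(2) assms]
    using assms by (intro sum.cong) (auto simp: A_pow)
  then show ?thesis using assms by (simp add: B_def)
qed

lemma markov_entry:
  assumes "u < m" "v < m"
  shows "markov A B C p $$ (u, v) = (\<Sum>i<n. if c i = u \<and> b i = v then \<gamma> i * d i ^ p else 0)"
proof -
  have CA: "C * A ^\<^sub>m p \<in> carrier_mat m n"
    by (rule mult_carrier_mat[OF carriers(3) pow_carrier_mat[OF carriers(1)]])
  show ?thesis
    unfolding markov_def index_mult_mat_sum[OF CA carriers(2) assms]
    using assms by (intro sum.cong) (auto simp: CA_entry B_def)
qed

text \<open>
  Interpolation polynomials \<open>L i\<close> at the eigenvalues turn the powers of
  \<open>A\<close> into projections onto eigenspaces. Within an eigenspace, the states are told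
  apart by the outputs \<open>c i\<close> and by the inputs \<open>b i\<close>. The coefficients
  of the \<open>L i\<close> give \<open>\<alpha>\<close> and \<open>\<beta>\<close> that make
  the probed observability and controllability matrices equal to the identity.
\<close>

lemma probe_exists:
  assumes dc: "inj_on (\<lambda>i. (d i, c i)) {..<n}" and db: "inj_on (\<lambda>i. (d i, b i)) {..<n}"
  shows "\<exists>K \<alpha> \<beta>. \<alpha> \<in> carrier_mat n (K * m) \<and> \<beta> \<in> carrier_mat (K * m) n \<and>
    hankel_probe m K \<alpha> \<beta> (markov A B C) \<noteq> 0"
proof -
  have "\<exists>p. poly p (d i) = 1 \<and> (\<forall>y\<in>d ` {..<n}. y \<noteq> d i \<longrightarrow> poly p y = 0)" for i
    by (rule lagrange_polynomial_exists) simp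
  then obtain L where L: "\<And>i. poly (L i) (d i) = 1"
    "\<And>i j. j < n \<Longrightarrow> d j \<noteq> d i \<Longrightarrow> poly (L i) (d j) = 0" by (metis imageI lessThan_iff)
  \<comment> \<open>exceeds the degree of every \<open>L i\<close>\<close>
  define K where "K = Suc (\<Sum>i<n. degree (L i))"
  have K: "degree (L i) < K" if "i < n" for i
    using member_le_sum[of i "{..<n}" "\<lambda>i. degree (L i)"] that by (simp add: K_def)
  have polyL: "(\<Sum>p<K. coeff (L i) p * y ^ p) = poly (L i) y" if "i < n" for i y
    unfolding poly_altdef
    by (rule sum.mono_neutral_right) (use K[OF that] in \<open>auto simp: coeff_eq_0\<close>)
  define \<alpha> where "\<alpha> = mat n (K * m) (\<lambda>(j, r).
    if r mod m = c j then coeff (L j) (r div m) / \<gamma> j else 0)"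
  define \<beta> where "\<beta> = mat (K * m) n (\<lambda>(s, j). if s mod m = b j then coeff (L j) (s div m) else 0)"
  have ab: "\<alpha> \<in> carrier_mat n (K * m)" "\<beta> \<in> carrier_mat (K * m) n" by (simp_all add: \<alpha>_def \<beta>_def)
  have O: "observability_mat K A C \<in> carrier_mat (K * m) n"
    and R: "controllability_mat K A B \<in> carrier_mat n (K * m)"
    by (auto simp: observability_mat_def controllability_mat_def A_def B_def C_def)
  have "\<alpha> * observability_mat K A C = 1\<^sub>m n"
  proof (rule eq_matI)
    fix j i assume "j < dim_row (1\<^sub>m n)" "i < dim_col (1\<^sub>m n)"
    then have ji: "j < n" "i < n" by auto
    have "(\<alpha> * observability_mat K A C) $$ (j, i) =
      (\<Sum>r<K * m. (if r mod m = c j then coeff (L j) (r div m) / \<gamma> j else 0) *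
        (if r mod m = c i then \<gamma> i * d i ^ (r div m) else 0))"
      unfolding index_mult_mat_sum[OF ab(1) O ji]
      by (intro sum.cong) (use ji mod_less_factor in \<open>auto simp: \<alpha>_def observability_mat_def CA_entry
        carrier_matD[OF carriers(1)] carrier_matD[OF carriers(3)] simp del: index_mult_mat(1)\<close>)
    also have "\<dots> = (if c j = c i then \<Sum>p<K. coeff (L j) p / \<gamma> j * (\<gamma> i * d i ^ p) else 0)"
      by (rule sum_matching_residues[OF c[OF ji(1)]])
    also have "\<dots> = (if c i = c j then \<gamma> i / \<gamma> j * poly (L j) (d i) else 0)"
      unfolding polyL[OF ji(1), symmetric] sum_distrib_left by (auto intro!: sum.cong)
    also have "\<dots> = (if j = i then 1 else 0)"
    proof (cases "d i = d j")
      case True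
      have "c i = c j \<longleftrightarrow> j = i" using inj_onD[OF dc, of i j] True ji by auto
      then show ?thesis using L(1)[of i] \<gamma>[OF ji(2)] by simp
    next
      case False
      with L(2)[OF ji(2) False] show ?thesis by (cases "j = i") simp_all
    qed
    finally show "(\<alpha> * observability_mat K A C) $$ (j, i) = 1\<^sub>m n $$ (j, i)" using ji by simp
  qed (use ab O in auto)
  moreover have "controllability_mat K A B * \<beta> = 1\<^sub>m n"
  proof (rule eq_matI)
    fix i j assume "i < dim_row (1\<^sub>m n)" "j < dim_col (1\<^sub>m n)"
    then have ij: "i < n" "j < n" by auto
    have "(controllability_mat K A B * \<beta>) $$ (i, j) =
      (\<Sum>r<K * m. (if r mod m = b i then d i ^ (r div m) else 0) *
        (if r mod m = b j then coeff (L j) (r div m) else 0))"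
      unfolding index_mult_mat_sum[OF R ab(2) ij]
      by (intro sum.cong) (use ij mod_less_factor in \<open>auto simp: \<beta>_def controllability_mat_def AB_entry
        carrier_matD[OF carriers(1)] carrier_matD[OF carriers(2)] simp del: index_mult_mat(1)\<close>)
    also have "\<dots> = (if b i = b j then \<Sum>p<K. d i ^ p * coeff (L j) p else 0)"
      by (rule sum_matching_residues[OF b[OF ij(1)]])
    also have "\<dots> = (if b i = b j then poly (L j) (d i) else 0)"
      using polyL[OF ij(2), of "d i"] by (simp add: mult.commute)
    also have "\<dots> = (if i = j then 1 else 0)"
    proof (cases "d i = d j")
      case True
      have "b i = b j \<longleftrightarrow> i = j" using inj_onD[OF db, of i j] True ij by auto
      then show ?thesis using L(1)[of j] by simp
    next
      case False
      with L(2)[OF ij(1) False] show ?thesis by (cases "i = j") simp_all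
    qed
    finally show "(controllability_mat K A B * \<beta>) $$ (i, j) = 1\<^sub>m n $$ (i, j)" using ij by simp
  qed (use ab R in auto)
  moreover have "\<alpha> * hankel_mat m K (markov A B C) * \<beta> =
    (\<alpha> * observability_mat K A C) * (controllability_mat K A B * \<beta>)"
  proof -
    have "hankel_mat m K (markov A B C) = observability_mat K A C * controllability_mat K A B"
      using observability_mult_controllability[OF carriers, of K 0] O
      by (simp add: carrier_matD[OF carriers(1)])
    then show ?thesis using ab O R by (simp add: mat_assoc)
  qed
  ultimately have "hankel_probe m K \<alpha> \<beta> (markov A B C) = 1" by (simp add: hankel_probe_def)
  then show ?thesis using ab by (metis zero_neq_one)
qed

end

lemma card_increasing_pairs: "card {(a, b :: nat). a < b \<and> b < m} = m choose 2"
proof (induction m)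
  case (Suc m)
  have "{(a, b :: nat). a < b \<and> b < Suc m} = {(a, b). a < b \<and> b < m} \<union> (\<lambda>a. (a, m)) ` {..<m}"
    by auto
  moreover have "finite {(a, b :: nat). a < b \<and> b < m}"
    by (rule finite_subset[of _ "{..<m} \<times> {..<m}"]) auto
  moreover have "card ((\<lambda>a. (a, m)) ` {..<m}) = m" by (simp add: card_image inj_on_def)
  ultimately have "card {(a, b :: nat). a < b \<and> b < Suc m} = (m choose 2) + m"
    using Suc by (subst (asm) eq_commute) (auto intro!: trans[OF card_Un_disjoint])
  then show ?case by (simp add: numeral_2_eq_2)
qed simp

text \<open>
  For the Markov parameters \<open>h\<close>, the Jacobian determinant, up to a triangular
  factor, of the closed-loop polynomial at zero feedback in the \<open>N\<close> directions
  \<open>F l\<close>; here \<open>idx\<close> enumerates the degrees in which the Markov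
  parameters are skew-symmetric.
\<close>

definition direction_probe ::
  "nat \<Rightarrow> (nat \<Rightarrow> nat) \<Rightarrow> (nat \<Rightarrow> complex mat) \<Rightarrow> (nat \<Rightarrow> complex mat) \<Rightarrow> complex" where
  "direction_probe N idx F h = det (mat N N (\<lambda>(k, l). mat_trace (F l * h (idx k))))"

text \<open>
  To each of \<open>N\<close> distinct pairs \<open>a l < b l\<close> of channels belong two
  states, with eigenvalues \<open>l + 1\<close> and \<open>\<sigma> (l + 1)\<close>, that
  contribute \<open>W / (s - (l + 1))\<close> and
  \<open>- \<sigma> W\<^sup>T / (s - \<sigma> (l + 1))\<close> to the transfer function, where
  \<open>W\<close> is the elementary matrix at \<open>(a l, b l)\<close>. Exchanging the two
  states is the symmetry. For odd \<open>n\<close> one more state adds an elementary diagonal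
  matrix divided by \<open>s\<close>, which is compatible with \<open>\<sigma> = -1\<close>. The
  Markov parameters in the degrees \<open>idx k\<close> are combinations of the skew-symmetric
  parts \<open>W - W\<^sup>T\<close> with the powers of \<open>l + 1\<close> as coefficients,
  which gives a Vandermonde determinant.
\<close>

lemma symmetric_realization_exists:
  fixes \<sigma> :: complex
  assumes m: "m > 0" and N: "N \<le> m choose 2" and \<sigma>: "\<sigma> = 1 \<or> \<sigma> = -1"
    and n: "n = 2 * N \<or> n = 2 * N + 1 \<and> \<sigma> = -1"
    and idx: "\<And>k. idx k = s + t * k" "\<And>k. \<sigma> ^ Suc (idx k) = 1" and t: "t > 0"
  shows "\<exists>A B C K \<alpha> \<beta> F. A \<in> carrier_mat n n \<and> B \<in> carrier_mat n m \<and> C \<in> carrier_mat m n \<and>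
    (\<forall>p. (markov A B C p)\<^sup>T = (- \<sigma> * \<sigma> ^ p) \<cdot>\<^sub>m markov A B C p) \<and>
    \<alpha> \<in> carrier_mat n (K * m) \<and> \<beta> \<in> carrier_mat (K * m) n \<and>
    hankel_probe m K \<alpha> \<beta> (markov A B C) \<noteq> 0 \<and>
    (\<forall>l<N. F l \<in> skew_symmetric_mats m) \<and> direction_probe N idx F (markov A B C) \<noteq> 0"
proof -
  have fin: "finite {(a, b :: nat). a < b \<and> b < m}"
    by (rule finite_subset[of _ "{..<m} \<times> {..<m}"]) auto
  obtain e where e: "inj_on e {..<N}" "e ` {..<N} \<subseteq> {(a, b). a < b \<and> b < m}"
    using card_le_inj[of "{..<N}" "{(a, b :: nat). a < b \<and> b < m}"] fin N
    by (auto simp: card_increasing_pairs)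
  define a where "a l = fst (e l)" for l
  define b where "b l = snd (e l)" for l
  have ab: "a l < b l" "a l < m" "b l < m" if "l < N" for l
    using e(2) that by (force simp: a_def b_def)+
  have ab_inj: "l = l'" if "l < N" "l' < N" "a l = a l'" "b l = b l'" for l l'
    using inj_onD[OF e(1), of l l'] that by (simp add: a_def b_def prod_eq_iff)
  define d where "d i = (if i = 2 * N then 0 else if even i then of_nat (Suc (i div 2))
    else \<sigma> * of_nat (Suc (i div 2)))" for i
  define \<gamma> where "\<gamma> i = (if even i then 1 else - \<sigma>)" for i :: nat
  define c where "c i = (if i = 2 * N then 0 else if even i then a (i div 2) else b (i div 2))" for i
  define r where "r i = (if i = 2 * N then 0 else if even i then b (i div 2) else a (i div 2))" for i
  have half: "i div 2 < N" if "i < n" "i \<noteq> 2 * N" for i using n that by auto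
  interpret diagonal_realization n m d \<gamma> c r
  proof
    fix i assume "i < n"
    then show "\<gamma> i \<noteq> 0" "c i < m" "r i < m"
      using \<sigma> m half[of i] ab[of "i div 2"] by (auto simp: \<gamma>_def c_def r_def)
  qed
  have norm_d: "norm (d i) = (if i = 2 * N then 0 else real (Suc (i div 2)))" for i
    using \<sigma> by (auto simp: d_def norm_mult simp del: of_nat_Suc)
  have inj: "i = j" if "i < n" "j < n" "d i = d j" "c i = c j \<or> r i = r j" for i j
  proof (cases "i = 2 * N \<or> j = 2 * N")
    case True
    then show ?thesis using norm_d[of i] norm_d[of j] that(3) by (auto split: if_splits)
  next
    case False
    then have l: "i div 2 = j div 2" using norm_d[of i] norm_d[of j] that(3) by simp
    have "even i \<longleftrightarrow> even j"
      using that(4) False l half[of i] ab(1)[of "i div 2"] that(1) by (auto simp: c_def r_def split: if_splits)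
    with l show ?thesis by (metis dvd_mult_div_cancel odd_two_times_div_two_succ)
  qed
  have "inj_on (\<lambda>i. (d i, c i)) {..<n}" "inj_on (\<lambda>i. (d i, r i)) {..<n}"
    using inj by (auto simp: inj_on_def)
  then obtain K \<alpha> \<beta> where probe: "\<alpha> \<in> carrier_mat n (K * m)" "\<beta> \<in> carrier_mat (K * m) n"
    "hankel_probe m K \<alpha> \<beta> (markov A B C) \<noteq> 0"
    using probe_exists by blast
  \<comment> \<open>the exchange of the two states of each pair\<close>
  define \<tau> where "\<tau> i = (if i = 2 * N then i else if even i then i + 1 else i - 1)" for i
  have \<tau>: "\<tau> i < n" "\<tau> (\<tau> i) = i" "c (\<tau> i) = r i" "r (\<tau> i) = c i"
    "\<gamma> (\<tau> i) * d (\<tau> i) ^ p = - \<sigma> * \<sigma> ^ p * (\<gamma> i * d i ^ p)" if i: "i < n" for i p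
  proof -
    consider "i = 2 * N" "\<sigma> = -1" | "i \<noteq> 2 * N" "even i" | "i \<noteq> 2 * N" "odd i" using i n by auto
    then have "\<tau> i < n \<and> \<tau> (\<tau> i) = i \<and> c (\<tau> i) = r i \<and> r (\<tau> i) = c i \<and>
      \<gamma> (\<tau> i) * d (\<tau> i) ^ p = - \<sigma> * \<sigma> ^ p * (\<gamma> i * d i ^ p)"
    proof cases
      case 1
      then show ?thesis using i by (cases p) (auto simp: \<tau>_def c_def r_def \<gamma>_def d_def)
    next
      case 2
      then obtain l where l: "i = 2 * l" by blast
      with 2 i n have "l < N" by auto
      then show ?thesis using n 2 unfolding l
        by (auto simp: \<tau>_def c_def r_def \<gamma>_def d_def power_mult_distrib)
    next
      case 3
      then obtain l where l: "i = 2 * l + 1" using oddE by blast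
      with 3 i n have lN: "l < N" by auto
      have "\<sigma> * \<sigma> = 1" using \<sigma> by auto
      then have "\<sigma> * \<sigma> ^ p * (\<sigma> * \<sigma> ^ p) = 1" by (simp flip: power_mult_distrib add: mult_ac)
      then show ?thesis using n 3 lN unfolding l
        by (auto simp: \<tau>_def c_def r_def \<gamma>_def d_def power_mult_distrib mult_ac)
    qed
    then show "\<tau> i < n" "\<tau> (\<tau> i) = i" "c (\<tau> i) = r i" "r (\<tau> i) = c i"
      "\<gamma> (\<tau> i) * d (\<tau> i) ^ p = - \<sigma> * \<sigma> ^ p * (\<gamma> i * d i ^ p)" by auto
  qed
  have h: "markov A B C p \<in> carrier_mat m m" for p by (rule markov_carrier[OF carriers])
  have \<sigma>2: "\<sigma> * (\<sigma> ^ p * (\<sigma> * \<sigma> ^ p)) = 1" for p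
    using \<sigma> by (auto simp flip: power_mult_distrib)
  have sym: "(markov A B C p)\<^sup>T = (- \<sigma> * \<sigma> ^ p) \<cdot>\<^sub>m markov A B C p" for p
  proof (rule eq_matI)
    fix u v assume "u < dim_row ((- \<sigma> * \<sigma> ^ p) \<cdot>\<^sub>m markov A B C p)"
      "v < dim_col ((- \<sigma> * \<sigma> ^ p) \<cdot>\<^sub>m markov A B C p)"
    then have uv: "u < m" "v < m" using h[of p] by auto
    have "markov A B C p $$ (v, u) = (\<Sum>i<n. if c i = v \<and> r i = u then \<gamma> i * d i ^ p else 0)"
      by (rule markov_entry[OF uv(2,1)])
    also have "\<dots> = (\<Sum>i<n. if c i = u \<and> r i = v then - \<sigma> * \<sigma> ^ p * (\<gamma> i * d i ^ p) else 0)"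
      by (rule sum.reindex_bij_witness[of _ \<tau> \<tau>]) (use \<tau> \<sigma>2 in auto)
    also have "\<dots> = - \<sigma> * \<sigma> ^ p * markov A B C p $$ (u, v)"
      unfolding markov_entry[OF uv] sum_distrib_left by (intro sum.cong) auto
    finally show "(markov A B C p)\<^sup>T $$ (u, v) = ((- \<sigma> * \<sigma> ^ p) \<cdot>\<^sub>m markov A B C p) $$ (u, v)"
      using uv h[of p] by simp
  qed (use h[of p] in auto)
  define F where "F l = mat m m (\<lambda>(u, v). if u = a l \<and> v = b l then 1
    else if u = b l \<and> v = a l then - 1 else (0 :: complex))" for l
  have F: "F l \<in> carrier_mat m m" for l by (simp add: F_def)
  have F_skew: "F l \<in> skew_symmetric_mats m" if "l < N" for l
    using ab(1)[OF that] by (auto simp: skew_symmetric_mats_def F_def intro!: eq_matI)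
  have trace: "mat_trace (F l * markov A B C p) = - 2 * of_nat (Suc l) ^ p"
    if l: "l < N" and p: "\<sigma> ^ Suc p = 1" for l p
  proof -
    have 1: "c i = a l \<and> r i = b l \<longleftrightarrow> i = 2 * l" if "i < n" for i
    proof (cases "i = 2 * N")
      case True
      then show ?thesis using ab(1)[OF l] l by (auto simp: c_def r_def)
    next
      case False
      let ?k = "i div 2"
      have k: "?k < N" using half that False by simp
      show ?thesis
      proof (cases "even i")
        case True
        then have "c i = a l \<and> r i = b l \<longleftrightarrow> ?k = l"
          using False ab_inj[OF k l] by (auto simp: c_def r_def)
        with True show ?thesis by auto
      next
        case odd: False
        then have "\<not> (c i = a l \<and> r i = b l)"
          using False ab(1)[OF l] ab(1)[OF k] by (auto simp: c_def r_def)
        with odd show ?thesis by auto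
      qed
    qed
    have "markov A B C p $$ (a l, b l) = (\<Sum>i<n. if i = 2 * l then \<gamma> i * d i ^ p else 0)"
      unfolding markov_entry[OF ab(2,3)[OF l]] by (intro sum.cong) (use 1 in auto)
    also have "\<dots> = of_nat (Suc l) ^ p"
      using l n by (auto simp: \<gamma>_def d_def)
    finally have hab: "markov A B C p $$ (a l, b l) = of_nat (Suc l) ^ p" .
    have "markov A B C p $$ (b l, a l) = (markov A B C p)\<^sup>T $$ (a l, b l)"
      using h[of p] ab[OF l] by simp
    also have "\<dots> = - (\<sigma> * \<sigma> ^ p) * of_nat (Suc l) ^ p"
      unfolding sym using h[of p] ab[OF l] hab by simp
    also have "\<dots> = - (of_nat (Suc l) ^ p)" using p by simp
    finally have hba: "markov A B C p $$ (b l, a l) = - (of_nat (Suc l) ^ p)" .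
    have "mat_trace (F l * markov A B C p) = (\<Sum>u<m. \<Sum>v<m. F l $$ (u, v) * markov A B C p $$ (v, u))"
      by (rule mat_trace_mult[OF F h])
    also have "\<dots> = (\<Sum>u<m. \<Sum>v<m. (if v = b l then if u = a l then markov A B C p $$ (b l, a l) else 0 else 0) -
        (if v = a l then if u = b l then markov A B C p $$ (a l, b l) else 0 else 0))"
      by (intro sum.cong) (use ab(1)[OF l] in \<open>auto simp: F_def\<close>)
    also have "\<dots> = markov A B C p $$ (b l, a l) - markov A B C p $$ (a l, b l)"
      using ab[OF l] by (simp add: sum_subtractf)
    finally show ?thesis by (simp add: hab hba)
  qed
  have "direction_probe N idx F (markov A B C) \<noteq> 0"
  proof -
    let ?x = "\<lambda>l. of_nat (Suc l) ^ t :: complex"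
    have "mat N N (\<lambda>(k, l). mat_trace (F l * markov A B C (idx k))) =
      mat N N (\<lambda>(k, l). (- 2 * of_nat (Suc l) ^ s) * ?x l ^ k)"
    proof (rule cong_mat[OF refl refl], clarify)
      fix k l assume "l < N"
      then show "mat_trace (F l * markov A B C (idx k)) = (- 2 * of_nat (Suc l) ^ s) * ?x l ^ k"
        using trace[OF _ idx(2), of l k] by (simp add: idx(1) power_add power_mult del: of_nat_Suc)
    qed
    moreover have "inj_on ?x {..<N}"
    proof (rule inj_onI)
      fix l l' assume "?x l = ?x l'"
      then have "Suc l ^ t = Suc l' ^ t" by (metis of_nat_eq_iff of_nat_power)
      then show "l = l'" using t using power_eq_iff_eq_base[OF t, of "Suc l" "Suc l'"] by simp
    qed
    ultimately show ?thesis
      unfolding direction_probe_def using det_vandermonde_nonzero[of N "\<lambda>l. - 2 * of_nat (Suc l) ^ s" ?x]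
      by (simp del: of_nat_Suc)
  qed
  with probe sym F_skew carriers show ?thesis by blast
qed

section \<open>Open conditions on transfer functions\<close>

definition triples :: "nat \<Rightarrow> nat \<Rightarrow> (complex mat \<times> complex mat \<times> complex mat) set" where
  "triples m n = carrier_mat n n \<times> carrier_mat n m \<times> carrier_mat m n"

text \<open>
  The entries of a product of matrices are polynomial functions of the entries of the factors
  only as long as the dimensions fit, hence the restriction to \<open>V\<close>.
\<close>

definition polynomial_on :: "('a \<Rightarrow> complex) set \<Rightarrow> 'a set \<Rightarrow> ('a \<Rightarrow> complex) \<Rightarrow> bool" where
  "polynomial_on X V f \<longleftrightarrow> (\<exists>g\<in>polynomial_functions X. \<forall>v\<in>V. f v = g v)"

lemma polynomial_on_const: "polynomial_on X V (\<lambda>_. c)"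
  unfolding polynomial_on_def by (intro bexI[of _ "\<lambda>_. c"] polynomial_functions.const) simp

lemma polynomial_on_coord: "x \<in> X \<Longrightarrow> polynomial_on X V x"
  unfolding polynomial_on_def by (intro bexI[of _ x] polynomial_functions.coord) simp_all

lemma polynomial_on_cong:
  "polynomial_on X V g \<Longrightarrow> (\<And>v. v \<in> V \<Longrightarrow> f v = g v) \<Longrightarrow> polynomial_on X V f"
  unfolding polynomial_on_def by auto

lemma polynomial_on_mult:
  assumes "polynomial_on X V f" "polynomial_on X V g"
  shows "polynomial_on X V (\<lambda>v. f v * g v)"
proof -
  obtain f' g' where "f' \<in> polynomial_functions X" "\<forall>v\<in>V. f v = f' v"
    "g' \<in> polynomial_functions X" "\<forall>v\<in>V. g v = g' v"
    using assms unfolding polynomial_on_def by blast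
  then show ?thesis unfolding polynomial_on_def
    by (intro bexI[of _ "\<lambda>v. f' v * g' v"] polynomial_functions.mult) simp_all
qed

lemma polynomial_on_sum:
  assumes "\<And>i. i \<in> I \<Longrightarrow> polynomial_on X V (f i)"
  shows "polynomial_on X V (\<lambda>v. \<Sum>i\<in>I. f i v)"
proof -
  have "\<forall>i\<in>I. \<exists>g. g \<in> polynomial_functions X \<and> (\<forall>v\<in>V. f i v = g v)"
    using assms unfolding polynomial_on_def by blast
  then obtain g where "\<forall>i\<in>I. g i \<in> polynomial_functions X \<and> (\<forall>v\<in>V. f i v = g i v)" by metis
  then show ?thesis unfolding polynomial_on_def
    by (intro bexI[of _ "\<lambda>v. \<Sum>i\<in>I. g i v"] polynomial_functions_sum) auto
qed

lemma polynomial_on_det: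
  assumes "\<And>i j. i < k \<Longrightarrow> j < k \<Longrightarrow> polynomial_on X V (\<lambda>v. f v i j)"
  shows "polynomial_on X V (\<lambda>v. det (mat k k (\<lambda>(i, j). f v i j)))"
proof -
  have "\<forall>i\<in>{..<k}. \<forall>j\<in>{..<k}. \<exists>g. g \<in> polynomial_functions X \<and> (\<forall>v\<in>V. f v i j = g v)"
    using assms unfolding polynomial_on_def by blast
  then obtain g where g: "\<And>i j. i < k \<Longrightarrow> j < k \<Longrightarrow> g i j \<in> polynomial_functions X"
    "\<And>i j v. i < k \<Longrightarrow> j < k \<Longrightarrow> v \<in> V \<Longrightarrow> f v i j = g i j v" by (metis lessThan_iff)
  show ?thesis unfolding polynomial_on_def
  proof (intro bexI ballI)
    show "(\<lambda>v. det (mat k k (\<lambda>(i, j). g i j v))) \<in> polynomial_functions X"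
      by (intro polynomial_functions_det g(1))
    show "det (mat k k (\<lambda>(i, j). f v i j)) = det (mat k k (\<lambda>(i, j). g i j v))" if "v \<in> V" for v
      by (intro arg_cong[of _ _ det] cong_mat) (use g(2) that in auto)
  qed
qed

lemma polynomial_on_mat_mult:
  assumes M: "\<And>v. v \<in> V \<Longrightarrow> M v \<in> carrier_mat a b" and M': "\<And>v. v \<in> V \<Longrightarrow> M' v \<in> carrier_mat b c"
    and "\<And>i l. i < a \<Longrightarrow> l < b \<Longrightarrow> polynomial_on X V (\<lambda>v. M v $$ (i, l))"
    and "\<And>l j. l < b \<Longrightarrow> j < c \<Longrightarrow> polynomial_on X V (\<lambda>v. M' v $$ (l, j))"
    and ij: "i < a" "j < c"
  shows "polynomial_on X V (\<lambda>v. (M v * M' v) $$ (i, j))"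
proof (rule polynomial_on_cong)
  show "polynomial_on X V (\<lambda>v. \<Sum>l<b. M v $$ (i, l) * M' v $$ (l, j))"
    by (intro polynomial_on_sum polynomial_on_mult assms(3,4)) (use ij in auto)
  show "(M v * M' v) $$ (i, j) = (\<Sum>l<b. M v $$ (i, l) * M' v $$ (l, j))" if "v \<in> V" for v
    by (rule index_mult_mat_sum[OF M[OF that] M'[OF that] ij])
qed

abbreviation triple_markov :: "complex mat \<times> complex mat \<times> complex mat \<Rightarrow> nat \<Rightarrow> complex mat" where
  "triple_markov R \<equiv> markov (fst R) (fst (snd R)) (snd (snd R))"

lemma polynomial_on_markov:
  assumes "i < m" "j < m"
  shows "polynomial_on (triple_coords m n) (triples m n) (\<lambda>R. triple_markov R p $$ (i, j))"
proof -
  let ?P = "polynomial_on (triple_coords m n) (triples m n)"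
  have A: "fst R \<in> carrier_mat n n" and B: "fst (snd R) \<in> carrier_mat n m"
    and C: "snd (snd R) \<in> carrier_mat m n" if "R \<in> triples m n" for R
    using that by (auto simp: triples_def)
  have eqs: "(\<lambda>R. fst R $$ (i, j)) = (\<lambda>(A, B, C). A $$ (i, j))"
    "(\<lambda>R. fst (snd R) $$ (i, j)) = (\<lambda>(A, B, C). B $$ (i, j))"
    "(\<lambda>R. snd (snd R) $$ (i, j)) = (\<lambda>(A, B, C). C $$ (i, j))"
    for i j by auto
  have PA: "?P (\<lambda>R. fst R $$ (i, j))" if "i < n" "j < n" for i j
    unfolding eqs by (rule polynomial_on_coord) (use that in \<open>auto simp: triple_coords_def\<close>)
  have PB: "?P (\<lambda>R. fst (snd R) $$ (i, j))" if "i < n" "j < m" for i j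
    unfolding eqs by (rule polynomial_on_coord) (use that in \<open>auto simp: triple_coords_def\<close>)
  have PC: "?P (\<lambda>R. snd (snd R) $$ (i, j))" if "i < m" "j < n" for i j
    unfolding eqs by (rule polynomial_on_coord) (use that in \<open>auto simp: triple_coords_def\<close>)
  have Ppow: "?P (\<lambda>R. (fst R ^\<^sub>m q) $$ (i, j))" if "i < n" "j < n" for q i j
    using that
  proof (induction q arbitrary: i j)
    case 0
    show ?case
      by (rule polynomial_on_cong[OF polynomial_on_const[of _ _ "if i = j then 1 else 0"]])
        (use 0 carrier_matD[OF A] in auto)
  next
    case (Suc q)
    then show ?case unfolding pow_mat.simps
      by (intro polynomial_on_mat_mult[of _ _ n n _ n] PA A pow_carrier_mat) auto
  qed
  have PCA: "?P (\<lambda>R. (snd (snd R) * fst R ^\<^sub>m p) $$ (i, j))" if ij: "i < m" "j < n" for i j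
    by (rule polynomial_on_mat_mult[OF C pow_carrier_mat[OF A] PC Ppow ij])
  show ?thesis unfolding markov_def
    by (rule polynomial_on_mat_mult[OF mult_carrier_mat[OF C pow_carrier_mat[OF A]] B PCA PB assms])
qed

definition open_condition where
  "open_condition m N idx K \<alpha> \<beta> F R =
    hankel_probe m K \<alpha> \<beta> (triple_markov R) * direction_probe N idx F (triple_markov R)"

lemma polynomial_on_open_condition:
  assumes \<alpha>: "\<alpha> \<in> carrier_mat n (K * m)" and \<beta>: "\<beta> \<in> carrier_mat (K * m) n"
    and F: "\<And>l. l < N \<Longrightarrow> F l \<in> carrier_mat m m"
  shows "polynomial_on (triple_coords m n) (triples m n) (open_condition m N idx K \<alpha> \<beta> F)"
proof -
  let ?P = "polynomial_on (triple_coords m n) (triples m n)"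
  let ?H = "\<lambda>R. \<alpha> * hankel_mat m K (triple_markov R) * \<beta>"
  have H: "hankel_mat m K h \<in> carrier_mat (K * m) (K * m)" for h by (simp add: hankel_mat_def)
  have PH: "?P (\<lambda>R. hankel_mat m K (triple_markov R) $$ (r, s))" if "r < K * m" "s < K * m" for r s
    using that polynomial_on_markov[OF mod_less_factor mod_less_factor] by (simp add: hankel_mat_def)
  have PHab: "?P (\<lambda>R. ?H R $$ (i, j))" if "i < n" "j < n" for i j
    by (rule polynomial_on_mat_mult[OF mult_carrier_mat[OF \<alpha> H] \<beta>
          polynomial_on_mat_mult[OF \<alpha> H polynomial_on_const PH] polynomial_on_const that])
  have "?P (\<lambda>R. det (mat n n (\<lambda>(i, j). ?H R $$ (i, j))))"
    by (rule polynomial_on_det) (rule PHab)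
  moreover have "mat n n (\<lambda>(i, j). ?H R $$ (i, j)) = ?H R" for R
    using \<alpha> \<beta> by (intro eq_matI) auto
  ultimately have 1: "?P (\<lambda>R. hankel_probe m K \<alpha> \<beta> (triple_markov R))" by (simp add: hankel_probe_def)
  have h: "triple_markov R p \<in> carrier_mat m m" if "R \<in> triples m n" for R p
    by (rule markov_carrier[of _ n]) (use that in \<open>auto simp: triples_def\<close>)
  have "?P (\<lambda>R. mat_trace (F l * triple_markov R p))" if "l < N" for l p
  proof (rule polynomial_on_cong)
    show "?P (\<lambda>R. \<Sum>u<m. \<Sum>v<m. F l $$ (u, v) * triple_markov R p $$ (v, u))"
      by (intro polynomial_on_sum polynomial_on_mult polynomial_on_const polynomial_on_markov) auto
  qed (rule mat_trace_mult[OF F[OF that] h])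
  then have 2: "?P (\<lambda>R. direction_probe N idx F (triple_markov R))"
    unfolding direction_probe_def by (intro polynomial_on_det)
  show ?thesis unfolding open_condition_def using 1 2 by (rule polynomial_on_mult)
qed

lemma minimal_triples_subset: "minimal_triples m n T \<subseteq> triples m n"
  by (auto simp: minimal_triples_def minimal_realization_def realization_def triples_def)

lemma markov_realization_independent:
  assumes "realization m n G R" "realization m n' G R'"
  shows "triple_markov R p = triple_markov R' p"
proof -
  obtain A B C A' B' C' where R: "R = (A, B, C)" "R' = (A', B', C')" by (metis prod_cases3)
  show ?thesis using assms markov_eq_if_transfer_function_eq[of A n B m A' n' B' C m C' p]
    by (simp add: R realization_def)
qed

text \<open>
  A nonvanishing condition that depends on a triple only through its Markov parameters holds for
  all realizations of a transfer function or for none. The set of transfer functions that it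
  singles out is therefore open in the quotient topology.
\<close>

lemma genericI:
  assumes poly: "\<And>f. f \<in> P \<Longrightarrow> polynomial_on (triple_coords m n) (triples m n) f"
    and inv: "\<And>f R R'. f \<in> P \<Longrightarrow> triple_markov R = triple_markov R' \<Longrightarrow> f R = f R'"
    and ex: "G\<^sub>0 \<in> T" "minimal_realization m n G\<^sub>0 R\<^sub>0" "f\<^sub>0 \<in> P" "f\<^sub>0 R\<^sub>0 \<noteq> 0"
    and Q: "\<And>G R f. G \<in> T \<Longrightarrow> minimal_realization m n G R \<Longrightarrow> f \<in> P \<Longrightarrow> f R \<noteq> 0 \<Longrightarrow> Q G"
  shows "generic m n T Q"
proof -
  define U where "U = {G \<in> T. \<exists>R f. minimal_realization m n G R \<and> f \<in> P \<and> f R \<noteq> 0}"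
  have U: "minimal_triples m n U = {R \<in> minimal_triples m n T. \<exists>f\<in>P. f R \<noteq> 0}"
  proof (intro equalityI subsetI)
    fix R assume "R \<in> minimal_triples m n U"
    then obtain G R' f where *: "G \<in> T" "minimal_realization m n G R" "minimal_realization m n G R'"
      "f \<in> P" "f R' \<noteq> 0" by (auto simp: minimal_triples_def U_def)
    have "triple_markov R p = triple_markov R' p" for p
      using markov_realization_independent[of m n G R n R'] *(2,3)
      by (auto simp: minimal_realization_def)
    then have "triple_markov R = triple_markov R'" by blast
    from inv[OF *(4) this] *(5) have "f R \<noteq> 0" by simp
    with *(1,2,4) show "R \<in> {R \<in> minimal_triples m n T. \<exists>f\<in>P. f R \<noteq> 0}"
      unfolding minimal_triples_def by blast
  next
    fix R assume "R \<in> {R \<in> minimal_triples m n T. \<exists>f\<in>P. f R \<noteq> 0}"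
    then obtain G f where "G \<in> T" "minimal_realization m n G R" "f \<in> P" "f R \<noteq> 0"
      unfolding minimal_triples_def by blast
    then show "R \<in> minimal_triples m n U" unfolding minimal_triples_def U_def by blast
  qed
  have "\<forall>f\<in>P. \<exists>g. g \<in> polynomial_functions (triple_coords m n) \<and> (\<forall>v\<in>triples m n. f v = g v)"
    using poly unfolding polynomial_on_def by blast
  then obtain g where g: "\<And>f. f \<in> P \<Longrightarrow> g f \<in> polynomial_functions (triple_coords m n)"
    "\<And>f v. f \<in> P \<Longrightarrow> v \<in> triples m n \<Longrightarrow> f v = g f v" by metis
  have "minimal_triples m n T - minimal_triples m n U =
    {v \<in> minimal_triples m n T. \<forall>f\<in>g ` P. f v = 0}"
    unfolding U using g(2) minimal_triples_subset by fastforce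
  moreover have "g ` P \<subseteq> polynomial_functions (triple_coords m n)" using g(1) by auto
  ultimately have "zariski_closed_in (triple_coords m n) (minimal_triples m n T)
    (minimal_triples m n T - minimal_triples m n U)"
    unfolding zariski_closed_in_def by blast
  then have "tf_zariski_open m n T U"
    unfolding tf_zariski_open_def zariski_open_in_def using U by (auto simp: U_def)
  moreover have "U \<noteq> {}" using ex unfolding U_def by blast
  moreover have "\<forall>G\<in>U. Q G" using Q unfolding U_def by blast
  ultimately show ?thesis unfolding generic_def by blast
qed

section \<open>Sufficiency of the dimension condition\<close>

lemma transfer_function_smult_output:
  assumes A: "A \<in> carrier_mat n n" and B: "B \<in> carrier_mat n k" and C: "C \<in> carrier_mat m n"
  shows "transfer_function A B ((-1) \<cdot>\<^sub>m C) = - transfer_function A B C"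
proof -
  note R = resolvent_inverse(1)[OF A]
  have "const_mat ((-1) \<cdot>\<^sub>m C) = - const_mat C" by (rule eq_matI) auto
  then show ?thesis using A B C R by (simp add: transfer_function_def)
qed

lemma one_smult_mat: "(1 :: 'a :: monoid_mult) \<cdot>\<^sub>m M = M"
  by (rule eq_matI) auto

text \<open>
  The right-hand transfer function is \<open>-G(s)\<close> for \<open>\<sigma> = 1\<close> and
  \<open>-G(-s)\<close> for \<open>\<sigma> = -1\<close>, where \<open>G\<close> is the transfer
  function of \<open>(A, B, C)\<close>; this treats both symmetries at once.
\<close>

lemma transpose_eq_iff_markov_symmetric:
  assumes A: "A \<in> carrier_mat n n" and B: "B \<in> carrier_mat n m" and C: "C \<in> carrier_mat m n"
  shows "(transfer_function A B C)\<^sup>T = transfer_function (\<sigma> \<cdot>\<^sub>m A) B ((- \<sigma>) \<cdot>\<^sub>m C) \<longleftrightarrow>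
    (\<forall>p. (markov A B C p)\<^sup>T = (- \<sigma> * \<sigma> ^ p) \<cdot>\<^sub>m markov A B C p)"
proof -
  have T: "A\<^sup>T \<in> carrier_mat n n" "C\<^sup>T \<in> carrier_mat n m" "B\<^sup>T \<in> carrier_mat m n" using A B C by auto
  have c: "\<sigma> \<cdot>\<^sub>m A \<in> carrier_mat n n" "(- \<sigma>) \<cdot>\<^sub>m C \<in> carrier_mat m n" using A C by auto
  show ?thesis
    unfolding transfer_function_transpose[OF A B C] markov_transpose[OF A B C]
      markov_smult[OF A B C, symmetric]
    using markov_eq_if_transfer_function_eq[OF T(1,2) c(1) B T(3) c(2)]
      transfer_function_eq_if_markov_eq[OF T c(1) B c(2)] by blast
qed

lemma skew_trace_zero:
  assumes F: "F \<in> carrier_mat m m" "F\<^sup>T = - F" and h: "h \<in> carrier_mat m m" "h\<^sup>T = h"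
  shows "mat_trace (F * h) = 0"
proof -
  have F': "F $$ (v, u) = - F $$ (u, v)" if "u < m" "v < m" for u v
    using arg_cong[OF F(2), of "\<lambda>M. M $$ (u, v)"] that F(1) by simp
  have h': "h $$ (v, u) = h $$ (u, v)" if "u < m" "v < m" for u v
    using arg_cong[OF h(2), of "\<lambda>M. M $$ (u, v)"] that h(1) by simp
  have "mat_trace (F * h) = (\<Sum>v<m. \<Sum>u<m. F $$ (u, v) * h $$ (v, u))"
    unfolding mat_trace_mult[OF F(1) h(1)] by (rule sum.swap)
  also have "\<dots> = (\<Sum>v<m. \<Sum>u<m. - (F $$ (v, u) * h $$ (u, v)))"
  proof (intro sum.cong refl)
    fix v u assume "v \<in> {..<m}" "u \<in> {..<m}"
    then show "F $$ (u, v) * h $$ (v, u) = - (F $$ (v, u) * h $$ (u, v))"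
      using F'[of v u] h'[of u v] by simp
  qed
  also have "\<dots> = - mat_trace (F * h)"
    unfolding mat_trace_mult[OF F(1) h(1)] by (simp add: sum_negf)
  finally show ?thesis by simp
qed

text \<open>
  The traces are linear in the feedback matrix, so the inverse of the Jacobian matrix yields the
  coefficients of a suitable combination of the \<open>F l\<close>.
\<close>

lemma directions_onto:
  assumes F: "\<And>l. l < N \<Longrightarrow> F l \<in> skew_symmetric_mats m" and h: "\<And>p. h p \<in> carrier_mat m m"
    and probe: "direction_probe N idx F h \<noteq> 0"
  shows "\<exists>G\<in>skew_symmetric_mats m. \<forall>k<N. mat_trace (G * h (idx k)) = c k"
proof -
  have Fc: "F l \<in> carrier_mat m m" "(F l)\<^sup>T = - F l" if "l < N" for l
    using F[OF that] by (auto simp: skew_symmetric_mats_def)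
  let ?M = "mat N N (\<lambda>(k, l). mat_trace (F l * h (idx k)))"
  obtain M' where M': "M' \<in> carrier_mat N N" "?M * M' = 1\<^sub>m N"
    using inverse_mat_exists[of ?M N] probe by (auto simp: direction_probe_def)
  define x where "x l = (\<Sum>k<N. M' $$ (l, k) * c k)" for l
  have Mx: "(\<Sum>l<N. mat_trace (F l * h (idx k)) * x l) = c k" if k: "k < N" for k
  proof -
    have "(\<Sum>l<N. mat_trace (F l * h (idx k)) * x l) =
      (\<Sum>l<N. \<Sum>j<N. ?M $$ (k, l) * M' $$ (l, j) * c j)"
      using k by (simp add: x_def sum_distrib_left mult.assoc)
    also have "\<dots> = (\<Sum>j<N. (?M * M') $$ (k, j) * c j)"
      by (subst sum.swap) (use k index_mult_mat_sum[of ?M N N M' N k] M'(1) in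
        \<open>simp add: sum_distrib_right\<close>)
    also have "\<dots> = (\<Sum>j<N. if j = k then c j else 0)"
      unfolding M'(2) using k by (intro sum.cong) auto
    finally show ?thesis using k by simp
  qed
  define G where "G = mat m m (\<lambda>(u, v). \<Sum>l<N. x l * F l $$ (u, v))"
  have G: "G \<in> carrier_mat m m" by (simp add: G_def)
  have "G\<^sup>T = - G"
  proof (rule eq_matI)
    fix u v assume "u < dim_row (- G)" "v < dim_col (- G)"
    then have uv: "u < m" "v < m" by (auto simp: G_def)
    have "F l $$ (v, u) = - F l $$ (u, v)" if "l < N" for l
      using arg_cong[OF Fc(2)[OF that], of "\<lambda>M. M $$ (u, v)"] Fc(1)[OF that] uv by simp
    then have "(\<Sum>l<N. x l * F l $$ (v, u)) = (\<Sum>l<N. - (x l * F l $$ (u, v)))"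
      by (intro sum.cong) auto
    then show "G\<^sup>T $$ (u, v) = (- G) $$ (u, v)" using uv by (simp add: G_def sum_negf)
  qed (auto simp: G_def)
  with G have "G \<in> skew_symmetric_mats m" by (simp add: skew_symmetric_mats_def)
  moreover have "mat_trace (G * h (idx k)) = c k" if k: "k < N" for k
  proof -
    have "mat_trace (G * h (idx k)) = (\<Sum>u<m. \<Sum>v<m. \<Sum>l<N. x l * (F l $$ (u, v) * h (idx k) $$ (v, u)))"
      unfolding mat_trace_mult[OF G h]
      by (intro sum.cong) (auto simp: G_def sum_distrib_right mult.assoc)
    also have "\<dots> = (\<Sum>u<m. \<Sum>l<N. \<Sum>v<m. x l * (F l $$ (u, v) * h (idx k) $$ (v, u)))"
      by (rule sum.cong[OF refl], rule sum.swap)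
    also have "\<dots> = (\<Sum>l<N. \<Sum>u<m. \<Sum>v<m. x l * (F l $$ (u, v) * h (idx k) $$ (v, u)))"
      by (rule sum.swap)
    also have "\<dots> = (\<Sum>l<N. mat_trace (F l * h (idx k)) * x l)"
      by (intro sum.cong) (auto simp: mat_trace_mult[OF Fc(1) h] sum_distrib_left sum_distrib_right mult.commute)
    finally show ?thesis using Mx[OF k] by simp
  qed
  ultimately show ?thesis by blast
qed

text \<open>
  The curves required for density are the images of the lines of feedback matrices
  \<open>t G\<close>. For a prescribed velocity \<open>u\<close>, forward substitution gives the
  values \<open>c J\<close> that the traces of \<open>G\<close> times the skew-symmetric Markov
  parameters must take; the other Markov parameters are symmetric and contribute no trace.
\<close>

lemma pole_assignable_if_probes_nonzero:
  fixes \<sigma> :: complex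
  assumes A: "A \<in> carrier_mat n n" and B: "B \<in> carrier_mat n m" and C: "C \<in> carrier_mat m n"
    and \<alpha>: "\<alpha> \<in> carrier_mat n (K * m)" and \<beta>: "\<beta> \<in> carrier_mat (K * m) n"
    and probe: "hankel_probe m K \<alpha> \<beta> (markov A B C) \<noteq> 0"
    and F: "\<And>l. l < N \<Longrightarrow> F l \<in> skew_symmetric_mats m"
    and dprobe: "direction_probe N idx F (markov A B C) \<noteq> 0"
    and \<sigma>: "\<sigma> = 1 \<or> \<sigma> = -1"
    and h: "\<And>p. (markov A B C p)\<^sup>T = (- \<sigma> * \<sigma> ^ p) \<cdot>\<^sub>m markov A B C p"
    and idx: "strict_mono idx" "\<And>J. J < N \<Longrightarrow> idx J < n" "\<And>i. \<sigma> ^ Suc i = 1 \<Longrightarrow> i \<in> range idx"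
    and V: "coefficient_chart n N (\<lambda>i. n - 1 - idx i) V"
    and closed: "\<And>S X. S \<in> carrier_mat n n \<Longrightarrow> X \<in> carrier_mat n n \<Longrightarrow> det S \<noteq> 0 \<Longrightarrow>
      S\<^sup>T = (- \<sigma>) \<cdot>\<^sub>m S \<Longrightarrow> S * X = \<sigma> \<cdot>\<^sub>m X\<^sup>T * S \<Longrightarrow> char_poly X \<in> V"
  shows "zariski_dense_in (poly_coords n) V
    ((\<lambda>F. char_poly (A + B * F * C)) ` skew_symmetric_mats m)"
proof (rule zariski_dense_if_tangent_onto[OF V, of _ "char_poly A"])
  have \<sigma>2: "\<sigma> * \<sigma> = 1" using \<sigma> by auto
  show "(\<lambda>F. char_poly (A + B * F * C)) ` skew_symmetric_mats m \<subseteq> V"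
  proof (rule image_subsetI)
    fix F assume "F \<in> skew_symmetric_mats m"
    then have F: "F \<in> carrier_mat m m" "F\<^sup>T = - F" by (auto simp: skew_symmetric_mats_def)
    have X: "A + B * F * C \<in> carrier_mat n n" using A B C F by auto
    from closed_loop_symmetry[OF A B C \<alpha> \<beta> probe \<sigma>2 h F] closed[OF _ X]
    show "char_poly (A + B * F * C) \<in> V" by blast
  qed
  fix u :: "nat \<Rightarrow> complex"
  let ?a = "coeff (char_poly A)"
  have hc: "markov A B C p \<in> carrier_mat m m" for p by (rule markov_carrier[OF A B C])
  let ?r = "\<lambda>J c. - u J - (\<Sum>I<J. ?a (n - idx J + idx I) * c I)"
  have "\<exists>c. \<forall>J<N. c J = ?r J c"
  proof (rule triangular_system_solvable)
    show "?r J c = ?r J c'" if "\<And>I. I < J \<Longrightarrow> c I = c' I" for J c c'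
      using that by simp
  qed
  then obtain c where c: "\<And>J. J < N \<Longrightarrow> c J = ?r J c" by blast
  obtain G where G: "G \<in> skew_symmetric_mats m" "\<And>k. k < N \<Longrightarrow> mat_trace (G * markov A B C (idx k)) = c k"
    using directions_onto[OF F hc dprobe] by blast
  then have Gc: "G \<in> carrier_mat m m" "G\<^sup>T = - G" by (auto simp: skew_symmetric_mats_def)
  let ?X = "B * G * C"
  have X: "?X \<in> carrier_mat n n" using B C Gc by auto
  have trace: "mat_trace (?X * A ^\<^sub>m i) = mat_trace (G * markov A B C i)" for i
  proof -
    have Y: "G * C * A ^\<^sub>m i \<in> carrier_mat m n"
      by (rule mult_carrier_mat[OF mult_carrier_mat[OF Gc(1) C] pow_carrier_mat[OF A]])
    have "?X * A ^\<^sub>m i = B * (G * C * A ^\<^sub>m i)" using A B C Gc by (simp add: mat_assoc)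
    then have "mat_trace (?X * A ^\<^sub>m i) = mat_trace (G * C * A ^\<^sub>m i * B)"
      using mat_trace_mult_comm[OF B Y] by simp
    also have "G * C * A ^\<^sub>m i * B = G * markov A B C i"
      unfolding markov_def using A B C Gc by (simp add: mat_assoc)
    finally show ?thesis .
  qed
  have trace0: "mat_trace (G * markov A B C i) = 0" if "i \<notin> range idx" for i
  proof -
    have "\<sigma> ^ Suc i \<noteq> 1" using idx(3) that by blast
    then have "\<sigma> ^ Suc i = -1" using \<sigma> by (cases "even i") auto
    then have "- \<sigma> * \<sigma> ^ i = 1" by simp
    then have "(markov A B C i)\<^sup>T = markov A B C i" using h[of i] by (simp add: one_smult_mat)
    then show ?thesis by (rule skew_trace_zero[OF Gc hc])
  qed
  have tangent: "coeff (char_poly_pencil A ?X 1) (n - 1 - idx J) = u J" if J: "J < N" for J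
  proof -
    have inj: "inj_on idx {..J}" using idx(1) by (auto simp: inj_on_def strict_mono_eq)
    have "(\<Sum>i\<le>idx J. ?a (n - idx J + i) * mat_trace (?X * A ^\<^sub>m i)) =
      (\<Sum>i\<in>idx ` {..J}. ?a (n - idx J + i) * mat_trace (G * markov A B C i))"
      unfolding trace
    proof (rule sum.mono_neutral_right)
      show "idx ` {..J} \<subseteq> {..idx J}" using idx(1) by (auto simp: strict_mono_less_eq)
      show "\<forall>i\<in>{..idx J} - idx ` {..J}. ?a (n - idx J + i) * mat_trace (G * markov A B C i) = 0"
      proof
        fix i assume i: "i \<in> {..idx J} - idx ` {..J}"
        have "i \<notin> range idx" using i idx(1) by (auto simp: strict_mono_less_eq)
        then show "?a (n - idx J + i) * mat_trace (G * markov A B C i) = 0" by (simp add: trace0)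
      qed
    qed simp
    also have "\<dots> = (\<Sum>I\<le>J. ?a (n - idx J + idx I) * c I)"
      unfolding sum.reindex[OF inj] using J G(2) by (intro sum.cong) auto
    also have "\<dots> = (\<Sum>I<J. ?a (n - idx J + idx I) * c I) + c J"
      using degree_monic_char_poly[OF A] idx(2)[OF J]
      by (simp add: lessThan_Suc_atMost[symmetric])
    also have "\<dots> = - u J" using c[OF J] by simp
    finally show ?thesis using coeff_char_poly_pencil_1[OF A X idx(2)[OF J]] by simp
  qed
  show "\<exists>D \<psi>. \<psi> 0 = char_poly A \<and> (\<forall>i<N. coeff (\<psi> 1) (n - 1 - idx i) = u i) \<and>
    (\<forall>t. (\<Sum>j\<le>Suc D. Polynomial.smult (t ^ j) (\<psi> j)) \<in>
      (\<lambda>F. char_poly (A + B * F * C)) ` skew_symmetric_mats m)"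
  proof (intro exI[of _ n] exI[of _ "char_poly_pencil A ?X"] conjI allI impI)
    show "char_poly_pencil A ?X 0 = char_poly A" by (rule char_poly_pencil_0[OF A])
    fix t
    have tG: "t \<cdot>\<^sub>m G \<in> skew_symmetric_mats m"
    proof -
      have "(t \<cdot>\<^sub>m G)\<^sup>T = t \<cdot>\<^sub>m G\<^sup>T" by (rule eq_matI) auto
      also have "\<dots> = - (t \<cdot>\<^sub>m G)" unfolding Gc(2) by (rule eq_matI) auto
      finally show ?thesis using Gc(1) by (simp add: skew_symmetric_mats_def)
    qed
    have "(\<Sum>j\<le>Suc n. Polynomial.smult (t ^ j) (char_poly_pencil A ?X j)) = char_poly (A + t \<cdot>\<^sub>m ?X)"
      by (rule char_poly_on_line[OF A X, symmetric]) simp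
    also have "t \<cdot>\<^sub>m ?X = B * (t \<cdot>\<^sub>m G) * C"
      unfolding mult_smult_distrib[OF B Gc(1)]
      by (rule mult_smult_assoc_mat[symmetric, OF mult_carrier_mat[OF B Gc(1)] C])
    finally show "(\<Sum>j\<le>Suc n. Polynomial.smult (t ^ j) (char_poly_pencil A ?X j)) \<in>
      (\<lambda>F. char_poly (A + B * F * C)) ` skew_symmetric_mats m" using tG by blast
  qed (rule tangent)
qed

text \<open>
  Both symmetry types are instances. The parameters \<open>s\<close> and \<open>t\<close> of
  \<open>idx\<close> are \<open>0\<close> and \<open>1\<close> in the skew-symmetric case, where
  all Markov parameters are skew-symmetric, and \<open>1\<close> and \<open>2\<close> in the
  skew-Hamiltonian case, where those of odd index are.
\<close>

lemma generic_pole_assignable: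
  fixes \<sigma> :: complex
  assumes m: "m > 0" and N: "N \<le> m choose 2" and \<sigma>: "\<sigma> = 1 \<or> \<sigma> = -1"
    and n: "n = 2 * N \<or> n = 2 * N + 1 \<and> \<sigma> = -1"
    and idx: "\<And>k. idx k = s + t * k" "t > 0" "\<And>i. \<sigma> ^ Suc i = 1 \<longleftrightarrow> i \<in> range idx"
      "\<And>J. J < N \<Longrightarrow> idx J < n"
    and T: "\<And>A B C. A \<in> carrier_mat n n \<Longrightarrow> B \<in> carrier_mat n m \<Longrightarrow> C \<in> carrier_mat m n \<Longrightarrow>
      transfer_function A B C \<in> T \<longleftrightarrow> transfer_function A B C \<in> transfer_functions m n \<and>
        (\<forall>p. (markov A B C p)\<^sup>T = (- \<sigma> * \<sigma> ^ p) \<cdot>\<^sub>m markov A B C p)"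
    and V: "coefficient_chart n N (\<lambda>i. n - 1 - idx i) V"
    and closed: "\<And>S X. S \<in> carrier_mat n n \<Longrightarrow> X \<in> carrier_mat n n \<Longrightarrow> det S \<noteq> 0 \<Longrightarrow>
      S\<^sup>T = (- \<sigma>) \<cdot>\<^sub>m S \<Longrightarrow> S * X = \<sigma> \<cdot>\<^sub>m X\<^sup>T * S \<Longrightarrow> char_poly X \<in> V"
  shows "generic m n T (pole_assignable m n V)"
proof -
  define P where "P = {open_condition m N idx K \<alpha> \<beta> F | K \<alpha> \<beta> F. \<alpha> \<in> carrier_mat n (K * m) \<and>
    \<beta> \<in> carrier_mat (K * m) n \<and> (\<forall>l<N. F l \<in> skew_symmetric_mats m)}"
  have idx1: "\<sigma> ^ Suc (idx k) = 1" for k using idx(3) by blast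
  obtain A B C K \<alpha> \<beta> F where ex: "A \<in> carrier_mat n n" "B \<in> carrier_mat n m" "C \<in> carrier_mat m n"
    "\<And>p. (markov A B C p)\<^sup>T = (- \<sigma> * \<sigma> ^ p) \<cdot>\<^sub>m markov A B C p"
    "\<alpha> \<in> carrier_mat n (K * m)" "\<beta> \<in> carrier_mat (K * m) n"
    "hankel_probe m K \<alpha> \<beta> (markov A B C) \<noteq> 0"
    "\<And>l. l < N \<Longrightarrow> F l \<in> skew_symmetric_mats m" "direction_probe N idx F (markov A B C) \<noteq> 0"
    using symmetric_realization_exists[OF m N \<sigma> n idx(1) idx1 idx(2)] by blast
  let ?G = "transfer_function A B C"
  have min: "minimal_realization m n ?G (A, B, C)"
    unfolding minimal_realization_def
  proof (intro conjI allI impI)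
    show real: "realization m n ?G (A, B, C)" using ex(1-3) by (simp add: realization_def)
    fix n' R' assume R': "realization m n' ?G R'"
    obtain A' B' C' where R'_eq: "R' = (A', B', C')" by (metis prod_cases3)
    show "n \<le> n'"
      by (rule probe_order_minimal[OF ex(1-3,5-7), of A' n' B' C'])
        (use R' markov_realization_independent[OF real R'] in \<open>auto simp: R'_eq realization_def\<close>)
  qed
  show ?thesis
  proof (rule genericI[where P = P])
    show "polynomial_on (triple_coords m n) (triples m n) f" if "f \<in> P" for f
      using that unfolding P_def
      by (auto intro!: polynomial_on_open_condition simp: skew_symmetric_mats_def)
    show "f R = f R'" if "f \<in> P" "triple_markov R = triple_markov R'" for f R R'
      using that by (auto simp: P_def open_condition_def)
    show "minimal_realization m n ?G (A, B, C)" by (rule min)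
    then show "?G \<in> T" using T[OF ex(1-3)] ex(4) by (auto simp: transfer_functions_def)
    show "open_condition m N idx K \<alpha> \<beta> F \<in> P" using ex(5,6,8) by (auto simp: P_def)
    show "open_condition m N idx K \<alpha> \<beta> F (A, B, C) \<noteq> 0" using ex(7,9) by (simp add: open_condition_def)
  next
    fix G R f assume G: "G \<in> T" and min: "minimal_realization m n G R" and f: "f \<in> P" "f R \<noteq> 0"
    obtain A B C where R: "R = (A, B, C)" by (metis prod_cases3)
    then have c: "A \<in> carrier_mat n n" "B \<in> carrier_mat n m" "C \<in> carrier_mat m n"
      and G_eq: "G = transfer_function A B C"
      using min by (auto simp: minimal_realization_def realization_def)
    obtain K \<alpha> \<beta> F where f_eq: "f = open_condition m N idx K \<alpha> \<beta> F" and ab: "\<alpha> \<in> carrier_mat n (K * m)"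
      "\<beta> \<in> carrier_mat (K * m) n" and F: "\<And>l. l < N \<Longrightarrow> F l \<in> skew_symmetric_mats m"
      using f(1) unfolding P_def by blast
    have probes: "hankel_probe m K \<alpha> \<beta> (markov A B C) \<noteq> 0" "direction_probe N idx F (markov A B C) \<noteq> 0"
      using f(2) by (auto simp: f_eq open_condition_def R)
    have h: "(markov A B C p)\<^sup>T = (- \<sigma> * \<sigma> ^ p) \<cdot>\<^sub>m markov A B C p" for p
      using T[OF c] G G_eq by blast
    have mono: "strict_mono idx" using idx(1,2) by (simp add: strict_mono_def)
    have "zariski_dense_in (poly_coords n) V ((\<lambda>F. char_poly (A + B * F * C)) ` skew_symmetric_mats m)"
      by (rule pole_assignable_if_probes_nonzero[OF c ab probes(1) F probes(2) \<sigma> h mono idx(4) _ V closed])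
        (use idx(3) in auto)
    then show "pole_assignable m n V G"
      unfolding pole_assignable_def using min R by blast
  qed
qed

section \<open>Necessity of the dimension condition\<close>

lemma skew_symmetric_parametrization:
  obtains \<Psi> :: "(nat \<Rightarrow> complex) \<Rightarrow> complex mat" where
    "\<And>x. \<Psi> x \<in> carrier_mat m m"
    "\<And>x y t. \<Psi> (\<lambda>i. x i + t * y i) = \<Psi> x + t \<cdot>\<^sub>m \<Psi> y"
    "\<And>F. F \<in> skew_symmetric_mats m \<Longrightarrow> \<exists>x. (\<forall>e\<ge>m choose 2. x e = 0) \<and> F = \<Psi> x"
proof -
  let ?Pairs = "{(a, b :: nat). a < b \<and> b < m}"
  have fin: "finite ?Pairs" by (rule finite_subset[of _ "{..<m} \<times> {..<m}"]) auto
  obtain ix where ix: "bij_betw ix ?Pairs {..<m choose 2}"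
    using ex_bij_betw_finite_nat[OF fin] by (auto simp: card_increasing_pairs atLeast0LessThan)
  define \<Psi> :: "(nat \<Rightarrow> complex) \<Rightarrow> complex mat" where
    "\<Psi> x = mat m m (\<lambda>(u, v). if u < v then x (ix (u, v)) else if v < u then - x (ix (v, u)) else 0)" for x
  show thesis
  proof (rule that)
    show "\<Psi> x \<in> carrier_mat m m" for x by (simp add: \<Psi>_def)
    show "\<Psi> (\<lambda>i. x i + t * y i) = \<Psi> x + t \<cdot>\<^sub>m \<Psi> y" for x y t
      by (rule eq_matI) (auto simp: \<Psi>_def)
    fix F assume "F \<in> skew_symmetric_mats m"
    then have F: "F \<in> carrier_mat m m" "F\<^sup>T = - F" by (auto simp: skew_symmetric_mats_def)
    have skew: "F $$ (v, u) = - F $$ (u, v)" if "u < m" "v < m" for u v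
      using arg_cong[OF F(2), of "\<lambda>M. M $$ (u, v)"] that F(1) by simp
    define x where "x e = (if e < m choose 2 then F $$ (inv_into ?Pairs ix e) else 0)" for e
    have x: "x (ix (u, v)) = F $$ (u, v)" if "u < v" "v < m" for u v
    proof -
      have uv: "(u, v) \<in> ?Pairs" using that by simp
      have "ix (u, v) < m choose 2" using bij_betw_apply[OF ix uv] by simp
      then show ?thesis using bij_betw_inv_into_left[OF ix uv] by (simp add: x_def)
    qed
    have "F = \<Psi> x"
    proof (rule eq_matI)
      fix u v assume "u < dim_row (\<Psi> x)" "v < dim_col (\<Psi> x)"
      then have uv: "u < m" "v < m" by (auto simp: \<Psi>_def)
      consider "u < v" | "v < u" | "u = v" by linarith
      then show "F $$ (u, v) = \<Psi> x $$ (u, v)"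
      proof cases
        case 2
        then show ?thesis using uv x[of v u] skew[of v u] by (simp add: \<Psi>_def)
      next
        case 3
        then show ?thesis using uv skew[of u u] by (simp add: \<Psi>_def)
      qed (use uv x in \<open>simp add: \<Psi>_def\<close>)
    qed (use F in \<open>auto simp: \<Psi>_def\<close>)
    then show "\<exists>x. (\<forall>e\<ge>m choose 2. x e = 0) \<and> F = \<Psi> x"
      by (intro exI[of _ x]) (simp add: x_def)
  qed
qed

text \<open>
  Changing one parameter moves the closed-loop matrix along a line, on which the coefficients of
  the characteristic polynomial are polynomials of degree at most \<open>n\<close>.
\<close>

lemma not_pole_assignable_if_few_parameters:
  assumes V: "coefficient_chart n N \<kappa> V" and few: "m choose 2 < N"
  shows "\<not> pole_assignable m n V G"
proof
  assume "pole_assignable m n V G"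
  then obtain A B C where min: "minimal_realization m n G (A, B, C)"
    and dense: "zariski_dense_in (poly_coords n) V
      ((\<lambda>F. char_poly (A + B * F * C)) ` skew_symmetric_mats m)"
    unfolding pole_assignable_def by blast
  have A: "A \<in> carrier_mat n n" and B: "B \<in> carrier_mat n m" and C: "C \<in> carrier_mat m n"
    using min by (auto simp: minimal_realization_def realization_def)
  obtain \<Psi> where \<Psi>: "\<And>x. \<Psi> x \<in> carrier_mat m m"
    "\<And>x y t. \<Psi> (\<lambda>i. x i + t * y i) = \<Psi> x + t \<cdot>\<^sub>m \<Psi> y"
    "\<And>F. F \<in> skew_symmetric_mats m \<Longrightarrow> \<exists>x. (\<forall>e\<ge>m choose 2. x e = 0) \<and> F = \<Psi> x"
    using skew_symmetric_parametrization[of m] by blast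
  have sep: "separately_polynomial (m choose 2) n (\<lambda>x. coeff (char_poly (A + B * \<Psi> x * C)) k)" for k
    unfolding separately_polynomial_def
  proof (intro allI impI)
    fix x :: "nat \<Rightarrow> complex" and e
    let ?x0 = "x(e := 0)" and ?\<delta> = "(\<lambda>_. 0 :: complex)(e := 1)"
    let ?A = "A + B * \<Psi> ?x0 * C" and ?X = "B * \<Psi> ?\<delta> * C"
    have c: "?A \<in> carrier_mat n n" "?X \<in> carrier_mat n n" using A B C \<Psi>(1) by auto
    have line: "A + B * \<Psi> (x(e := t)) * C = ?A + t \<cdot>\<^sub>m ?X" for t
    proof -
      have "x(e := t) = (\<lambda>i. ?x0 i + t * ?\<delta> i)" by auto
      then have "\<Psi> (x(e := t)) = \<Psi> ?x0 + t \<cdot>\<^sub>m \<Psi> ?\<delta>" using \<Psi>(2) by metis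
      then have "B * \<Psi> (x(e := t)) * C = (B * \<Psi> ?x0 + B * (t \<cdot>\<^sub>m \<Psi> ?\<delta>)) * C"
        using mult_add_distrib_mat[OF B \<Psi>(1) smult_carrier_mat[OF \<Psi>(1)]] by simp
      also have "\<dots> = B * \<Psi> ?x0 * C + B * (t \<cdot>\<^sub>m \<Psi> ?\<delta>) * C"
        by (rule add_mult_distrib_mat[OF mult_carrier_mat[OF B \<Psi>(1)]
              mult_carrier_mat[OF B smult_carrier_mat[OF \<Psi>(1)]] C])
      also have "B * (t \<cdot>\<^sub>m \<Psi> ?\<delta>) * C = t \<cdot>\<^sub>m ?X"
        unfolding mult_smult_distrib[OF B \<Psi>(1)]
        by (rule mult_smult_assoc_mat[OF mult_carrier_mat[OF B \<Psi>(1)] C])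
      finally have "B * \<Psi> (x(e := t)) * C = B * \<Psi> ?x0 * C + t \<cdot>\<^sub>m ?X" .
      then show ?thesis
        using assoc_add_mat[OF A mult_carrier_mat[OF mult_carrier_mat[OF B \<Psi>(1)] C]
            smult_carrier_mat[OF c(2)], of ?x0 t] by metis
    qed
    have "coeff (char_poly (A + B * \<Psi> (x(e := t)) * C)) k =
      poly (\<Sum>j\<le>n. monom (coeff (char_poly_pencil ?A ?X j) k) j) t" for t
      unfolding line[of t] char_poly_on_line[OF c order_refl, of t]
      by (simp add: coeff_sum poly_sum poly_monom mult.commute)
    moreover have "degree (\<Sum>j\<le>n. monom (coeff (char_poly_pencil ?A ?X j) k) j) \<le> n"
      by (intro degree_sum_le) (auto intro: order_trans[OF degree_monom_le])
    ultimately show "\<exists>p. degree p \<le> n \<and>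
      (\<forall>t. coeff (char_poly (A + B * \<Psi> (x(e := t)) * C)) k = poly p t)" by blast
  qed
  have "\<exists>x. (\<forall>e\<ge>m choose 2. x e = 0) \<and> p = char_poly (A + B * \<Psi> x * C)"
    if "p \<in> (\<lambda>F. char_poly (A + B * F * C)) ` skew_symmetric_mats m" for p
    using that \<Psi>(3) by blast
  from not_zariski_dense_if_few_parameters[OF V few sep this] dense show False by blast
qed

lemma generic_imp_exists: "generic m n T Q \<Longrightarrow> \<exists>G. Q G"
  unfolding generic_def by blast

lemma skew_symmetric_generic_iff:
  assumes m: "m > 0" and n: "even n"
  shows "generic m n (skew_symmetric_tfs m n) (pole_assignable m n (square_polys n)) \<longleftrightarrow>
    n div 2 \<le> m choose 2"
proof
  assume "generic m n (skew_symmetric_tfs m n) (pole_assignable m n (square_polys n))"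
  then show "n div 2 \<le> m choose 2"
    using not_pole_assignable_if_few_parameters[OF square_polys_chart[OF n]] generic_imp_exists
    by (meson not_le)
next
  assume N: "n div 2 \<le> m choose 2"
  show "generic m n (skew_symmetric_tfs m n) (pole_assignable m n (square_polys n))"
  proof (rule generic_pole_assignable[OF m N, where \<sigma> = 1 and idx = "\<lambda>k. k" and s = 0 and t = 1])
    show "n = 2 * (n div 2) \<or> n = 2 * (n div 2) + 1 \<and> (1 :: complex) = -1" using n by simp
    show "coefficient_chart n (n div 2) (\<lambda>i. n - 1 - i) (square_polys n)"
      by (rule square_polys_chart[OF n])
    show "char_poly X \<in> square_polys n" if "S \<in> carrier_mat n n" "X \<in> carrier_mat n n" "det S \<noteq> 0"
      "S\<^sup>T = (- 1) \<cdot>\<^sub>m S" "S * X = 1 \<cdot>\<^sub>m X\<^sup>T * S" for S X :: "complex mat"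
    proof (rule char_poly_square_of_skew_pencil[OF that(1,3) _ that(2)])
      show "S\<^sup>T = - S" unfolding that(4) by (rule eq_matI) auto
      show "S * X = X\<^sup>T * S" using that(5) by (simp add: one_smult_mat)
    qed
    fix A B C :: "complex mat"
    assume A: "A \<in> carrier_mat n n" and B: "B \<in> carrier_mat n m" and C: "C \<in> carrier_mat m n"
    have "transfer_function (1 \<cdot>\<^sub>m A) B ((- 1) \<cdot>\<^sub>m C) = - transfer_function A B C"
      using transfer_function_smult_output[OF A B C] by (simp add: one_smult_mat)
    then show "transfer_function A B C \<in> skew_symmetric_tfs m n \<longleftrightarrow>
      transfer_function A B C \<in> transfer_functions m n \<and>
      (\<forall>p. (markov A B C p)\<^sup>T = (- 1 * 1 ^ p) \<cdot>\<^sub>m markov A B C p)"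
      using transpose_eq_iff_markov_symmetric[OF A B C, of 1] by (simp add: skew_symmetric_tfs_def)
  qed auto
qed

lemma skew_hamiltonian_generic_iff:
  assumes m: "m > 0"
  shows "generic m n (skew_hamiltonian_tfs m n) (pole_assignable m n (reflection_polys n)) \<longleftrightarrow>
    n div 2 \<le> m choose 2"
proof
  assume "generic m n (skew_hamiltonian_tfs m n) (pole_assignable m n (reflection_polys n))"
  then show "n div 2 \<le> m choose 2"
    using not_pole_assignable_if_few_parameters[OF reflection_polys_chart] generic_imp_exists
    by (meson not_le)
next
  assume N: "n div 2 \<le> m choose 2"
  show "generic m n (skew_hamiltonian_tfs m n) (pole_assignable m n (reflection_polys n))"
  proof (rule generic_pole_assignable[OF m N, where \<sigma> = "-1" and idx = "\<lambda>k. 2 * k + 1" and s = 1 and t = 2])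
    show "n = 2 * (n div 2) \<or> n = 2 * (n div 2) + 1 \<and> (-1 :: complex) = -1" by auto
    show "(-1 :: complex) ^ Suc i = 1 \<longleftrightarrow> i \<in> range (\<lambda>k. 2 * k + 1)" for i
      by (cases "even i") (auto elim: oddE)
    show "coefficient_chart n (n div 2) (\<lambda>i. n - 1 - (2 * i + 1)) (reflection_polys n)"
      by (rule reflection_polys_chart)
    show "char_poly X \<in> reflection_polys n" if "S \<in> carrier_mat n n" "X \<in> carrier_mat n n" "det S \<noteq> 0"
      "S\<^sup>T = (- (-1)) \<cdot>\<^sub>m S" "S * X = (-1) \<cdot>\<^sub>m X\<^sup>T * S" for S X :: "complex mat"
    proof (rule char_poly_reflection_of_intertwiner[OF that(1,3,2)])
      have "(-1) \<cdot>\<^sub>m X\<^sup>T = - X\<^sup>T" by (rule eq_matI) auto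
      then show "S * X = - X\<^sup>T * S" using that(5) by simp
    qed
    fix A B C :: "complex mat"
    assume A: "A \<in> carrier_mat n n" and B: "B \<in> carrier_mat n m" and C: "C \<in> carrier_mat m n"
    have "(-1) \<cdot>\<^sub>m A = - A" by (rule eq_matI) auto
    then have "transfer_function ((-1) \<cdot>\<^sub>m A) B ((- (-1)) \<cdot>\<^sub>m C) =
      - map_mat rat_reflect (transfer_function A B C)"
      using transfer_function_reflect[OF A B C] by (simp add: one_smult_mat)
    then show "transfer_function A B C \<in> skew_hamiltonian_tfs m n \<longleftrightarrow>
      transfer_function A B C \<in> transfer_functions m n \<and>
      (\<forall>p. (markov A B C p)\<^sup>T = (- (-1) * (-1) ^ p) \<cdot>\<^sub>m markov A B C p)"
      using transpose_eq_iff_markov_symmetric[OF A B C, of "-1"]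
      by (simp add: skew_hamiltonian_tfs_def)
  qed auto
qed

theorem theorem2:
  fixes m n :: nat
  assumes "m > 0" and "n > 0"
  shows "(even n \<longrightarrow>
      (generic m n (skew_symmetric_tfs m n) (pole_assignable m n (square_polys n)) \<longleftrightarrow>
        n div 2 \<le> m choose 2)) \<and>
    (generic m n (skew_hamiltonian_tfs m n) (pole_assignable m n (reflection_polys n)) \<longleftrightarrow>
      n div 2 \<le> m choose 2)"
  using skew_symmetric_generic_iff[OF assms(1)] skew_hamiltonian_generic_iff[OF assms(1)] by blast

end
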